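(* Let $S$ be a spacelike codimension-two embedded submanifold of a spacetime $(M,g)$ of dimension $n+2\ge4$ with a lightlike normal vector field $\xi$. Let $\Sigma=\Phi(\mathscr O)$ be the lightlike hypersurface emanating from $S$ by the normal exponential construction along $\xi$ (see context), and assume that $\Sigma$ is totally umbilical. Let $F=\pi\circ\Phi^{-1}\colon\Sigma\to S$, and let $U$, $\mathcal S$ be the associated geodesic extension of $\xi$ and screen distribution. Then: (a) For any $X,Y\in\mathfrak X(\Sigma)$ and each $q=\Phi(p,t)\in\Sigma$, the induced degenerate metric satisfies $$g_q(X_q,Y_q)=\Omega(q)\,g_p\bigl(\mathrm dF_q(X_q),\mathrm dF_q(Y_q)\bigr),$$ where $$\Omega\bigl(\Phi(p,t)\bigr)=\exp\left(-2\int_0^t\mu\bigl(\Phi(p,s)\bigr)\,ds\right),$$ and $\mu$ is determined by $B_U=\mu g$. (b) Let $L$ and $\overline L$ be two leaves of $\mathcal S$ such that $F|_L\colon L\to S$ and $F|_{\overline L}\colon\overline L\to S$ are diffeomorphisms. Then $G:=(F|_{\overline L})^{-1}\circ F|_L\colon L\to\overline L$ is conformal. Consequently, the Riemannian metrics induced on $L$ and $\overline L$ are globally conformally related. In particular, this applies to any two canonical leaves $S_t$ and $S_s$ with $s,t\in D$.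
   Context: A spacetime is a connected time-oriented Lorentzian manifold of signature $(-,+,\dots,+)$, with Levi-Civita connection $\widetilde\nabla$; lightlike vectors are nonzero null vectors; $S$ is connected of dimension $n$ with induced Riemannian metric, also denoted $g$. Normal exponential construction: choose an open neighborhood $\mathscr V$ of the zero section of the normal bundle $T^\perp S$, fiberwise star-shaped about $0$, such that the normal exponential map $\exp^\perp$ restricts to a diffeomorphism from $\mathscr V$ onto an open neighborhood of $S$ in $M$. Put $\mathscr O=\{(p,t)\in S\times\mathbb R: t\xi_p\in\mathscr V\}$, $\Phi\colon\mathscr O\to M$, $\Phi(p,t)=\exp^\perp_p(t\xi_p)$, and $\Sigma=\Phi(\mathscr O)$. Then $\Phi$ is an embedding and $\Sigma$ is a lightlike hypersurface (the induced metric is everywhere degenerate) containing $S=\Phi(S\times\{0\})$; $U=\Phi_*(\partial_t)$ is a lightlike vector field on $\Sigma$ with $\widetilde\nabla_UU=0$, $U|_S=\xi$, spanning the radical of the induced metric; $\mathcal S$ is the integrable screen distribution (complementary to $\operatorname{span}\{U\}$ in $T\Sigma$) given by the images under $\Phi_*$ of the tangent spaces to the slices $\{t=\text{const}\}$ of $\mathscr O$. $\pi\colon\mathscr O\to S$ is the projection. $I_p=\{t:(p,t)\in\mathscr O\}$ is an open interval containing $0$, $D=\bigcap_{p\in S}I_p$, and for $t\in D$ the canonical leaf is $S_t=\Phi(S\times\{t\})$, which is a leaf of $\mathcal S$ on which $F$ restricts to a diffeomorphism onto $S$. $B_U(X,Y)=-g(\widetilde\nabla_XU,Y)$ on $\Sigma$;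 $\Sigma$ is totally umbilical if $B_U=\mu g$ for a smooth function $\mu$ on $\Sigma$. *)

theory Defs
  imports "HOL-Analysis.Analysis"
begin

section \<open>Smooth maps between Euclidean spaces\<close>

text \<open>On an open subset of a Euclidean space, \<open>C\<^sup>k\<close> is iterated differentiability in all
  directions, with continuous derivatives.\<close>

primrec Ck_on :: "nat \<Rightarrow> 'a::real_normed_vector set \<Rightarrow> ('a \<Rightarrow> 'b::real_normed_vector) \<Rightarrow> bool"
  where
    "Ck_on 0 X f \<longleftrightarrow> continuous_on X f"
  | "Ck_on (Suc k) X f \<longleftrightarrow>
       (\<forall>x\<in>X. f differentiable at x) \<and> (\<forall>v. Ck_on k X (\<lambda>x. frechet_derivative f (at x) v))"

definition smooth_on :: "'a::real_normed_vector set \<Rightarrow> ('a \<Rightarrow> 'b::real_normed_vector) \<Rightarrow> bool"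
  where "smooth_on X f \<longleftrightarrow> (\<forall>k. Ck_on k X f)"

section \<open>Smooth manifolds\<close>

text \<open>A chart is a pair \<open>(D, \<phi>)\<close> of a domain and a coordinate map (only its values on \<open>D\<close> matter).
  A manifold is given by an atlas, not necessarily maximal; the atlas determines
  the underlying point set and the topology.  The dimension is that of the model space \<open>'e\<close>.\<close>

type_synonym ('m, 'e) chart = "'m set \<times> ('m \<Rightarrow> 'e)"
type_synonym ('m, 'e) mfld = "('m, 'e) chart set"

definition chart_inv :: "('m, 'e) chart \<Rightarrow> 'e \<Rightarrow> 'm"
  where "chart_inv c = inv_into (fst c) (snd c)"

definition carrier :: "('m, 'e) mfld \<Rightarrow> 'm set"
  where "carrier M = (\<Union>c\<in>M. fst c)"

definition mtop :: "('m, 'e::euclidean_space) mfld \<Rightarrow> 'm topology"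
  where "mtop M = topology_generated_by {{p\<in>D. \<phi> p \<in> B} | D \<phi> B. (D, \<phi>) \<in> M \<and> open B}"

definition smooth_manifold :: "('m, 'e::euclidean_space) mfld \<Rightarrow> bool"
  where "smooth_manifold M \<longleftrightarrow>
     (\<forall>c\<in>M. inj_on (snd c) (fst c) \<and> open (snd c ` fst c)) \<and>
     (\<forall>c\<in>M. \<forall>c'\<in>M. open (snd c ` (fst c \<inter> fst c')) \<and>
        smooth_on (snd c ` (fst c \<inter> fst c')) (snd c' \<circ> chart_inv c)) \<and>
     Hausdorff_space (mtop M) \<and> second_countable (mtop M)"

definition smooth_map ::
    "('m, 'e::euclidean_space) mfld \<Rightarrow> ('n, 'f::euclidean_space) mfld \<Rightarrow> ('m \<Rightarrow> 'n) \<Rightarrow> bool"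
  where "smooth_map M N f \<longleftrightarrow>
     f ` carrier M \<subseteq> carrier N \<and> continuous_map (mtop M) (mtop N) f \<and>
     (\<forall>c\<in>M. \<forall>c'\<in>N. smooth_on (snd c ` {p \<in> fst c. f p \<in> fst c'}) (snd c' \<circ> f \<circ> chart_inv c))"

definition diffeomorphism ::
    "('m, 'e::euclidean_space) mfld \<Rightarrow> ('n, 'f::euclidean_space) mfld \<Rightarrow> ('m \<Rightarrow> 'n) \<Rightarrow> bool"
  where "diffeomorphism M N f \<longleftrightarrow>
     bij_betw f (carrier M) (carrier N) \<and> smooth_map M N f \<and>
     smooth_map N M (inv_into (carrier M) f)"

definition real_line :: "(real, real) mfld"
  where "real_line = {(UNIV, id)}"

definition prod_mfld :: "('m, 'e) mfld \<Rightarrow> ('n, 'f) mfld \<Rightarrow> ('m \<times> 'n, 'e \<times> 'f) mfld"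
  where "prod_mfld M N =
     {(D \<times> E, \<lambda>(p, q). (\<phi> p, \<psi> q)) | D \<phi> E \<psi>. (D, \<phi>) \<in> M \<and> (E, \<psi>) \<in> N}"

text \<open>The open submanifold \<open>W\<close> of \<open>M\<close> (for open \<open>W\<close>).\<close>

definition open_sub :: "('m, 'e) mfld \<Rightarrow> 'm set \<Rightarrow> ('m, 'e) mfld"
  where "open_sub M W = {(D \<inter> W, \<phi>) | D \<phi>. (D, \<phi>) \<in> M}"

text \<open>The image of \<open>M\<close> under an injective map \<open>f\<close>, with the structure making \<open>f\<close> a
  diffeomorphism onto it.\<close>

definition image_mfld :: "('m \<Rightarrow> 'n) \<Rightarrow> ('m, 'e) mfld \<Rightarrow> ('n, 'e) mfld"
  where "image_mfld f M = {(f ` D, \<phi> \<circ> inv_into (carrier M) f) | D \<phi>. (D, \<phi>) \<in> M}"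

section \<open>Tangent vectors\<close>

text \<open>A chart \<open>chart_at M p\<close> is chosen around every point, and a tangent vector at \<open>p\<close> is identified
  with its components in that chart.  So every tangent space is a copy of the model space \<open>'e\<close>, and
  a vector field is a map \<open>'m \<Rightarrow> 'e\<close>.  The components in an arbitrary chart are obtained
  by \<open>to_chart\<close>, those in the chosen one from components in an arbitrary chart by \<open>from_chart\<close>.
  In particular smoothness of a vector field is not smoothness of the map \<open>'m \<Rightarrow> 'e\<close>, but of the
  section of the tangent bundle.\<close>

definition chart_at :: "('m, 'e) mfld \<Rightarrow> 'm \<Rightarrow> ('m, 'e) chart"
  where "chart_at M p = (SOME c. c \<in> M \<and> p \<in> fst c)"

definition to_chart ::
    "('m, 'e::euclidean_space) mfld \<Rightarrow> ('m, 'e) chart \<Rightarrow> 'm \<Rightarrow> 'e \<Rightarrow> 'e"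
  where "to_chart M c p =
     frechet_derivative (snd c \<circ> chart_inv (chart_at M p)) (at (snd (chart_at M p) p))"

definition from_chart ::
    "('m, 'e::euclidean_space) mfld \<Rightarrow> ('m, 'e) chart \<Rightarrow> 'm \<Rightarrow> 'e \<Rightarrow> 'e"
  where "from_chart M c p = frechet_derivative (snd (chart_at M p) \<circ> chart_inv c) (at (snd c p))"

text \<open>The differential \<open>T\<^sub>pM \<rightarrow> T\<^sub>f\<^sub>(\<^sub>p\<^sub>)N\<close> of \<open>f\<close> at \<open>p\<close>.\<close>

definition mfderiv ::
    "('m, 'e::euclidean_space) mfld \<Rightarrow> ('n, 'f::euclidean_space) mfld \<Rightarrow> ('m \<Rightarrow> 'n) \<Rightarrow> 'm \<Rightarrow> 'e \<Rightarrow> 'f"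
  where "mfderiv M N f p =
     frechet_derivative (snd (chart_at N (f p)) \<circ> f \<circ> chart_inv (chart_at M p))
       (at (snd (chart_at M p) p))"

definition velocity :: "('m, 'e::euclidean_space) mfld \<Rightarrow> (real \<Rightarrow> 'm) \<Rightarrow> real \<Rightarrow> 'e"
  where "velocity M \<gamma> t = mfderiv real_line M \<gamma> t 1"

definition tangent_bundle :: "('m, 'e::euclidean_space) mfld \<Rightarrow> ('m \<times> 'e, 'e \<times> 'e) mfld"
  where "tangent_bundle M =
     {(fst c \<times> UNIV, \<lambda>(p, v). (snd c p, to_chart M c p v)) | c. c \<in> M}"

definition vector_field_along ::
    "('n, 'f::euclidean_space) mfld \<Rightarrow> ('m, 'e::euclidean_space) mfld \<Rightarrow> ('n \<Rightarrow> 'm) \<Rightarrow> ('n \<Rightarrow> 'e) \<Rightarrow> bool"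
  where "vector_field_along N M f X \<longleftrightarrow> smooth_map N (tangent_bundle M) (\<lambda>p. (f p, X p))"

definition vector_field :: "('m, 'e::euclidean_space) mfld \<Rightarrow> ('m \<Rightarrow> 'e) \<Rightarrow> bool"
  where "vector_field M X \<longleftrightarrow> vector_field_along M M id X"

definition immersion ::
    "('m, 'e::euclidean_space) mfld \<Rightarrow> ('n, 'f::euclidean_space) mfld \<Rightarrow> ('m \<Rightarrow> 'n) \<Rightarrow> bool"
  where "immersion M N f \<longleftrightarrow> smooth_map M N f \<and> (\<forall>p\<in>carrier M. inj (mfderiv M N f p))"

definition embedded_submanifold ::
    "('m, 'e::euclidean_space) mfld \<Rightarrow> ('m, 'f::euclidean_space) mfld \<Rightarrow> bool"
  where "embedded_submanifold S M \<longleftrightarrow>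
     smooth_manifold S \<and> immersion S M id \<and> mtop S = subtopology (mtop M) (carrier S)"

section \<open>Metrics\<close>

text \<open>The value at the point with coordinates \<open>x\<close> in chart \<open>c\<close>, on vectors given by their
  components in \<open>c\<close>.\<close>

definition metric_in_chart ::
    "('m, 'e::euclidean_space) mfld \<Rightarrow> ('m \<Rightarrow> 'e \<Rightarrow> 'e \<Rightarrow> real) \<Rightarrow> ('m, 'e) chart \<Rightarrow> 'e \<Rightarrow> 'e \<Rightarrow> 'e \<Rightarrow> real"
  where "metric_in_chart M g c x u v =
     (let p = chart_inv c x in g p (from_chart M c p u) (from_chart M c p v))"

definition symmetric_tensor ::
    "('m, 'e::euclidean_space) mfld \<Rightarrow> ('m \<Rightarrow> 'e \<Rightarrow> 'e \<Rightarrow> real) \<Rightarrow> bool"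
  where "symmetric_tensor M g \<longleftrightarrow>
     (\<forall>p\<in>carrier M. bilinear (g p) \<and> (\<forall>u v. g p u v = g p v u)) \<and>
     (\<forall>c\<in>M. \<forall>u v. smooth_on (snd c ` fst c) (\<lambda>x. metric_in_chart M g c x u v))"

definition riemannian_metric ::
    "('m, 'e::euclidean_space) mfld \<Rightarrow> ('m \<Rightarrow> 'e \<Rightarrow> 'e \<Rightarrow> real) \<Rightarrow> bool"
  where "riemannian_metric M g \<longleftrightarrow>
     symmetric_tensor M g \<and> (\<forall>p\<in>carrier M. \<forall>v. v \<noteq> 0 \<longrightarrow> g p v v > 0)"

text \<open>Signature \<open>(-,+,\<dots>,+)\<close>: in a suitable basis, the image under \<open>e\<close> of the
  standard one, the matrix of \<open>b\<close> is diagonal with a single entry \<open>-1\<close> (at \<open>i\<close>) and the others \<open>1\<close>.\<close>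

definition lorentzian_form :: "('e::euclidean_space \<Rightarrow> 'e \<Rightarrow> real) \<Rightarrow> bool"
  where "lorentzian_form b \<longleftrightarrow>
     (\<exists>i\<in>Basis. \<exists>e :: 'e \<Rightarrow> 'e. linear e \<and> bij e \<and>
        (\<forall>x y. b (e x) (e y) = x \<bullet> y - 2 * (x \<bullet> i) * (y \<bullet> i)))"

definition lorentzian_metric ::
    "('m, 'e::euclidean_space) mfld \<Rightarrow> ('m \<Rightarrow> 'e \<Rightarrow> 'e \<Rightarrow> real) \<Rightarrow> bool"
  where "lorentzian_metric M g \<longleftrightarrow> symmetric_tensor M g \<and> (\<forall>p\<in>carrier M. lorentzian_form (g p))"

text \<open>The time orientation is given by a timelike vector field \<open>T\<close>.\<close>

definition spacetime ::
    "('m, 'e::euclidean_space) mfld \<Rightarrow> ('m \<Rightarrow> 'e \<Rightarrow> 'e \<Rightarrow> real) \<Rightarrow> ('m \<Rightarrow> 'e) \<Rightarrow> bool"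
  where "spacetime M g T \<longleftrightarrow>
     smooth_manifold M \<and> connected_space (mtop M) \<and> lorentzian_metric M g \<and>
     vector_field M T \<and> (\<forall>p\<in>carrier M. g p (T p) (T p) < 0)"

definition pullback_metric ::
    "('n, 'f::euclidean_space) mfld \<Rightarrow> ('m, 'e::euclidean_space) mfld \<Rightarrow> ('n \<Rightarrow> 'm) \<Rightarrow>
       ('m \<Rightarrow> 'e \<Rightarrow> 'e \<Rightarrow> real) \<Rightarrow> 'n \<Rightarrow> 'f \<Rightarrow> 'f \<Rightarrow> real"
  where "pullback_metric N M f g p u v = g (f p) (mfderiv N M f p u) (mfderiv N M f p v)"

definition induced_metric ::
    "('m, 'f::euclidean_space) mfld \<Rightarrow> ('m, 'e::euclidean_space) mfld \<Rightarrow>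
       ('m \<Rightarrow> 'e \<Rightarrow> 'e \<Rightarrow> real) \<Rightarrow> 'm \<Rightarrow> 'f \<Rightarrow> 'f \<Rightarrow> real"
  where "induced_metric N M g = pullback_metric N M id g"

definition conformal_map ::
    "('n, 'f::euclidean_space) mfld \<Rightarrow> ('n \<Rightarrow> 'f \<Rightarrow> 'f \<Rightarrow> real) \<Rightarrow>
     ('m, 'e::euclidean_space) mfld \<Rightarrow> ('m \<Rightarrow> 'e \<Rightarrow> 'e \<Rightarrow> real) \<Rightarrow> ('n \<Rightarrow> 'm) \<Rightarrow> bool"
  where "conformal_map N h M g f \<longleftrightarrow>
     smooth_map N M f \<and>
     (\<exists>\<rho>. smooth_map N real_line \<rho> \<and>
        (\<forall>p\<in>carrier N. \<rho> p > 0 \<and> (\<forall>u v. pullback_metric N M f g p u v = \<rho> p * h p u v)))"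

definition globally_conformally_related ::
    "('n, 'f::euclidean_space) mfld \<Rightarrow> ('n \<Rightarrow> 'f \<Rightarrow> 'f \<Rightarrow> real) \<Rightarrow>
     ('m, 'e::euclidean_space) mfld \<Rightarrow> ('m \<Rightarrow> 'e \<Rightarrow> 'e \<Rightarrow> real) \<Rightarrow> bool"
  where "globally_conformally_related N h M g \<longleftrightarrow>
     riemannian_metric N h \<and> riemannian_metric M g \<and>
     (\<exists>f. diffeomorphism N M f \<and> conformal_map N h M g f)"

section \<open>Connections\<close>

text \<open>An affine connection is given by its Christoffel symbols: \<open>\<Gamma> c x u v\<close> are the components, in
  the chart \<open>c\<close> and at the point with coordinates \<open>x\<close>, of the derivative in direction \<open>u\<close> of the
  vector field with constant components \<open>v\<close>.  The last clause is the transformation law under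
  a change of coordinates \<open>\<tau>\<close>, which says that \<open>D\<^sub>u Y + \<Gamma>(u, Y)\<close> transforms as a vector.\<close>

type_synonym ('m, 'e) christoffel = "('m, 'e) chart \<Rightarrow> 'e \<Rightarrow> 'e \<Rightarrow> 'e \<Rightarrow> 'e"

definition affine_connection ::
    "('m, 'e::euclidean_space) mfld \<Rightarrow> ('m, 'e) christoffel \<Rightarrow> bool"
  where "affine_connection M \<Gamma> \<longleftrightarrow>
     (\<forall>c\<in>M. \<forall>x\<in>snd c ` fst c. bilinear (\<Gamma> c x)) \<and>
     (\<forall>c\<in>M. \<forall>u v. smooth_on (snd c ` fst c) (\<lambda>x. \<Gamma> c x u v)) \<and>
     (\<forall>c\<in>M. \<forall>c'\<in>M. \<forall>x\<in>snd c ` (fst c \<inter> fst c'). \<forall>u v.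
        (let \<tau> = snd c' \<circ> chart_inv c; D\<tau> = (\<lambda>y. frechet_derivative \<tau> (at y)) in
           \<Gamma> c' (\<tau> x) (D\<tau> x u) (D\<tau> x v) =
             D\<tau> x (\<Gamma> c x u v) - frechet_derivative (\<lambda>y. D\<tau> y v) (at x) u))"

text \<open>The torsion-free connection compatible with \<open>g\<close>.\<close>

definition levi_civita ::
    "('m, 'e::euclidean_space) mfld \<Rightarrow> ('m \<Rightarrow> 'e \<Rightarrow> 'e \<Rightarrow> real) \<Rightarrow> ('m, 'e) christoffel \<Rightarrow> bool"
  where "levi_civita M g \<Gamma> \<longleftrightarrow>
     affine_connection M \<Gamma> \<and>
     (\<forall>c\<in>M. \<forall>x\<in>snd c ` fst c. \<forall>u v. \<Gamma> c x u v = \<Gamma> c x v u) \<and>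
     (\<forall>c\<in>M. \<forall>x\<in>snd c ` fst c. \<forall>u v w.
        frechet_derivative (\<lambda>y. metric_in_chart M g c y v w) (at x) u =
          metric_in_chart M g c x (\<Gamma> c x u v) w + metric_in_chart M g c x v (\<Gamma> c x u w))"

text \<open>The covariant derivative in direction \<open>w \<in> T\<^sub>pN\<close> of a vector field \<open>X\<close> along \<open>f : N \<rightarrow> M\<close>,
  computed in the chosen chart of \<open>M\<close> at \<open>f p\<close>.\<close>

definition cov_deriv ::
    "('n, 'f::euclidean_space) mfld \<Rightarrow> ('m, 'e::euclidean_space) mfld \<Rightarrow> ('m, 'e) christoffel \<Rightarrow>
       ('n \<Rightarrow> 'm) \<Rightarrow> ('n \<Rightarrow> 'e) \<Rightarrow> 'n \<Rightarrow> 'f \<Rightarrow> 'e"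
  where "cov_deriv N M \<Gamma> f X p w =
     (let a = chart_at N p; c = chart_at M (f p) in
        frechet_derivative (\<lambda>y. let r = chart_inv a y in to_chart M c (f r) (X r)) (at (snd a p)) w +
        \<Gamma> c (snd c (f p)) (mfderiv N M f p w) (X p))"

definition geodesic_on ::
    "('m, 'e::euclidean_space) mfld \<Rightarrow> ('m, 'e) christoffel \<Rightarrow> real set \<Rightarrow> (real \<Rightarrow> 'm) \<Rightarrow> bool"
  where "geodesic_on M \<Gamma> J \<gamma> \<longleftrightarrow>
     smooth_map (open_sub real_line J) M \<gamma> \<and>
     (\<forall>t\<in>J. cov_deriv real_line M \<Gamma> \<gamma> (velocity M \<gamma>) t 1 = 0)"

definition exp_rel ::
    "('m, 'e::euclidean_space) mfld \<Rightarrow> ('m, 'e) christoffel \<Rightarrow> 'm \<times> 'e \<Rightarrow> 'm \<Rightarrow> bool"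
  where "exp_rel M \<Gamma> z q \<longleftrightarrow>
     (\<exists>J \<gamma>. open J \<and> is_interval J \<and> {0..1} \<subseteq> J \<and> geodesic_on M \<Gamma> J \<gamma> \<and>
        \<gamma> 0 = fst z \<and> velocity M \<gamma> 0 = snd z \<and> \<gamma> 1 = q)"

definition exp_domain ::
    "('m, 'e::euclidean_space) mfld \<Rightarrow> ('m, 'e) christoffel \<Rightarrow> ('m \<times> 'e) set"
  where "exp_domain M \<Gamma> = {z. \<exists>q. exp_rel M \<Gamma> z q}"

definition exp_map ::
    "('m, 'e::euclidean_space) mfld \<Rightarrow> ('m, 'e) christoffel \<Rightarrow> 'm \<times> 'e \<Rightarrow> 'm"
  where "exp_map M \<Gamma> z = (THE q. exp_rel M \<Gamma> z q)"

section \<open>The normal bundle of a submanifold of codimension two\<close>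

definition normal_space ::
    "('m, 'e::euclidean_space) mfld \<Rightarrow> ('m \<Rightarrow> 'e \<Rightarrow> 'e \<Rightarrow> real) \<Rightarrow> ('m, 'f::euclidean_space) mfld \<Rightarrow>
       'm \<Rightarrow> 'e set"
  where "normal_space M g S p = {v. \<forall>w. g p v (mfderiv S M id p w) = 0}"

definition normal_frame ::
    "('m, 'e::euclidean_space) mfld \<Rightarrow> ('m \<Rightarrow> 'e \<Rightarrow> 'e \<Rightarrow> real) \<Rightarrow> ('m, 'f::euclidean_space) mfld \<Rightarrow>
       'm set \<Rightarrow> ('m \<Rightarrow> 'e) \<Rightarrow> ('m \<Rightarrow> 'e) \<Rightarrow> bool"
  where "normal_frame M g S W e1 e2 \<longleftrightarrow>
     vector_field_along (open_sub S W) M id e1 \<and> vector_field_along (open_sub S W) M id e2 \<and>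
     (\<forall>p\<in>W. e1 p \<in> normal_space M g S p \<and> e2 p \<in> normal_space M g S p \<and>
        (\<forall>a b. a *\<^sub>R e1 p + b *\<^sub>R e2 p = 0 \<longrightarrow> a = 0 \<and> b = 0))"

text \<open>The charts of the normal bundle: a chart of \<open>S\<close> and the two components with respect to a local
  frame.  Codimension two is built in.\<close>

definition normal_bundle ::
    "('m, 'e::euclidean_space) mfld \<Rightarrow> ('m \<Rightarrow> 'e \<Rightarrow> 'e \<Rightarrow> real) \<Rightarrow> ('m, 'f::euclidean_space) mfld \<Rightarrow>
       ('m \<times> 'e, 'f \<times> real \<times> real) mfld"
  where "normal_bundle M g S =
     {({(p, v). p \<in> D \<inter> W \<and> v \<in> normal_space M g S p},
       \<lambda>(p, v). (\<phi> p, THE ab. v = fst ab *\<^sub>R e1 p + snd ab *\<^sub>R e2 p)) | D \<phi> W e1 e2.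
       (D, \<phi>) \<in> S \<and> openin (mtop S) W \<and> normal_frame M g S W e1 e2}"

definition normal_exp_neighborhood ::
    "('m, 'e::euclidean_space) mfld \<Rightarrow> ('m \<Rightarrow> 'e \<Rightarrow> 'e \<Rightarrow> real) \<Rightarrow> ('m, 'e) christoffel \<Rightarrow>
       ('m, 'f::euclidean_space) mfld \<Rightarrow> ('m \<times> 'e) set \<Rightarrow> bool"
  where "normal_exp_neighborhood M g \<Gamma> S V \<longleftrightarrow>
     openin (mtop (normal_bundle M g S)) V \<and>
     (\<forall>p\<in>carrier S. (p, 0) \<in> V) \<and>
     (\<forall>p v s. (p, v) \<in> V \<and> 0 \<le> s \<and> s \<le> 1 \<longrightarrow> (p, s *\<^sub>R v) \<in> V) \<and>
     V \<subseteq> exp_domain M \<Gamma> \<and>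
     (\<exists>W. openin (mtop M) W \<and> carrier S \<subseteq> W \<and>
        diffeomorphism (open_sub (normal_bundle M g S) V) (open_sub M W) (exp_map M \<Gamma>))"

definition lightlike_normal_field ::
    "('m, 'e::euclidean_space) mfld \<Rightarrow> ('m \<Rightarrow> 'e \<Rightarrow> 'e \<Rightarrow> real) \<Rightarrow> ('m, 'f::euclidean_space) mfld \<Rightarrow>
       ('m \<Rightarrow> 'e) \<Rightarrow> bool"
  where "lightlike_normal_field M g S \<xi> \<longleftrightarrow>
     vector_field_along S M id \<xi> \<and>
     (\<forall>p\<in>carrier S. \<xi> p \<in> normal_space M g S p \<and> \<xi> p \<noteq> 0 \<and> g p (\<xi> p) (\<xi> p) = 0)"

section \<open>The lightlike hypersurface emanating from \<open>S\<close>\<close>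

definition flow_domain ::
    "('m, 'f) mfld \<Rightarrow> ('m \<Rightarrow> 'e::euclidean_space) \<Rightarrow> ('m \<times> 'e) set \<Rightarrow> ('m \<times> real) set"
  where "flow_domain S \<xi> V = {(p, t). p \<in> carrier S \<and> (p, t *\<^sub>R \<xi> p) \<in> V}"

definition flow_mfld ::
    "('m, 'f) mfld \<Rightarrow> ('m \<Rightarrow> 'e::euclidean_space) \<Rightarrow> ('m \<times> 'e) set \<Rightarrow> ('m \<times> real, 'f \<times> real) mfld"
  where "flow_mfld S \<xi> V = open_sub (prod_mfld S real_line) (flow_domain S \<xi> V)"

definition flow_map ::
    "('m, 'e::euclidean_space) mfld \<Rightarrow> ('m, 'e) christoffel \<Rightarrow> ('m \<Rightarrow> 'e) \<Rightarrow> 'm \<times> real \<Rightarrow> 'm"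
  where "flow_map M \<Gamma> \<xi> = (\<lambda>(p, t). exp_map M \<Gamma> (p, t *\<^sub>R \<xi> p))"

text \<open>In the following, \<open>\<O>\<close> is a manifold with points in \<open>S \<times> \<real>\<close>, \<open>\<Phi>\<close> is injective on it and
  \<open>\<Sigma>\<close> is its image.\<close>

text \<open>The vector field \<open>\<Phi>\<^sub>*(\<partial>\<^sub>t)\<close> on \<open>\<Sigma>\<close>; \<open>\<partial>\<^sub>t\<close> is the velocity of \<open>s \<mapsto> (p, s)\<close>.\<close>

definition push_dt ::
    "('m \<times> real, 'k::euclidean_space) mfld \<Rightarrow> ('m, 'k) mfld \<Rightarrow> ('m \<times> real \<Rightarrow> 'm) \<Rightarrow> 'm \<Rightarrow> 'k"
  where "push_dt \<O> \<Sigma> \<Phi> q =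
     (let z = inv_into (carrier \<O>) \<Phi> q in
        mfderiv \<O> \<Sigma> \<Phi> z (velocity \<O> (\<lambda>s. (fst z, s)) (snd z)))"

text \<open>The image under \<open>\<Phi>\<^sub>*\<close> of the tangent spaces to the slices \<open>{t = const}\<close>.\<close>

definition screen_distribution ::
    "('m, 'f::euclidean_space) mfld \<Rightarrow> ('m \<times> real, 'k::euclidean_space) mfld \<Rightarrow> ('m, 'k) mfld \<Rightarrow>
       ('m \<times> real \<Rightarrow> 'm) \<Rightarrow> 'm \<Rightarrow> 'k set"
  where "screen_distribution S \<O> \<Sigma> \<Phi> q =
     (let z = inv_into (carrier \<O>) \<Phi> q in
        mfderiv \<O> \<Sigma> \<Phi> z ` range (mfderiv S \<O> (\<lambda>p. (p, snd z)) (fst z)))"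

text \<open>Integral manifolds and leaves carry their own, possibly finer, topology.\<close>

definition integral_manifold ::
    "('m, 'k::euclidean_space) mfld \<Rightarrow> ('m \<Rightarrow> 'k set) \<Rightarrow> ('m, 'f::euclidean_space) mfld \<Rightarrow> bool"
  where "integral_manifold N E L \<longleftrightarrow>
     smooth_manifold L \<and> immersion L N id \<and> (\<forall>q\<in>carrier L. range (mfderiv L N id q) = E q)"

definition leaf ::
    "('m, 'k::euclidean_space) mfld \<Rightarrow> ('m \<Rightarrow> 'k set) \<Rightarrow> ('m, 'f::euclidean_space) mfld \<Rightarrow> bool"
  where "leaf N E L \<longleftrightarrow>
     integral_manifold N E L \<and> connected_space (mtop L) \<and>
     (\<forall>L' :: ('m, 'f) mfld. integral_manifold N E L' \<and> connected_space (mtop L') \<and>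
        carrier L \<subseteq> carrier L' \<longrightarrow> carrier L' = carrier L)"

text \<open>\<open>B\<^sub>U(x, y) = - g(\<nabla>\<^sub>x U, y)\<close> for \<open>x, y \<in> T\<^sub>q\<Sigma>\<close>, where \<open>U\<close> is regarded as a vector field of \<open>M\<close>
  along \<open>\<Sigma>\<close>.\<close>

definition null_second_fundamental_form ::
    "('m, 'e::euclidean_space) mfld \<Rightarrow> ('m \<Rightarrow> 'e \<Rightarrow> 'e \<Rightarrow> real) \<Rightarrow> ('m, 'e) christoffel \<Rightarrow>
       ('m, 'k::euclidean_space) mfld \<Rightarrow> ('m \<Rightarrow> 'k) \<Rightarrow> 'm \<Rightarrow> 'k \<Rightarrow> 'k \<Rightarrow> real"
  where "null_second_fundamental_form M g \<Gamma> \<Sigma> U q x y =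
     - g q (cov_deriv \<Sigma> M \<Gamma> id (\<lambda>r. mfderiv \<Sigma> M id r (U r)) q x) (mfderiv \<Sigma> M id q y)"

definition totally_umbilical_with ::
    "('m, 'e::euclidean_space) mfld \<Rightarrow> ('m \<Rightarrow> 'e \<Rightarrow> 'e \<Rightarrow> real) \<Rightarrow> ('m, 'e) christoffel \<Rightarrow>
       ('m, 'k::euclidean_space) mfld \<Rightarrow> ('m \<Rightarrow> 'k) \<Rightarrow> ('m \<Rightarrow> real) \<Rightarrow> bool"
  where "totally_umbilical_with M g \<Gamma> \<Sigma> U \<mu> \<longleftrightarrow>
     smooth_map \<Sigma> real_line \<mu> \<and>
     (\<forall>q\<in>carrier \<Sigma>. \<forall>x y.
        null_second_fundamental_form M g \<Gamma> \<Sigma> U q x y = \<mu> q * induced_metric \<Sigma> M g q x y)"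

end

theory Submission
  imports Defs
begin

text \<open>
  Let \<open>H\<close> be the metric of \<open>M\<close> pulled back along \<open>\<Phi>\<close>, evaluated on two vectors of \<open>S \<times> \<real>\<close> with
  constant components in a product chart.  Since \<open>\<Gamma>\<close> is torsion-free and metric,
  \<open>\<partial>\<^sub>t H(x, y) = g(\<nabla>\<^sub>x U, y) + g(x, \<nabla>\<^sub>y U) = - 2 \<mu> H(x, y)\<close>.  Umbilicity is available for all vectors
  tangent to \<open>\<Sigma>\<close>, so this holds even when \<open>x\<close> or \<open>y\<close> is \<open>\<partial>\<^sub>t\<close>, and neither \<open>\<nabla>\<^sub>U U = 0\<close> nor the
  lightlikeness of \<open>U\<close> away from \<open>S\<close> has to be shown.  Hence \<open>H\<^sub>t = \<Omega> H\<^sub>0\<close>, and at \<open>t = 0\<close>, where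
  \<open>\<Phi>\<^sub>* (u, r) = u + r \<xi>\<close> with \<open>\<xi>\<close> null and normal, \<open>H\<^sub>0((u, r), (v, s)) = g(u, v)\<close>.  Uniqueness of geodesics enters
  only through these initial values, the exponential map being a definite description.

  On a section of \<open>F\<close> the formula says that the induced metric is \<open>\<Omega>\<close> times the pullback of the metric of
  \<open>S\<close>, which makes any two sections conformal; the conformal factor is smooth as a quotient of
  metric coefficients.  A canonical leaf is maximal since \<open>dt\<close> vanishes on the screen distribution.
\<close>

section \<open>Calculus of smooth maps\<close>

text \<open>A tangent vector is a tuple of components in a chart chosen separately at every point,
  so fields and frames jump where the choice changes and cannot be differentiated as plain
  functions. All computations are therefore moved to fixed charts, a product chart of the cylinder
  and a chart of \<open>M\<close>, between which \<open>\<Phi>\<close> is one smooth map of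
  Euclidean spaces. There the t-derivative of d\<Phi>(x) equals the derivative of d\<Phi>(0, 1) in
  direction x, by symmetry of second derivatives; symmetric Christoffel symbols turn this into the
  covariant derivative of U in direction x, on which umbilicity acts. Smoothness of
  \<open>\<Phi>\<close> has to be drawn from the exponential map on the normal bundle, whose charts
  use arbitrary smooth normal frames. The components of t\<xi> in such a frame are smooth by
  Cramer's rule, and the frame spans because normal spaces have dimension two, a consequence of
  nondegeneracy and the dimension hypothesis. Comparing metric coefficients for the conformal factor
  avoids differentiating the integral in the exponent with respect to the base point.\<close>

lemma Ck_on_subset: "Ck_on k Y f \<Longrightarrow> X \<subseteq> Y \<Longrightarrow> Ck_on k X f"
  by (induction k arbitrary: f) (auto intro: continuous_on_subset)

lemma smooth_on_subset: "smooth_on Y f \<Longrightarrow> X \<subseteq> Y \<Longrightarrow> smooth_on X f"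
  unfolding smooth_on_def using Ck_on_subset by blast

text \<open>Derivatives are taken at a point of the whole space, never within \<open>X\<close>, so
  every clause of \<open>Ck_on\<close> is decided by arbitrarily small neighbourhoods.\<close>

lemma Ck_on_local:
  assumes "\<And>x. x \<in> X \<Longrightarrow> \<exists>Y. open Y \<and> x \<in> Y \<and> Ck_on k Y f"
  shows "Ck_on k X f"
  using assms
proof (induction k arbitrary: f)
  case 0
  have "\<forall>x\<in>X. isCont f x"
    using 0 by (metis Ck_on.simps(1) continuous_on_eq_continuous_at)
  then show ?case by (simp add: continuous_at_imp_continuous_on)
next
  case (Suc k)
  have "f differentiable at x" if "x \<in> X" for x
    using Suc.prems[OF that] by auto
  moreover have "Ck_on k X (\<lambda>x. frechet_derivative f (at x) v)" for v
    by (rule Suc.IH) (use Suc.prems in fastforce)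
  ultimately show ?case by simp
qed

lemma smooth_on_local:
  assumes "\<And>x. x \<in> X \<Longrightarrow> \<exists>Y. open Y \<and> x \<in> Y \<and> smooth_on Y f"
  shows "smooth_on X f"
  unfolding smooth_on_def
  by (intro allI Ck_on_local) (use assms smooth_on_def in blast)

lemma frechet_derivative_cong_open:
  assumes "open X" "x \<in> X" "\<And>y. y \<in> X \<Longrightarrow> f y = h y"
  shows "frechet_derivative f (at x) = frechet_derivative h (at x)"
proof -
  have "(f has_derivative D) (at x) \<longleftrightarrow> (h has_derivative D) (at x)" for D
    using has_derivative_transform_within_open[of f D x UNIV X h]
      has_derivative_transform_within_open[of h D x UNIV X f] assms by auto
  then show ?thesis by (simp add: frechet_derivative_def)
qed

lemma differentiable_cong_open:
  assumes "open X" "x \<in> X" "\<And>y. y \<in> X \<Longrightarrow> f y = h y" "h differentiable at x"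
  shows "f differentiable at x"
  using has_derivative_transform_within_open[of h _ x UNIV X f] assms
  by (auto simp: differentiable_def)

text \<open>Openness of \<open>X\<close> turns agreement on \<open>X\<close> into agreement near
  each of its points, so the derivatives agree too and the induction continues with them.\<close>

lemma Ck_on_cong:
  assumes "open X" "\<And>x. x \<in> X \<Longrightarrow> f x = h x" "Ck_on k X h"
  shows "Ck_on k X f"
  using assms
proof (induction k arbitrary: f h)
  case 0
  then show ?case by (simp cong: continuous_on_cong)
next
  case (Suc k)
  have "f differentiable at x" if "x \<in> X" for x
    using differentiable_cong_open[OF \<open>open X\<close> that Suc.prems(2)] Suc.prems that by simp
  moreover have "Ck_on k X (\<lambda>x. frechet_derivative f (at x) v)" for v
    by (rule Suc.IH[where h="\<lambda>x. frechet_derivative h (at x) v"])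
       (use Suc.prems frechet_derivative_cong_open[of X _ f h] in auto)
  ultimately show ?case by simp
qed

lemma smooth_on_cong:
  assumes "open X" "\<And>x. x \<in> X \<Longrightarrow> f x = h x" "smooth_on X h"
  shows "smooth_on X f"
  using assms Ck_on_cong unfolding smooth_on_def by metis

lemma Ck_on_Suc_D: "Ck_on (Suc k) X f \<Longrightarrow> Ck_on k X f"
proof (induction k arbitrary: f)
  case 0
  then show ?case
    by (auto intro!: continuous_at_imp_continuous_on differentiable_imp_continuous_within)
next
  case (Suc k)
  then show ?case by (metis Ck_on.simps(2))
qed

lemma smooth_on_differentiable: "smooth_on X f \<Longrightarrow> x \<in> X \<Longrightarrow> f differentiable at x"
  unfolding smooth_on_def by (metis Ck_on.simps(2))

lemma smooth_on_has_derivative: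
  "smooth_on X f \<Longrightarrow> x \<in> X \<Longrightarrow> (f has_derivative frechet_derivative f (at x)) (at x)"
  using smooth_on_differentiable frechet_derivative_works by blast

lemma smooth_on_linear_derivative:
  "smooth_on X f \<Longrightarrow> x \<in> X \<Longrightarrow> linear (frechet_derivative f (at x))"
  using smooth_on_differentiable linear_frechet_derivative by blast

lemma smooth_on_continuous: "smooth_on X f \<Longrightarrow> continuous_on X f"
  unfolding smooth_on_def by (metis Ck_on.simps(1))

lemma smooth_on_frechet_derivative:
  "smooth_on X f \<Longrightarrow> smooth_on X (\<lambda>x. frechet_derivative f (at x) v)"
  unfolding smooth_on_def by (metis Ck_on.simps(2))

lemma Ck_on_const: "Ck_on k X (\<lambda>x. c)"
  by (induction k arbitrary: c) auto

lemma smooth_on_const [intro, simp]: "smooth_on X (\<lambda>x. c)"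
  by (simp add: smooth_on_def Ck_on_const)

lemma bounded_linear_frechet:
  "bounded_linear L \<Longrightarrow> frechet_derivative L (at x) = L"
  by (metis bounded_linear_imp_has_derivative frechet_derivative_at)

lemma smooth_on_bounded_linear: 
  assumes "bounded_linear L" shows "smooth_on X L"
  unfolding smooth_on_def
proof
  fix k show "Ck_on k X L"
  proof (cases k)
    case 0
    then show ?thesis using assms by (simp add: linear_continuous_on)
  next
    case (Suc j)
    then show ?thesis
      using assms bounded_linear_imp_differentiable
      by (auto simp: bounded_linear_frechet Ck_on_const)
  qed
qed

lemma Ck_on_add:
  assumes "open X" "Ck_on k X f" "Ck_on k X h"
  shows "Ck_on k X (\<lambda>x. f x + h x)"
  using assms
proof (induction k arbitrary: f h)
  case 0
  then show ?case by (simp add: continuous_on_add)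
next
  case (Suc k)
  have "frechet_derivative (\<lambda>x. f x + h x) (at x) v =
    frechet_derivative f (at x) v + frechet_derivative h (at x) v" if "x \<in> X" for x v
    using fun_cong[OF frechet_derivative_at[OF has_derivative_add[of f "frechet_derivative f (at x)" "at x" h
        "frechet_derivative h (at x)"]], of v] Suc.prems that
    by (auto simp: frechet_derivative_works[symmetric])
  then have "Ck_on k X (\<lambda>x. frechet_derivative (\<lambda>x. f x + h x) (at x) v)" for v
    by (rule Ck_on_cong[OF \<open>open X\<close>]) (use Suc in auto)
  then show ?case using Suc.prems by auto
qed

lemma smooth_on_add: "open X \<Longrightarrow> smooth_on X f \<Longrightarrow> smooth_on X h \<Longrightarrow> smooth_on X (\<lambda>x. f x + h x)"
  by (simp add: smooth_on_def Ck_on_add)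

lemma (in bounded_bilinear) Ck_on_bilinear:
  assumes "open X" "Ck_on k X f" "Ck_on k X h"
  shows "Ck_on k X (\<lambda>x. prod (f x) (h x))"
  using assms
proof (induction k arbitrary: f h)
  case 0
  then show ?case by (simp add: continuous_on)
next
  case (Suc k)
  have D: "frechet_derivative (\<lambda>x. prod (f x) (h x)) (at x) v =
    prod (f x) (frechet_derivative h (at x) v) + prod (frechet_derivative f (at x) v) (h x)"
    and d: "(\<lambda>x. prod (f x) (h x)) differentiable at x"
    if "x \<in> X" for x v
  proof -
    have *: "((\<lambda>x. prod (f x) (h x)) has_derivative (\<lambda>v. prod (f x) (frechet_derivative h (at x) v) + prod (frechet_derivative f (at x) v) (h x))) (at x)"
      using Suc.prems that by (intro FDERIV) (auto simp: frechet_derivative_works[symmetric])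
    show "frechet_derivative (\<lambda>x. prod (f x) (h x)) (at x) v =
    prod (f x) (frechet_derivative h (at x) v) + prod (frechet_derivative f (at x) v) (h x)"
      using fun_cong[OF frechet_derivative_at[OF *], of v] by simp
    show "(\<lambda>x. prod (f x) (h x)) differentiable at x" using * by (rule differentiableI)
  qed
  have k: "Ck_on k X f" "Ck_on k X h" using Suc.prems Ck_on_Suc_D by blast+
  have "Ck_on k X (\<lambda>x. frechet_derivative (\<lambda>x. prod (f x) (h x)) (at x) v)" for v
  proof (rule Ck_on_cong[OF \<open>open X\<close> D])
    have "Ck_on k X (\<lambda>x. prod (f x) (frechet_derivative h (at x) v))"
      using Suc.IH[OF \<open>open X\<close>, of f "\<lambda>x. frechet_derivative h (at x) v"] Suc.prems k by simp
    moreover have "Ck_on k X (\<lambda>x. prod (frechet_derivative f (at x) v) (h x))"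
      using Suc.IH[OF \<open>open X\<close>, of "\<lambda>x. frechet_derivative f (at x) v" h] Suc.prems k by simp
    ultimately show "Ck_on k X (\<lambda>x. prod (f x) (frechet_derivative h (at x) v) + prod (frechet_derivative f (at x) v) (h x))"
      by (rule Ck_on_add[OF \<open>open X\<close>])
  qed
  then show ?case using d by simp
qed

lemma (in bounded_bilinear) smooth_on_bilinear:
  "open X \<Longrightarrow> smooth_on X f \<Longrightarrow> smooth_on X h \<Longrightarrow> smooth_on X (\<lambda>x. prod (f x) (h x))"
  by (simp add: smooth_on_def Ck_on_bilinear)

lemmas smooth_on_scaleR = bounded_bilinear.smooth_on_bilinear[OF bounded_bilinear_scaleR]
lemmas smooth_on_inner = bounded_bilinear.smooth_on_bilinear[OF bounded_bilinear_inner]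
lemmas smooth_on_mult = bounded_bilinear.smooth_on_bilinear[OF bounded_bilinear_mult]

lemma Ck_on_sum:
  assumes "open X" "\<And>i. i \<in> I \<Longrightarrow> Ck_on k X (f i)"
  shows "Ck_on k X (\<lambda>x. \<Sum>i\<in>I. f i x)"
  using assms(2)
  by (induction I rule: infinite_finite_induct) (auto simp: Ck_on_const intro!: Ck_on_add assms(1))

lemma smooth_on_sum: 
  "open X \<Longrightarrow> (\<And>i. i \<in> I \<Longrightarrow> smooth_on X (f i)) \<Longrightarrow> smooth_on X (\<lambda>x. \<Sum>i\<in>I. f i x)"
  by (simp add: smooth_on_def Ck_on_sum)

lemma smooth_on_diff: "open X \<Longrightarrow> smooth_on X f \<Longrightarrow> smooth_on X h \<Longrightarrow> smooth_on X (\<lambda>x. f x - h x)"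
  using smooth_on_add[of X f "\<lambda>x. (-1) *\<^sub>R h x"] smooth_on_scaleR[of X "\<lambda>x. -1" h] by simp

lemma linear_frechet_expand:
  fixes f :: "'a::euclidean_space \<Rightarrow> 'b::real_normed_vector"
  assumes "linear f" shows "f v = (\<Sum>i\<in>Basis. (v \<bullet> i) *\<^sub>R f i)"
proof -
  have "f (\<Sum>i\<in>Basis. (v \<bullet> i) *\<^sub>R i) = (\<Sum>i\<in>Basis. (v \<bullet> i) *\<^sub>R f i)"
    using assms by (simp add: linear_sum linear_scale)
  then show ?thesis by (simp add: euclidean_representation)
qed

text \<open>\<open>Ck_on\<close> speaks of derivatives in fixed directions, whereas the chain rule
  evaluates the derivative of \<open>h\<close> in a direction that varies with \<open>y\<close>.
  Expanding that direction in the basis gives a finite sum of products, to which the induction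
  hypothesis applies; hence the Euclidean intermediate space.\<close>

lemma Ck_on_compose:
  fixes h :: "'b::euclidean_space \<Rightarrow> 'c::real_normed_vector" and f :: "'a::real_normed_vector \<Rightarrow> 'b"
  assumes "open Y" "Ck_on k X h" "Ck_on k Y f" "f ` Y \<subseteq> X"
  shows "Ck_on k Y (\<lambda>y. h (f y))"
  using assms
proof (induction k arbitrary: h)
  case 0
  then show ?case by (simp add: continuous_on_compose2)
next
  case (Suc k)
  have d: "h differentiable at (f y)" "f differentiable at y" if "y \<in> Y" for y
    using Suc.prems that by auto
  have D: "frechet_derivative (\<lambda>y. h (f y)) (at y) v =
     (\<Sum>i\<in>Basis. (frechet_derivative f (at y) v \<bullet> i) *\<^sub>R frechet_derivative h (at (f y)) i)"
    if "y \<in> Y" for y v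
    unfolding linear_frechet_expand[OF linear_frechet_derivative[OF d(1)[OF that]], symmetric]
    using fun_cong[OF frechet_derivative_compose[OF d(2,1)[OF that]], of v] by (simp add: o_def)
  have k: "Ck_on k Y f" using Suc.prems Ck_on_Suc_D by blast
  have "Ck_on k Y (\<lambda>y. frechet_derivative (\<lambda>y. h (f y)) (at y) v)" for v
  proof (rule Ck_on_cong[OF \<open>open Y\<close> D])
    have "Ck_on k Y (\<lambda>y. frechet_derivative f (at y) v \<bullet> i)" for i
      using Suc.prems by (intro bounded_bilinear.Ck_on_bilinear[OF bounded_bilinear_inner]) (auto simp: Ck_on_const)
    moreover have "Ck_on k Y (\<lambda>y. frechet_derivative h (at (f y)) i)" for i
      using Suc.IH[of "\<lambda>x. frechet_derivative h (at x) i"] Suc.prems k by simp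
    ultimately show "Ck_on k Y (\<lambda>y. \<Sum>i\<in>Basis. (frechet_derivative f (at y) v \<bullet> i) *\<^sub>R
        frechet_derivative h (at (f y)) i)"
      by (intro Ck_on_sum bounded_bilinear.Ck_on_bilinear[OF bounded_bilinear_scaleR] \<open>open Y\<close>)
  qed
  then show ?case using differentiable_compose[OF d] by simp
qed

lemma smooth_on_compose:
  fixes h :: "'b::euclidean_space \<Rightarrow> 'c::real_normed_vector" and f :: "'a::real_normed_vector \<Rightarrow> 'b"
  assumes "smooth_on X h" "smooth_on Y f" "open Y" "f ` Y \<subseteq> X"
  shows "smooth_on Y (\<lambda>y. h (f y))"
  using assms by (auto simp: smooth_on_def intro: Ck_on_compose)

text \<open>Separate from general composition because the intermediate space is an arbitrary normed
  space here; pairing and the projections rest on it.\<close>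

lemma smooth_on_bounded_linear_compose:
  fixes L :: "'b::real_normed_vector \<Rightarrow> 'c::real_normed_vector"
  assumes L: "bounded_linear L" and "open X" "smooth_on X f"
  shows "smooth_on X (\<lambda>x. L (f x))"
proof -
  have "Ck_on k X (\<lambda>x. L (f x))" if "Ck_on k X f" for k
    using that
  proof (induction k arbitrary: f)
    case 0
    then show ?case using L by (simp add: bounded_linear.continuous_on)
  next
    case (Suc k)
    have D: "((\<lambda>x. L (f x)) has_derivative (\<lambda>v. L (frechet_derivative f (at x) v))) (at x)" if "x \<in> X" for x
      using Suc.prems that
      by (intro bounded_linear.has_derivative[OF L]) (auto simp: frechet_derivative_works[symmetric])
    have "Ck_on k X (\<lambda>x. frechet_derivative (\<lambda>x. L (f x)) (at x) v)" for v
    proof (rule Ck_on_cong[OF \<open>open X\<close>])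
      show "frechet_derivative (\<lambda>x. L (f x)) (at x) v = L (frechet_derivative f (at x) v)" if "x \<in> X" for x
        using fun_cong[OF frechet_derivative_at[OF D[OF that]], of v] by simp
      show "Ck_on k X (\<lambda>x. L (frechet_derivative f (at x) v))"
        using Suc.IH[of "\<lambda>x. frechet_derivative f (at x) v"] Suc.prems by simp
    qed
    then show ?case using D differentiableI by fastforce
  qed
  then show ?thesis using assms(3) by (simp add: smooth_on_def)
qed

lemma smooth_on_Pair:
  assumes "open X" "smooth_on X f" "smooth_on X h"
  shows "smooth_on X (\<lambda>x. (f x, h x))"
proof -
  have "bounded_linear (\<lambda>x. (x, 0))" "bounded_linear (\<lambda>x. (0, x))"
    by (intro bounded_linear_Pair bounded_linear_ident bounded_linear_zero)+
  then have "smooth_on X (\<lambda>x. (f x, 0) + (0, h x))"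
    by (intro smooth_on_add[OF \<open>open X\<close>] smooth_on_bounded_linear_compose[OF _ \<open>open X\<close> assms(2)]
        smooth_on_bounded_linear_compose[OF _ \<open>open X\<close> assms(3)])
  then show ?thesis by simp
qed

lemma smooth_on_fst: "open X \<Longrightarrow> smooth_on X f \<Longrightarrow> smooth_on X (\<lambda>x. fst (f x))"
  and smooth_on_snd: "open X \<Longrightarrow> smooth_on X f \<Longrightarrow> smooth_on X (\<lambda>x. snd (f x))"
  by (auto intro: smooth_on_bounded_linear_compose bounded_linear_fst bounded_linear_snd)

lemma smooth_on_ident [intro, simp]: "smooth_on X (\<lambda>x. x)"
  by (intro smooth_on_bounded_linear bounded_linear_ident)

lemma smooth_on_inverse: 
  fixes f :: "'a::real_normed_vector \<Rightarrow> real"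
  assumes "open X" "smooth_on X f" "\<And>x. x \<in> X \<Longrightarrow> f x \<noteq> 0"
  shows "smooth_on X (\<lambda>x. inverse (f x))"
proof -
  have D: "frechet_derivative (\<lambda>x. inverse (f x)) (at x) v = 
    inverse (f x) * (frechet_derivative f (at x) v * ((-1) * inverse (f x)))" 
    and d: "(\<lambda>x. inverse (f x)) differentiable at x" if "x \<in> X" for x v
  proof -
    have *: "((\<lambda>x. inverse (f x)) has_derivative (\<lambda>v. - (inverse (f x) * frechet_derivative f (at x) v * inverse (f x)))) (at x)"
      using assms that by (intro Deriv.has_derivative_inverse smooth_on_has_derivative[OF assms(2)]) auto
    show "frechet_derivative (\<lambda>x. inverse (f x)) (at x) v = 
       inverse (f x) * (frechet_derivative f (at x) v * ((-1) * inverse (f x)))"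
      using fun_cong[OF frechet_derivative_at[OF *], of v] by simp
    show "(\<lambda>x. inverse (f x)) differentiable at x" using * by (rule differentiableI)
  qed
  have "Ck_on k X (\<lambda>x. inverse (f x))" for k
  proof (induction k)
    case 0
    then show ?case using assms smooth_on_continuous by (auto intro: continuous_intros)
  next
    case (Suc k)
    \<comment> \<open>The derivative of 1/f is written as a product containing 1/f itself, so the
      induction hypothesis on the inverse closes the step.\<close>
    have *: "Ck_on k X (\<lambda>x. inverse (f x) * (frechet_derivative f (at x) v * ((-1) * inverse (f x))))" for v
      using Suc assms smooth_on_frechet_derivative[OF assms(2)] unfolding smooth_on_def
      by (intro bounded_bilinear.Ck_on_bilinear[OF bounded_bilinear_mult]) (auto simp: Ck_on_const)
    have "Ck_on k X (\<lambda>x. frechet_derivative (\<lambda>x. inverse (f x)) (at x) v)" for v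
      by (rule Ck_on_cong[OF \<open>open X\<close> D]) (assumption, rule *)
    then show ?case using d by simp
  qed
  then show ?thesis by (simp add: smooth_on_def)
qed

lemma smooth_on_divide: 
  fixes f h :: "'a::real_normed_vector \<Rightarrow> real"
  assumes "open X" "smooth_on X f" "smooth_on X h" "\<And>x. x \<in> X \<Longrightarrow> h x \<noteq> 0"
  shows "smooth_on X (\<lambda>x. f x / h x)"
  using smooth_on_mult[OF assms(1,2) smooth_on_inverse[OF assms(1,3,4)]] by (simp add: divide_inverse)

section \<open>Symmetry of second derivatives\<close>

lemma second_difference_mean_value:
  fixes f :: "'a::euclidean_space \<Rightarrow> real"
  assumes f: "smooth_on X f" and h: "0 < h"
    and X: "\<And>s t. s \<in> {0..h} \<Longrightarrow> t \<in> {0..h} \<Longrightarrow> x + s *\<^sub>R u + t *\<^sub>R v \<in> X"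
  obtains s t where "s \<in> {0..h}" "t \<in> {0..h}"
    "f (x + h *\<^sub>R u + h *\<^sub>R v) - f (x + h *\<^sub>R u) - (f (x + h *\<^sub>R v) - f x) =
       frechet_derivative (\<lambda>y. frechet_derivative f (at y) u) (at (x + s *\<^sub>R u + t *\<^sub>R v)) v * h * h"
proof -
  let ?D = "\<lambda>y w. frechet_derivative f (at y) w"
  let ?DD = "\<lambda>y w. frechet_derivative (\<lambda>y. ?D y u) (at y) w"
  \<comment> \<open>The difference of \<open>f\<close> across the parallelogram in direction
    \<open>v\<close>. The mean value theorem is applied to it in \<open>s\<close>, and then in
    \<open>t\<close> to the \<open>u\<close>-derivative so obtained; the summand with factor 0 keeps
    both edges in the same form.\<close>
  let ?G = "\<lambda>s. f (x + s *\<^sub>R u + h *\<^sub>R v) - f (x + s *\<^sub>R u + 0 *\<^sub>R v)"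
  have D: "((\<lambda>s. f (x + s *\<^sub>R u + t *\<^sub>R v)) has_derivative (\<lambda>r. r * ?D (x + s *\<^sub>R u + t *\<^sub>R v) u)) (at s within {0..h})"
    if "s \<in> {0..h}" "t \<in> {0..h}" for s t
  proof -
    have "((\<lambda>s. f (x + s *\<^sub>R u + t *\<^sub>R v)) has_derivative (\<lambda>r. ?D (x + s *\<^sub>R u + t *\<^sub>R v) (r *\<^sub>R u))) (at s within {0..h})"
      by (rule has_derivative_compose[where f="\<lambda>s. x + s *\<^sub>R u + t *\<^sub>R v" and g=f, OF _ smooth_on_has_derivative[OF f X[OF that]]])
         (auto intro!: derivative_eq_intros)
    then show ?thesis
      using smooth_on_linear_derivative[OF f X[OF that]] by (simp add: linear_scale)
  qed
  have "\<exists>s\<in>{0<..<h}. ?G h - ?G 0 = (\<lambda>r. r * ?D (x + s *\<^sub>R u + h *\<^sub>R v) u - r * ?D (x + s *\<^sub>R u + 0 *\<^sub>R v) u) (h - 0)"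
    by (rule mvt_simple[OF h]) (auto intro!: has_derivative_diff D[where t=h] D[where t=0, simplified] simp: h less_imp_le)
  then obtain s where s: "s \<in> {0<..<h}"
    and G: "?G h - ?G 0 = h * (?D (x + s *\<^sub>R u + h *\<^sub>R v) u - ?D (x + s *\<^sub>R u + 0 *\<^sub>R v) u)"
    by (auto simp: algebra_simps)
  have s': "s \<in> {0..h}" using s by auto
  have D2: "((\<lambda>t. ?D (x + s *\<^sub>R u + t *\<^sub>R v) u) has_derivative (\<lambda>r. r * ?DD (x + s *\<^sub>R u + t *\<^sub>R v) v)) (at t within {0..h})"
    if "t \<in> {0..h}" for t
  proof -
    note f' = smooth_on_frechet_derivative[OF f, of u]
    have "((\<lambda>t. ?D (x + s *\<^sub>R u + t *\<^sub>R v) u) has_derivative (\<lambda>r. ?DD (x + s *\<^sub>R u + t *\<^sub>R v) (r *\<^sub>R v))) (at t within {0..h})"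
      by (rule has_derivative_compose[where f="\<lambda>t. x + s *\<^sub>R u + t *\<^sub>R v" and g="\<lambda>y. ?D y u",
            OF _ smooth_on_has_derivative[OF f' X[OF s' that]]])
         (auto intro!: derivative_eq_intros)
    then show ?thesis
      using smooth_on_linear_derivative[OF f' X[OF s' that]] by (simp add: linear_scale)
  qed
  obtain t where t: "t \<in> {0<..<h}"
    and H: "?D (x + s *\<^sub>R u + h *\<^sub>R v) u - ?D (x + s *\<^sub>R u + 0 *\<^sub>R v) u = h * ?DD (x + s *\<^sub>R u + t *\<^sub>R v) v"
    using mvt_simple[OF h D2] by auto
  show ?thesis
    by (rule that[of s t]) (use s t G H in auto)
qed

text \<open>The second difference over a small parallelogram is unchanged when \<open>u\<close> and
  \<open>v\<close> are exchanged, and each reading of it yields one of the two mixed derivatives at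
  a nearby point. Continuity of both then leaves no room for a gap at \<open>x\<close>.\<close>

lemma second_derivative_symmetric_real:
  fixes f :: "'a::euclidean_space \<Rightarrow> real"
  assumes f: "smooth_on X f" and "open X" "x \<in> X"
  shows "frechet_derivative (\<lambda>y. frechet_derivative f (at y) u) (at x) v =
         frechet_derivative (\<lambda>y. frechet_derivative f (at y) v) (at x) u" (is "?A x = ?B x")
proof (rule ccontr)
  assume ne: "?A x \<noteq> ?B x"
  \<comment> \<open>Half the gap: two continuity errors below \<open>e\<close> cannot bridge
    it.\<close>
  define e where "e = \<bar>?A x - ?B x\<bar> / 2"
  have e: "e > 0" using ne by (simp add: e_def)
  have "continuous_on X ?A" "continuous_on X ?B"
    by (intro smooth_on_continuous smooth_on_frechet_derivative f)+
  then have "isCont ?A x" "isCont ?B x"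
    using assms(2,3) by (simp_all add: continuous_on_eq_continuous_at)
  then obtain d1 d2 where d: "d1 > 0" "d2 > 0"
    "\<And>y. dist y x < d1 \<Longrightarrow> dist (?A y) (?A x) < e" "\<And>y. dist y x < d2 \<Longrightarrow> dist (?B y) (?B x) < e"
    using e unfolding continuous_at_eps_delta by metis
  obtain d3 where d3: "d3 > 0" "ball x d3 \<subseteq> X"
    using assms(2,3) openE by blast
  define d where "d = Min {d1, d2, d3}"
  have dd: "d > 0" "d \<le> d1" "d \<le> d2" "d \<le> d3" using d d3 by (auto simp: d_def)
  \<comment> \<open>The parallelogram with sides \<open>h *\<^sub>R u\<close> and
    \<open>h *\<^sub>R v\<close> stays within \<open>h * n = d / 2\<close> of \<open>x\<close>; the
    summand 1 keeps \<open>n\<close> positive even when both vectors vanish.\<close>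
  define n where "n = norm u + norm v + 1"
  define h where "h = d / (2 * n)"
  have n: "n > 0" by (simp add: n_def add_nonneg_pos)
  have h: "h > 0" using dd n by (simp add: h_def)
  have small: "dist (x + s *\<^sub>R u + t *\<^sub>R v) x < d" if "s \<in> {0..h}" "t \<in> {0..h}" for s t
  proof -
    have "dist (x + s *\<^sub>R u + t *\<^sub>R v) x \<le> \<bar>s\<bar> * norm u + \<bar>t\<bar> * norm v"
      using norm_triangle_ineq[of "s *\<^sub>R u" "t *\<^sub>R v"] by (simp add: dist_norm)
    also have "\<dots> \<le> h * norm u + h * norm v"
      using that by (intro add_mono mult_right_mono) auto
    also have "\<dots> \<le> h * n" using h by (simp add: n_def algebra_simps)
    also have "\<dots> = d / 2" using n by (simp add: h_def)
    also have "\<dots> < d" using dd by simp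
    finally show ?thesis .
  qed
  have sub: "x + s *\<^sub>R u + t *\<^sub>R v \<in> X" if "s \<in> {0..h}" "t \<in> {0..h}" for s t
    using small[OF that] d3 dd by (auto simp: dist_commute mem_ball subset_iff)
  obtain s t where 1: "s \<in> {0..h}" "t \<in> {0..h}" 
    "f (x + h *\<^sub>R u + h *\<^sub>R v) - f (x + h *\<^sub>R u) - (f (x + h *\<^sub>R v) - f x) =
       ?A (x + s *\<^sub>R u + t *\<^sub>R v) * h * h"
    using second_difference_mean_value[OF f h sub] .
  have sub': "x + s *\<^sub>R v + t *\<^sub>R u \<in> X" if "s \<in> {0..h}" "t \<in> {0..h}" for s t
    using sub[OF that(2,1)] by (simp add: algebra_simps)
  obtain s' t' where 2: "s' \<in> {0..h}" "t' \<in> {0..h}" 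
    "f (x + h *\<^sub>R v + h *\<^sub>R u) - f (x + h *\<^sub>R v) - (f (x + h *\<^sub>R u) - f x) =
       ?B (x + s' *\<^sub>R v + t' *\<^sub>R u) * h * h"
    using second_difference_mean_value[OF f h sub'] .
  have "x + h *\<^sub>R v + h *\<^sub>R u = x + h *\<^sub>R u + h *\<^sub>R v" by simp
  note 2 = 2[unfolded this]
  have "?A (x + s *\<^sub>R u + t *\<^sub>R v) * h * h = ?B (x + s' *\<^sub>R v + t' *\<^sub>R u) * h * h"
    using 1(3) 2(3) by argo
  then have AB: "?A (x + s *\<^sub>R u + t *\<^sub>R v) = ?B (x + s' *\<^sub>R v + t' *\<^sub>R u)" using h by simp
  have "dist (?A (x + s *\<^sub>R u + t *\<^sub>R v)) (?A x) < e"
    using d(3) small[OF 1(1,2)] dd by simp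
  moreover have "dist (?B (x + s' *\<^sub>R v + t' *\<^sub>R u)) (?B x) < e"
    using d(4) small[OF 2(2,1)] dd by (simp add: add.assoc add.left_commute add.commute)
  ultimately have "\<bar>?A x - ?B x\<bar> < 2 * e" using AB unfolding dist_real_def by linarith
  then show False by (simp add: e_def)
qed

lemma smooth_on_frechet_inner:
  fixes f :: "'a::euclidean_space \<Rightarrow> 'b::euclidean_space"
  assumes "smooth_on X f" "x \<in> X"
  shows "frechet_derivative (\<lambda>x. f x \<bullet> b) (at x) v = frechet_derivative f (at x) v \<bullet> b"
  using fun_cong[OF frechet_derivative_at[OF has_derivative_inner_left[OF smooth_on_has_derivative[OF assms]]]]
  by metis

text \<open>Componentwise reduction to real functions. For \<open>\<Phi>\<close> in coordinates this
  exchanges the derivative along a generator with the derivative in any constant direction.\<close>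

lemma second_derivative_symmetric:
  fixes f :: "'a::euclidean_space \<Rightarrow> 'b::euclidean_space"
  assumes f: "smooth_on X f" and X: "open X" "x \<in> X"
  shows "frechet_derivative (\<lambda>y. frechet_derivative f (at y) u) (at x) v =
         frechet_derivative (\<lambda>y. frechet_derivative f (at y) v) (at x) u"
proof (rule euclidean_eqI)
  fix b :: 'b assume "b \<in> Basis"
  have fb: "smooth_on X (\<lambda>x. f x \<bullet> b)"
    by (intro smooth_on_inner X f smooth_on_const)
  have *: "frechet_derivative (\<lambda>y. frechet_derivative f (at y) u) (at x) v \<bullet> b =
    frechet_derivative (\<lambda>y. frechet_derivative (\<lambda>x. f x \<bullet> b) (at y) u) (at x) v" for u v
    using frechet_derivative_cong_open[OF X, of "\<lambda>y. frechet_derivative (\<lambda>x. f x \<bullet> b) (at y) u" 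
        "\<lambda>y. frechet_derivative f (at y) u \<bullet> b"] smooth_on_frechet_inner[OF f, of _ b u]
      smooth_on_frechet_inner[OF smooth_on_frechet_derivative[OF f, of u] X(2), of b v]
    by simp
  show "frechet_derivative (\<lambda>y. frechet_derivative f (at y) u) (at x) v \<bullet> b =
         frechet_derivative (\<lambda>y. frechet_derivative f (at y) v) (at x) u \<bullet> b"
    unfolding * by (rule second_derivative_symmetric_real[OF fb X])
qed

section \<open>Atlases and smooth maps between manifolds\<close>

text \<open>The local conditions of \<open>smooth_manifold\<close>, isolated so that they can be
  checked chart by chart for cylinders, open subsets and images.\<close>

definition atlas :: "('m, 'e::euclidean_space) mfld \<Rightarrow> bool"
  where "atlas M \<longleftrightarrow>
     (\<forall>c\<in>M. inj_on (snd c) (fst c) \<and> open (snd c ` fst c)) \<and>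
     (\<forall>c\<in>M. \<forall>c'\<in>M. open (snd c ` (fst c \<inter> fst c')) \<and>
        smooth_on (snd c ` (fst c \<inter> fst c')) (snd c' \<circ> chart_inv c))"

lemma smooth_manifold_atlas: "smooth_manifold M \<Longrightarrow> atlas M"
  by (simp add: smooth_manifold_def atlas_def)

lemma chart_inv_chart:
  assumes "atlas M" "c \<in> M" "p \<in> fst c" shows "chart_inv c (snd c p) = p"
  using assms by (simp add: atlas_def chart_inv_def)

lemma chart_inv_chart':
  assumes "inj_on (snd c) (fst c)" "p \<in> fst c" shows "chart_inv c (snd c p) = p"
  using assms by (simp add: chart_inv_def)

lemma chart_inv_in: "x \<in> snd c ` fst c \<Longrightarrow> chart_inv c x \<in> fst c"
  by (simp add: chart_inv_def inv_into_into)

lemma chart_chart_inv: "x \<in> snd c ` fst c \<Longrightarrow> snd c (chart_inv c x) = x"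
  by (simp add: chart_inv_def f_inv_into_f)

lemma chart_dom_carrier: "c \<in> M \<Longrightarrow> p \<in> fst c \<Longrightarrow> p \<in> carrier M"
  by (auto simp: carrier_def)

lemma topspace_mtop [simp]: "topspace (mtop M) = carrier M"
proof -
  have "\<Union> {{p\<in>D. \<phi> p \<in> B} | D \<phi> B. (D, \<phi>) \<in> M \<and> open B} = carrier M"
  proof (intro equalityI subsetI)
    fix p assume "p \<in> carrier M"
    then obtain D \<phi> where "(D, \<phi>) \<in> M" "p \<in> D" by (auto simp: carrier_def)
    then show "p \<in> \<Union> {{p\<in>D. \<phi> p \<in> B} | D \<phi> B. (D, \<phi>) \<in> M \<and> open B}"
      by (intro UnionI[of "{p\<in>D. \<phi> p \<in> UNIV}"]) (blast intro: open_UNIV)+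
  qed (force simp: carrier_def)
  then show ?thesis unfolding mtop_def by simp
qed

lemma openin_mtop_preimage: "c \<in> M \<Longrightarrow> open B \<Longrightarrow> openin (mtop M) {p\<in>fst c. snd c p \<in> B}"
  unfolding mtop_def by (rule topology_generated_by_Basis) (cases c; auto)

lemma openin_mtop_chart: "c \<in> M \<Longrightarrow> openin (mtop M) (fst c)"
  using openin_mtop_preimage[of c M UNIV] by simp

text \<open>The topology is known only through its generators, so the proof follows their
  generation: a generator is cut out in the chart by a continuous transition map, and intersections
  survive because the chart is injective.\<close>

lemma open_chart_image:
  assumes M: "atlas M" and c: "c \<in> M" and U: "openin (mtop M) U"
  shows "open (snd c ` (fst c \<inter> U))"
proof -
  have inj: "inj_on (snd c) (fst c)" using M c by (auto simp: atlas_def)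
  have "generate_topology_on {{p\<in>D. \<phi> p \<in> B} | D \<phi> B. (D, \<phi>) \<in> M \<and> open B} U"
    using U by (simp add: mtop_def openin_topology_generated_by_iff)
  then show ?thesis
  proof induction
    case Empty
    then show ?case by simp
  next
    case (Int a b)
    have "snd c ` (fst c \<inter> (a \<inter> b)) = snd c ` ((fst c \<inter> a) \<inter> (fst c \<inter> b))"
      by (rule arg_cong[where f="image (snd c)"]) blast
    also have "\<dots> = snd c ` (fst c \<inter> a) \<inter> snd c ` (fst c \<inter> b)"
      using inj by (intro inj_on_image_Int) auto
    finally show ?case using Int by auto
  next
    case (UN K)
    have "snd c ` (fst c \<inter> \<Union> K) = (\<Union>k\<in>K. snd c ` (fst c \<inter> k))" by blast
    then show ?case using UN by auto
  next
    case (Basis s)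
    then obtain D \<phi> B where s: "s = {p\<in>D. \<phi> p \<in> B}" "(D, \<phi>) \<in> M" "open B" by blast
    let ?X = "snd c ` (fst c \<inter> D)" and ?f = "\<phi> \<circ> chart_inv c"
    have X: "open ?X" "smooth_on ?X ?f" 
      using M c s(2) unfolding atlas_def by (metis fst_conv snd_conv)+
    then have "open (?X \<inter> ?f -` B)"
      using s(3) smooth_on_continuous continuous_open_preimage by blast
    moreover have "?X \<inter> ?f -` B = snd c ` (fst c \<inter> s)"
      by (auto simp: s chart_inv_chart[OF M c])
    ultimately show ?case by simp
  qed
qed

lemma continuous_map_mtopI:
  assumes "f ` topspace T \<subseteq> carrier M"
    and "\<And>c B. c \<in> M \<Longrightarrow> open B \<Longrightarrow> openin T {p \<in> topspace T. f p \<in> fst c \<and> snd c (f p) \<in> B}"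
  shows "continuous_map T (mtop M) f"
  unfolding mtop_def
proof (rule continuous_on_generated_topo)
  fix U assume "U \<in> {{p\<in>D. \<phi> p \<in> B} | D \<phi> B. (D, \<phi>) \<in> M \<and> open B}"
  then obtain D \<phi> B where U: "U = {p\<in>D. \<phi> p \<in> B}" "(D, \<phi>) \<in> M" "open B" by blast
  have "f -` U \<inter> topspace T = {p \<in> topspace T. f p \<in> fst (D, \<phi>) \<and> snd (D, \<phi>) (f p) \<in> B}"
    by (auto simp: U)
  then show "openin T (f -` U \<inter> topspace T)" using assms(2)[OF U(2,3)] by simp
next
  have "\<Union> {{p\<in>D. \<phi> p \<in> B} | D \<phi> B. (D, \<phi>) \<in> M \<and> open B} = carrier M"
    using topspace_mtop[of M] by (simp add: mtop_def)
  then show "f ` topspace T \<subseteq> \<Union> {{p\<in>D. \<phi> p \<in> B} | D \<phi> B. (D, \<phi>) \<in> M \<and> open B}"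
    using assms(1) by simp
qed

lemma smooth_map_carrier: "smooth_map N M f \<Longrightarrow> p \<in> carrier N \<Longrightarrow> f p \<in> carrier M"
  by (auto simp: smooth_map_def)

lemma smooth_map_openin:
  assumes "smooth_map N M f" "openin (mtop M) U" shows "openin (mtop N) {p \<in> carrier N. f p \<in> U}"
  using openin_continuous_map_preimage[of "mtop N" "mtop M" f U] assms
  by (simp add: smooth_map_def)

lemma smooth_map_open_rep:
  assumes "atlas N" "smooth_map N M f" "a \<in> N" "openin (mtop M) U"
  shows "open (snd a ` {p \<in> fst a. f p \<in> U})"
proof -
  have "fst a \<inter> {p \<in> carrier N. f p \<in> U} = {p \<in> fst a. f p \<in> U}"
    using assms(3) by (auto simp: carrier_def)
  then show ?thesis
    using open_chart_image[OF assms(1,3) smooth_map_openin[OF assms(2,4)]] by simp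
qed

lemma smooth_map_smooth_rep:
  assumes "smooth_map N M f" "a \<in> N" "c \<in> M"
  shows "smooth_on (snd a ` {p \<in> fst a. f p \<in> fst c}) (snd c \<circ> f \<circ> chart_inv a)"
  using assms by (auto simp: smooth_map_def)

text \<open>Smoothness in one pair of charts around each point carries over to all pairs by
  composing with transition maps on both sides, and continuity comes along because charts are
  homeomorphic onto open sets.\<close>

lemma smooth_mapI:
  fixes N :: "('n, 'f::euclidean_space) mfld" and M :: "('m, 'e::euclidean_space) mfld"
  assumes N: "atlas N" and M: "atlas M"
    and loc: "\<And>p. p \<in> carrier N \<Longrightarrow> \<exists>a\<in>N. \<exists>c\<in>M. \<exists>X. p \<in> fst a \<and> open X \<and> snd a p \<in> X \<and>
      X \<subseteq> snd a ` fst a \<and> f ` chart_inv a ` X \<subseteq> fst c \<and> smooth_on X (snd c \<circ> f \<circ> chart_inv a)"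
  shows "smooth_map N M f"
proof -
  have im: "f ` carrier N \<subseteq> carrier M"
  proof (intro subsetI, elim imageE)
    fix q p assume "q = f p" "p \<in> carrier N"
    then show "q \<in> carrier M"
      using loc[of p] chart_inv_chart[OF N] chart_dom_carrier by (metis imageI subsetD)
  qed
  have cont: "continuous_map (mtop N) (mtop M) f"
  proof (rule continuous_map_mtopI)
    show "f ` topspace (mtop N) \<subseteq> carrier M" using im by simp
    fix c' and B :: "'e set" assume c': "c' \<in> M" and B: "open B"
    let ?U = "{q \<in> fst c'. snd c' q \<in> B}"
    have U: "openin (mtop M) ?U" using openin_mtop_preimage[OF c' B] .
    have "\<exists>T. openin (mtop N) T \<and> p \<in> T \<and> T \<subseteq> {p \<in> topspace (mtop N). f p \<in> fst c' \<and> snd c' (f p) \<in> B}"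
      if p: "p \<in> carrier N" "f p \<in> ?U" for p
    proof -
      obtain a c X where a: "a \<in> N" "c \<in> M" "p \<in> fst a" "open X" "snd a p \<in> X"
        "X \<subseteq> snd a ` fst a" "f ` chart_inv a ` X \<subseteq> fst c" "smooth_on X (snd c \<circ> f \<circ> chart_inv a)"
        using loc[OF p(1)] by blast
      let ?Y = "X \<inter> (snd c \<circ> f \<circ> chart_inv a) -` (snd c ` (fst c \<inter> ?U))"
      have Y: "open ?Y"
        using continuous_open_preimage[OF smooth_on_continuous[OF a(8)] a(4) open_chart_image[OF M a(2) U]] .
      let ?T = "{q \<in> fst a. snd a q \<in> ?Y}"
      have "openin (mtop N) ?T" using openin_mtop_preimage[OF a(1) Y] .
      moreover have "f p \<in> fst c" using a chart_inv_chart[OF N a(1,3)] by force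
      then have "p \<in> ?T"
        using a p chart_inv_chart[OF N a(1,3)] by auto
      moreover have "?T \<subseteq> {p \<in> topspace (mtop N). f p \<in> fst c' \<and> snd c' (f p) \<in> B}"
      proof
        fix q assume that: "q \<in> ?T"
        have q: "q \<in> fst a" "snd a q \<in> X" "snd c (f q) \<in> snd c ` (fst c \<inter> ?U)"
          using that chart_inv_chart[OF N a(1)] by auto
        have "f q \<in> fst c" using q a(7) chart_inv_chart[OF N a(1) q(1)] by force
        then have "f q \<in> ?U" using q(3) M a(2) by (auto simp: atlas_def inj_on_def)
        then show "q \<in> {p \<in> topspace (mtop N). f p \<in> fst c' \<and> snd c' (f p) \<in> B}"
          using chart_dom_carrier[OF a(1) q(1)] by simp
      qed
      ultimately show ?thesis by blast
    qed
    then show "openin (mtop N) {p \<in> topspace (mtop N). f p \<in> fst c' \<and> snd c' (f p) \<in> B}"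
      by (subst openin_subopen) simp
  qed
  have "smooth_on (snd a' ` {p \<in> fst a'. f p \<in> fst c'}) (snd c' \<circ> f \<circ> chart_inv a')"
    if a': "a' \<in> N" and c': "c' \<in> M" for a' c'
  proof (rule smooth_on_local)
    fix x assume "x \<in> snd a' ` {p \<in> fst a'. f p \<in> fst c'}"
    then obtain p where p: "p \<in> fst a'" "f p \<in> fst c'" "x = snd a' p" by blast
    then obtain a c X where a: "a \<in> N" "c \<in> M" "p \<in> fst a" "open X" "snd a p \<in> X"
        "X \<subseteq> snd a ` fst a" "f ` chart_inv a ` X \<subseteq> fst c" "smooth_on X (snd c \<circ> f \<circ> chart_inv a)"
      using loc[of p] chart_dom_carrier[OF a'] by blast
    \<comment> \<open>The set on which the old pair of charts and the target chart \<open>c'\<close>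
      are all usable. Its openness rests on the continuity of \<open>f\<close>, which is why that
      was settled first.\<close>
    let ?W = "{q \<in> fst a. snd a q \<in> X} \<inter> {q \<in> topspace (mtop N). f q \<in> fst c'}"
    let ?Z = "snd a' ` (fst a' \<inter> ?W)"
    have "openin (mtop N) ?W"
      by (intro openin_Int openin_mtop_preimage a openin_continuous_map_preimage[OF cont] openin_mtop_chart c')
    then have Z: "open ?Z" by (rule open_chart_image[OF N a'])
    have xZ: "x \<in> ?Z" using p a chart_dom_carrier[OF a'] by auto
    have W: "f q \<in> fst c" if "q \<in> ?W" for q
      using that a(7) chart_inv_chart[OF N a(1), of q] by force
    have 1: "smooth_on (snd a' ` (fst a' \<inter> fst a)) (snd a \<circ> chart_inv a')"
      using N a(1) a' by (auto simp: atlas_def)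
    have 2: "smooth_on (snd c ` (fst c \<inter> fst c')) (snd c' \<circ> chart_inv c)"
      using M a(2) c' by (auto simp: atlas_def)
    have 3: "smooth_on ?Z (\<lambda>z. (snd c \<circ> f \<circ> chart_inv a) ((snd a \<circ> chart_inv a') z))"
      by (rule smooth_on_compose[OF a(8) smooth_on_subset[OF 1]])
         (use Z chart_inv_chart[OF N a'] in auto)
    have "smooth_on ?Z (\<lambda>z. (snd c' \<circ> chart_inv c) ((snd c \<circ> f \<circ> chart_inv a) ((snd a \<circ> chart_inv a') z)))"
      by (rule smooth_on_compose[OF 2 3 Z])
         (use W chart_inv_chart[OF N a'] chart_inv_chart[OF N a(1)] in auto)
    then have "smooth_on ?Z (snd c' \<circ> f \<circ> chart_inv a')"
      by (rule smooth_on_cong[OF Z, rotated])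
         (use W chart_inv_chart[OF N a'] chart_inv_chart[OF N a(1)] chart_inv_chart[OF M a(2)] in auto)
    then show "\<exists>Y. open Y \<and> x \<in> Y \<and> smooth_on Y (snd c' \<circ> f \<circ> chart_inv a')"
      using Z xZ by blast
  qed
  then show ?thesis using im cont by (auto simp: smooth_map_def)
qed

lemma smooth_map_compose:
  assumes N: "atlas N" and M: "atlas M" and P: "atlas P" 
    and f: "smooth_map N M f" and h: "smooth_map M P h"
  shows "smooth_map N P (\<lambda>p. h (f p))"
proof (rule smooth_mapI[OF N P])
  fix p assume p: "p \<in> carrier N"
  obtain a where a: "a \<in> N" "p \<in> fst a" using p by (auto simp: carrier_def)
  obtain c where c: "c \<in> M" "f p \<in> fst c" using smooth_map_carrier[OF f p] by (auto simp: carrier_def)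
  obtain d where d: "d \<in> P" "h (f p) \<in> fst d"
    using smooth_map_carrier[OF h smooth_map_carrier[OF f p]] by (auto simp: carrier_def)
  let ?U = "fst c \<inter> {q \<in> carrier M. h q \<in> fst d}"
  let ?X = "snd a ` {q \<in> fst a. f q \<in> ?U}"
  have X: "open ?X"
    by (intro smooth_map_open_rep[OF N f a(1)] openin_Int openin_mtop_chart c smooth_map_openin[OF h] d)
  have "smooth_on ?X (\<lambda>x. (snd d \<circ> h \<circ> chart_inv c) ((snd c \<circ> f \<circ> chart_inv a) x))"
    by (rule smooth_on_compose[OF smooth_map_smooth_rep[OF h c(1) d(1)]
          smooth_on_subset[OF smooth_map_smooth_rep[OF f a(1) c(1)]] X])
       (auto simp: chart_inv_chart[OF N a(1)])
  then have "smooth_on ?X (snd d \<circ> (\<lambda>p. h (f p)) \<circ> chart_inv a)"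
    by (rule smooth_on_cong[OF X, rotated])
       (auto simp: chart_inv_chart[OF N a(1)] chart_inv_chart[OF M c(1)])
  moreover have "(\<lambda>p. h (f p)) ` chart_inv a ` ?X \<subseteq> fst d"
    by (auto simp: chart_inv_chart[OF N a(1)])
  ultimately show "\<exists>a\<in>N. \<exists>c\<in>P. \<exists>X. p \<in> fst a \<and> open X \<and> snd a p \<in> X \<and> X \<subseteq> snd a ` fst a \<and>
    (\<lambda>p. h (f p)) ` chart_inv a ` X \<subseteq> fst c \<and> smooth_on X (snd c \<circ> (\<lambda>p. h (f p)) \<circ> chart_inv a)"
    using X a c d p smooth_map_carrier[OF f p]
    by (intro bexI[of _ a] bexI[of _ d] exI[of _ ?X]) auto
qed

lemma smooth_map_id: assumes "atlas M" shows "smooth_map M M (\<lambda>p. p)"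
proof (rule smooth_mapI[OF assms assms])
  fix p assume "p \<in> carrier M"
  then obtain a where a: "a \<in> M" "p \<in> fst a" by (auto simp: carrier_def)
  let ?X = "snd a ` fst a"
  have X: "open ?X" using assms a by (auto simp: atlas_def)
  have "smooth_on ?X (snd a \<circ> (\<lambda>p. p) \<circ> chart_inv a)"
    by (rule smooth_on_cong[OF X _ smooth_on_ident]) (auto simp: chart_inv_chart[OF assms a(1)])
  then show "\<exists>a\<in>M. \<exists>c\<in>M. \<exists>X. p \<in> fst a \<and> open X \<and> snd a p \<in> X \<and> X \<subseteq> snd a ` fst a \<and>
    (\<lambda>p. p) ` chart_inv a ` X \<subseteq> fst c \<and> smooth_on X (snd c \<circ> (\<lambda>p. p) \<circ> chart_inv a)"
    using a X by (intro bexI[of _ a] exI[of _ ?X]) (auto simp: chart_inv_chart[OF assms a(1)])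
qed

lemma smooth_map_cong:
  assumes N: "atlas N" and h: "smooth_map N M h" and eq: "\<And>p. p \<in> carrier N \<Longrightarrow> f p = h p"
  shows "smooth_map N M f"
proof -
  have "continuous_map (mtop N) (mtop M) f"
    using h eq by (auto simp: smooth_map_def intro: continuous_map_eq)
  moreover have "smooth_on (snd a ` {p \<in> fst a. f p \<in> fst c}) (snd c \<circ> f \<circ> chart_inv a)"
    if a: "a \<in> N" and c: "c \<in> M" for a c
  proof -
    have fh: "{p \<in> fst a. f p \<in> fst c} = {p \<in> fst a. h p \<in> fst c}"
      using eq chart_dom_carrier[OF a] by auto
    show ?thesis unfolding fh
      by (rule smooth_on_cong[OF smooth_map_open_rep[OF N h a openin_mtop_chart[OF c]] _
           smooth_map_smooth_rep[OF h a c]])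
        (use eq chart_inv_chart[OF N a] chart_dom_carrier[OF a] in auto)
  qed
  ultimately show ?thesis using h eq by (auto simp: smooth_map_def)
qed

lemma diffeomorphism_inverse:
  assumes "atlas N" "diffeomorphism N M f"
  shows "diffeomorphism M N (inv_into (carrier N) f)"
proof -
  have b: "bij_betw f (carrier N) (carrier M)" using assms by (simp add: diffeomorphism_def)
  have "smooth_map N M (inv_into (carrier M) (inv_into (carrier N) f))"
    by (rule smooth_map_cong[OF assms(1), of _ f])
       (use assms b in \<open>auto simp: diffeomorphism_def inv_into_inv_into_eq\<close>)
  then show ?thesis using assms b bij_betw_inv_into by (auto simp: diffeomorphism_def)
qed

lemma diffeomorphism_compose:
  assumes "atlas N" "atlas M" "atlas P" "diffeomorphism N M f" "diffeomorphism M P h"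
  shows "diffeomorphism N P (h \<circ> f)"
proof -
  have bf: "bij_betw f (carrier N) (carrier M)" and bh: "bij_betw h (carrier M) (carrier P)"
    using assms by (auto simp: diffeomorphism_def)
  have b: "bij_betw (h \<circ> f) (carrier N) (carrier P)" using bij_betw_trans[OF bf bh] .
  have "smooth_map P N (\<lambda>p. inv_into (carrier N) f (inv_into (carrier M) h p))"
    by (rule smooth_map_compose[OF assms(3,2,1)]) (use assms in \<open>auto simp: diffeomorphism_def\<close>)
  then have "smooth_map P N (inv_into (carrier N) (h \<circ> f))"
  proof (rule smooth_map_cong[OF assms(3)])
    fix p assume "p \<in> carrier P"
    then obtain q where q: "q \<in> carrier N" "p = (h \<circ> f) q" using b by (auto simp: bij_betw_def)
    have "f q \<in> carrier M" using q bf by (auto simp: bij_betw_def)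
    moreover have "inv_into (carrier N) (h \<circ> f) p = q"
      unfolding q(2) using b q(1) by (intro inv_into_f_f) (auto simp: bij_betw_def)
    ultimately show "inv_into (carrier N) (h \<circ> f) p = inv_into (carrier N) f (inv_into (carrier M) h p)"
      using q bf bh by (auto simp: bij_betw_def inv_into_f_f)
  qed
  moreover have "smooth_map N P (h \<circ> f)"
    using smooth_map_compose[OF assms(1-3)] assms(4,5) by (simp add: diffeomorphism_def comp_def)
  ultimately show ?thesis using b by (simp add: diffeomorphism_def)
qed

section \<open>Tangent maps\<close>

text \<open>The derivative read in two arbitrary charts. \<open>mfderiv\<close>,
  \<open>to_chart\<close> and \<open>from_chart\<close> are all instances of it, so a single chain
  rule serves the three of them.\<close>

definition drep ::
    "('m, 'e::euclidean_space) chart \<Rightarrow> ('n, 'f::euclidean_space) chart \<Rightarrow> ('m \<Rightarrow> 'n) \<Rightarrow> 'm \<Rightarrow> 'e \<Rightarrow> 'f"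
  where "drep a c f p = frechet_derivative (snd c \<circ> f \<circ> chart_inv a) (at (snd a p))"

lemma chart_at_in: "p \<in> carrier M \<Longrightarrow> chart_at M p \<in> M" "p \<in> carrier M \<Longrightarrow> p \<in> fst (chart_at M p)"
proof -
  assume "p \<in> carrier M"
  then have "\<exists>c. c \<in> M \<and> p \<in> fst c" by (auto simp: carrier_def)
  then have "chart_at M p \<in> M \<and> p \<in> fst (chart_at M p)"
    unfolding chart_at_def by (rule someI_ex)
  then show "chart_at M p \<in> M" "p \<in> fst (chart_at M p)" by auto
qed

lemma mfderiv_drep: "mfderiv N M f p = drep (chart_at N p) (chart_at M (f p)) f p"
  by (simp add: mfderiv_def drep_def)

lemma to_chart_drep: "to_chart M c p = drep (chart_at M p) c (\<lambda>p. p) p"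
  by (simp add: to_chart_def drep_def comp_def)

lemma from_chart_drep: "from_chart M c p = drep c (chart_at M p) (\<lambda>p. p) p"
  by (simp add: from_chart_def drep_def comp_def)

lemma smooth_map_has_derivative:
  assumes "smooth_map N M f" "a \<in> N" "c \<in> M" "p \<in> fst a" "f p \<in> fst c"
  shows "((snd c \<circ> f \<circ> chart_inv a) has_derivative drep a c f p) (at (snd a p))"
  unfolding drep_def
  by (rule smooth_on_has_derivative[OF smooth_map_smooth_rep[OF assms(1-3)]]) (use assms in auto)

lemma linear_drep:
  assumes "smooth_map N M f" "a \<in> N" "c \<in> M" "p \<in> fst a" "f p \<in> fst c"
  shows "linear (drep a c f p)"
  using smooth_map_has_derivative[OF assms] has_derivative_linear by blast

lemma drep_eqI:
  assumes "((snd c \<circ> f \<circ> chart_inv a) has_derivative D) (at (snd a p))"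
  shows "drep a c f p = D"
  unfolding drep_def using frechet_derivative_at[OF assms] by simp

lemma drep_cong:
  assumes N: "atlas N" and a: "a \<in> N" "p \<in> fst a" and W: "openin (mtop N) W" "p \<in> W"
    and eq: "\<And>q. q \<in> W \<Longrightarrow> f q = h q"
  shows "drep a c f p = drep a c h p"
  unfolding drep_def
  by (rule frechet_derivative_cong_open[OF open_chart_image[OF N a(1) W(1)]])
     (use a W eq chart_inv_chart[OF N a(1)] in auto)

text \<open>The ordinary chain rule; inserting the intermediate chart \<open>c\<close> and its
  inverse is legitimate only where \<open>f\<close> takes values in that chart, which is an open set
  around the point.\<close>

lemma drep_compose:
  assumes N: "atlas N" and M: "atlas M"
    and f: "smooth_map N M f" and h: "smooth_map M P h"
    and a: "a \<in> N" "p \<in> fst a" and c: "c \<in> M" "f p \<in> fst c" and d: "d \<in> P" "h (f p) \<in> fst d"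
  shows "drep a d (\<lambda>p. h (f p)) p v = drep c d h (f p) (drep a c f p v)"
proof -
  let ?X = "snd a ` {q \<in> fst a. f q \<in> fst c}"
  have X: "open ?X" by (intro smooth_map_open_rep[OF N f a(1)] openin_mtop_chart c)
  have p: "chart_inv a (snd a p) = p" using chart_inv_chart[OF N a] .
  have "((\<lambda>x. (snd d \<circ> h \<circ> chart_inv c) ((snd c \<circ> f \<circ> chart_inv a) x)) has_derivative
    (\<lambda>v. drep c d h (f p) (drep a c f p v))) (at (snd a p))"
    by (rule has_derivative_compose[OF smooth_map_has_derivative[OF f a(1) c(1) a(2) c(2)]])
       (use smooth_map_has_derivative[OF h c(1) d(1) c(2) d(2)] p in \<open>simp add: comp_def\<close>)
  then have "((snd d \<circ> (\<lambda>p. h (f p)) \<circ> chart_inv a) has_derivative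
    (\<lambda>v. drep c d h (f p) (drep a c f p v))) (at (snd a p))"
    by (rule has_derivative_transform_within_open[OF _ X])
       (use a c chart_inv_chart[OF N a(1)] chart_inv_chart[OF M c(1)] in auto)
  then show ?thesis by (simp add: drep_eqI)
qed

lemma drep_ident:
  assumes N: "atlas N" and a: "a \<in> N" "p \<in> fst a"
  shows "drep a a (\<lambda>p. p) p v = v"
proof -
  have "((\<lambda>x. x) has_derivative (\<lambda>v. v)) (at (snd a p))" by simp
  then have "((snd a \<circ> (\<lambda>p. p) \<circ> chart_inv a) has_derivative (\<lambda>v. v)) (at (snd a p))"
    by (rule has_derivative_transform_within_open[of _ _ _ _ "snd a ` fst a"])
       (use N a chart_inv_chart[OF N a(1)] in \<open>auto simp: atlas_def\<close>)
  then show ?thesis by (simp add: drep_eqI)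
qed

lemma drep_change:
  assumes N: "atlas N" and a: "a \<in> N" "p \<in> fst a" and b: "b \<in> N" "p \<in> fst b"
  shows "drep b a (\<lambda>p. p) p (drep a b (\<lambda>p. p) p v) = v"
  using drep_compose[OF N N smooth_map_id[OF N] smooth_map_id[OF N] a b a] drep_ident[OF N a] by simp

lemma from_to_chart:
  assumes "atlas M" "c \<in> M" "p \<in> fst c"
  shows "from_chart M c p (to_chart M c p v) = v" "to_chart M c p (from_chart M c p v) = v"
  using assms chart_at_in[OF chart_dom_carrier[OF assms(2,3)]]
  by (auto simp: from_chart_drep to_chart_drep drep_change)

lemma mfderiv_compose:
  assumes "atlas N" "atlas M" "smooth_map N M f" "smooth_map M P h" "p \<in> carrier N"
  shows "mfderiv N P (\<lambda>p. h (f p)) p v = mfderiv M P h (f p) (mfderiv N M f p v)"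
  using assms smooth_map_carrier[OF assms(3)] smooth_map_carrier[OF assms(4)]
  by (simp add: mfderiv_drep drep_compose[OF assms(1-4)] chart_at_in)

lemma linear_mfderiv:
  assumes "smooth_map N M f" "p \<in> carrier N" shows "linear (mfderiv N M f p)"
  using assms smooth_map_carrier[OF assms]
  by (simp add: mfderiv_drep linear_drep[OF assms(1)] chart_at_in)

lemma mfderiv_cong:
  assumes N: "atlas N" and "p \<in> carrier N" and eq: "\<And>q. q \<in> carrier N \<Longrightarrow> f q = h q"
  shows "mfderiv N M f p = mfderiv N M h p"
proof -
  have "drep (chart_at N p) (chart_at M (f p)) f p = drep (chart_at N p) (chart_at M (f p)) h p"
    by (rule drep_cong[OF N chart_at_in[OF assms(2)] openin_topspace[of "mtop N"]]) (use assms in auto)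
  then show ?thesis using assms(2) eq by (simp add: mfderiv_drep)
qed

lemma mfderiv_ident: "atlas M \<Longrightarrow> p \<in> carrier M \<Longrightarrow> mfderiv M M (\<lambda>p. p) p v = v"
  by (simp add: mfderiv_drep drep_ident chart_at_in)

text \<open>Two readings of the chain rule: \<open>f\<close> followed by the identity and the
  identity followed by \<open>f\<close>. It replaces components in pointwise chosen charts by
  components in fixed ones.\<close>

lemma to_chart_mfderiv:
  assumes N: "atlas N" and M: "atlas M" and f: "smooth_map N M f"
    and a: "a \<in> N" "p \<in> fst a" and c: "c \<in> M" "f p \<in> fst c"
  shows "to_chart M c (f p) (mfderiv N M f p v) = drep a c f p (to_chart N a p v)"
  using drep_compose[OF N M f smooth_map_id[OF M] chart_at_in[OF chart_dom_carrier[OF a]]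
      chart_at_in[OF chart_dom_carrier[OF c]] c, of v]
    drep_compose[OF N N smooth_map_id[OF N] f chart_at_in[OF chart_dom_carrier[OF a]] a c, of v]
  by (simp add: mfderiv_drep to_chart_drep)

lemma to_chart_mfderiv_from_chart:
  assumes "atlas N" "atlas M" "smooth_map N M f" "a \<in> N" "p \<in> fst a" "c \<in> M" "f p \<in> fst c"
  shows "to_chart M c (f p) (mfderiv N M f p (from_chart N a p v)) = drep a c f p v"
  using to_chart_mfderiv[OF assms] from_to_chart[OF assms(1,4,5)] by simp

lemma linear_to_chart: "atlas M \<Longrightarrow> c \<in> M \<Longrightarrow> p \<in> fst c \<Longrightarrow> linear (to_chart M c p)"
  and linear_from_chart: "atlas M \<Longrightarrow> c \<in> M \<Longrightarrow> p \<in> fst c \<Longrightarrow> linear (from_chart M c p)"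
  unfolding to_chart_drep from_chart_drep
  by (rule linear_drep[OF smooth_map_id]; use chart_at_in[OF chart_dom_carrier[of c M p]] in simp)+

section \<open>Metrics in coordinates and their pullbacks\<close>

lemma metric_in_chart_at:
  assumes "atlas M" "c \<in> M" "p \<in> fst c"
  shows "metric_in_chart M g c (snd c p) u v = g p (from_chart M c p u) (from_chart M c p v)"
  using chart_inv_chart[OF assms] by (simp add: metric_in_chart_def Let_def)

lemma metric_in_chart_to_chart:
  assumes "atlas M" "c \<in> M" "p \<in> fst c"
  shows "g p u v = metric_in_chart M g c (snd c p) (to_chart M c p u) (to_chart M c p v)"
  using metric_in_chart_at[OF assms] from_to_chart[OF assms] by simp

lemma bilinear_metric_in_chart:
  assumes M: "atlas M" and g: "symmetric_tensor M g" and c: "c \<in> M" "p \<in> fst c"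
  shows "bilinear (metric_in_chart M g c (snd c p))"
proof -
  have b: "bilinear (g p)" using g chart_dom_carrier[OF c] by (auto simp: symmetric_tensor_def)
  have l: "linear (from_chart M c p)" by (rule linear_from_chart[OF M c])
  show ?thesis
    unfolding bilinear_def metric_in_chart_at[OF M c] using b l linear_compose[OF l]
    by (auto simp: bilinear_def comp_def)
qed

lemma bilinear_euclidean_expand:
  fixes B :: "'a::euclidean_space \<Rightarrow> 'b::euclidean_space \<Rightarrow> 'c::real_vector"
  assumes "bilinear B"
  shows "B u v = (\<Sum>i\<in>Basis. \<Sum>j\<in>Basis. (u \<bullet> i) *\<^sub>R ((v \<bullet> j) *\<^sub>R B i j))"
proof -
  have "B (\<Sum>i\<in>Basis. (u \<bullet> i) *\<^sub>R i) (\<Sum>j\<in>Basis. (v \<bullet> j) *\<^sub>R j) =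
     (\<Sum>i\<in>Basis. \<Sum>j\<in>Basis. (u \<bullet> i) *\<^sub>R ((v \<bullet> j) *\<^sub>R B i j))"
    using assms by (simp add: bilinear_sum sum.cartesian_product[symmetric] bilinear_lmul bilinear_rmul)
  then show ?thesis by (simp add: euclidean_representation)
qed

text \<open>The tensor is given as smooth on constant vectors only; bilinear expansion in the basis
  extends this to arguments that vary smoothly together with the point.\<close>

lemma metric_smooth_apply:
  assumes M: "atlas M" and g: "symmetric_tensor M g" and c: "c \<in> M"
    and X: "open X" and x: "smooth_on X x" "x ` X \<subseteq> snd c ` fst c" and uv: "smooth_on X u" "smooth_on X v"
  shows "smooth_on X (\<lambda>t. metric_in_chart M g c (x t) (u t) (v t))"
proof -
  have g': "smooth_on (snd c ` fst c) (\<lambda>x. metric_in_chart M g c x i j)" for i j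
    using g c by (simp add: symmetric_tensor_def)
  have "smooth_on X (\<lambda>t. metric_in_chart M g c (x t) i j)" for i j
    by (rule smooth_on_compose[OF g' x(1) X x(2)])
  then have "smooth_on X (\<lambda>t. \<Sum>i\<in>Basis. \<Sum>j\<in>Basis. (u t \<bullet> i) * ((v t \<bullet> j) * metric_in_chart M g c (x t) i j))"
    by (intro smooth_on_sum smooth_on_mult smooth_on_inner X uv smooth_on_const)
  then show ?thesis
  proof (rule smooth_on_cong[OF X, rotated])
    fix t assume "t \<in> X"
    then obtain p where "p \<in> fst c" "x t = snd c p" using x(2) by auto
    then show "metric_in_chart M g c (x t) (u t) (v t) =
      (\<Sum>i\<in>Basis. \<Sum>j\<in>Basis. (u t \<bullet> i) * ((v t \<bullet> j) * metric_in_chart M g c (x t) i j))"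
      using bilinear_euclidean_expand[OF bilinear_metric_in_chart[OF M g c]] by simp
  qed
qed

lemma drep_smooth:
  assumes N: "atlas N" and f: "smooth_map N M f" and a: "a \<in> N" and c: "c \<in> M"
  shows "smooth_on (snd a ` {q \<in> fst a. f q \<in> fst c}) (\<lambda>x. drep a c f (chart_inv a x) u)"
proof (rule smooth_on_cong[OF smooth_map_open_rep[OF N f a openin_mtop_chart[OF c]] _
       smooth_on_frechet_derivative[OF smooth_map_smooth_rep[OF f a c], of u]])
qed (use chart_inv_chart[OF N a] in \<open>auto simp: drep_def\<close>)

lemma pullback_metric_drep:
  assumes N: "atlas N" and M: "atlas M" and f: "smooth_map N M f"
    and a: "a \<in> N" "p \<in> fst a" and c: "c \<in> M" "f p \<in> fst c"
  shows "pullback_metric N M f g p (from_chart N a p u) (from_chart N a p v) =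
    metric_in_chart M g c (snd c (f p)) (drep a c f p u) (drep a c f p v)"
  unfolding pullback_metric_def metric_in_chart_to_chart[OF M c]
  by (simp add: to_chart_mfderiv_from_chart[OF N M f a c])

lemma pullback_metric_smooth:
  assumes N: "atlas N" and M: "atlas M" and f: "smooth_map N M f" and g: "symmetric_tensor M g"
    and a: "a \<in> N"
  shows "smooth_on (snd a ` fst a) (\<lambda>x. metric_in_chart N (pullback_metric N M f g) a x u v)"
proof (rule smooth_on_local)
  fix x assume "x \<in> snd a ` fst a"
  then obtain p where p: "p \<in> fst a" "x = snd a p" by blast
  obtain c where c: "c \<in> M" "f p \<in> fst c"
    using smooth_map_carrier[OF f chart_dom_carrier[OF a p(1)]] by (auto simp: carrier_def)
  let ?X = "snd a ` {q \<in> fst a. f q \<in> fst c}"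
  have X: "open ?X" by (rule smooth_map_open_rep[OF N f a openin_mtop_chart[OF c(1)]])
  have "smooth_on ?X (\<lambda>x. metric_in_chart M g c ((snd c \<circ> f \<circ> chart_inv a) x) 
      (drep a c f (chart_inv a x) u) (drep a c f (chart_inv a x) v))"
    by (intro metric_smooth_apply[OF M g c(1) X] smooth_map_smooth_rep[OF f a c(1)] drep_smooth[OF N f a c(1)])
       (auto simp: chart_inv_chart[OF N a])
  then have "smooth_on ?X (\<lambda>x. metric_in_chart N (pullback_metric N M f g) a x u v)"
    by (rule smooth_on_cong[OF X, rotated])
       (auto simp: chart_inv_chart[OF N a] metric_in_chart_at[OF N a] pullback_metric_drep[OF N M f a _ c(1)])
  then show "\<exists>Y. open Y \<and> x \<in> Y \<and> smooth_on Y (\<lambda>x. metric_in_chart N (pullback_metric N M f g) a x u v)"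
    using X p c by blast
qed

lemma symmetric_tensor_pullback:
  assumes N: "atlas N" and M: "atlas M" and f: "smooth_map N M f" and g: "symmetric_tensor M g"
  shows "symmetric_tensor N (pullback_metric N M f g)"
proof -
  have "bilinear (pullback_metric N M f g p)" if p: "p \<in> carrier N" for p
  proof -
    have l: "linear (mfderiv N M f p)" by (rule linear_mfderiv[OF f p])
    have "linear (g (f p) w)" "linear (\<lambda>v. g (f p) v w)" for w
      using g smooth_map_carrier[OF f p] by (auto simp: symmetric_tensor_def bilinear_def)
    then show ?thesis
      using linear_compose[OF l] by (auto simp: bilinear_def pullback_metric_def comp_def)
  qed
  then show ?thesis
    using g pullback_metric_smooth[OF assms] smooth_map_carrier[OF f]
    by (auto simp: symmetric_tensor_def pullback_metric_def)
qed

lemma diffeomorphism_homeomorphic: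
  "diffeomorphism N M f \<Longrightarrow> mtop N homeomorphic_space mtop M"
  unfolding homeomorphic_space_def homeomorphic_maps_def
  by (intro exI[of _ f] exI[of _ "inv_into (carrier N) f"])
     (auto simp: diffeomorphism_def smooth_map_def bij_betw_def f_inv_into_f)

lemma mfderiv_diffeomorphism_inverse:
  assumes N: "atlas N" and M: "atlas M" and f: "diffeomorphism N M f" and p: "p \<in> carrier N"
  shows "mfderiv M N (inv_into (carrier N) f) (f p) (mfderiv N M f p v) = v"
    and "mfderiv N M f p (mfderiv M N (inv_into (carrier N) f) (f p) w) = w"
proof -
  have b: "bij_betw f (carrier N) (carrier M)" and s: "smooth_map N M f" "smooth_map M N (inv_into (carrier N) f)"
    using f by (auto simp: diffeomorphism_def)
  have fp: "f p \<in> carrier M" by (rule smooth_map_carrier[OF s(1) p])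
  have inv: "inv_into (carrier N) f (f q) = q" if "q \<in> carrier N" for q
    using b that by (simp add: bij_betw_def)
  have inv': "f (inv_into (carrier N) f q) = q" if "q \<in> carrier M" for q
    using b that by (simp add: bij_betw_def f_inv_into_f)
  show "mfderiv M N (inv_into (carrier N) f) (f p) (mfderiv N M f p v) = v"
    using mfderiv_compose[OF N M s p, of v] mfderiv_ident[OF N p]
      mfderiv_cong[OF N p inv, of _ N] by simp
  show "mfderiv N M f p (mfderiv M N (inv_into (carrier N) f) (f p) w) = w"
    using mfderiv_compose[OF M N s(2,1) fp, of w] mfderiv_ident[OF M fp]
      mfderiv_cong[OF M fp inv', of _ M] inv[OF p] by simp
qed

section \<open>Image manifolds\<close>

abbreviation image_chart :: "('m \<Rightarrow> 'n) \<Rightarrow> ('m, 'e) mfld \<Rightarrow> ('m, 'e) chart \<Rightarrow> ('n, 'e) chart"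
  where "image_chart f M c \<equiv> (f ` fst c, snd c \<circ> inv_into (carrier M) f)"

lemma image_mfld_eq: "image_mfld f M = image_chart f M ` M"
  by (force simp: image_mfld_def)

lemma carrier_image_mfld: "carrier (image_mfld f M) = f ` carrier M"
  by (auto simp: carrier_def image_mfld_eq)

context
  fixes M :: "('m, 'e::euclidean_space) mfld" and f :: "'m \<Rightarrow> 'n"
  assumes M: "atlas M" and inj: "inj_on f (carrier M)"
begin

lemma image_chart_apply: "c \<in> M \<Longrightarrow> p \<in> carrier M \<Longrightarrow> snd (image_chart f M c) (f p) = snd c p"
  using inj by simp

lemma image_chart_image: "c \<in> M \<Longrightarrow> snd (image_chart f M c) ` fst (image_chart f M c) = snd c ` fst c"
proof -
  assume c: "c \<in> M"
  have "(\<lambda>p. snd (image_chart f M c) (f p)) ` fst c = snd c ` fst c"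
    by (rule image_cong[OF refl]) (rule image_chart_apply[OF c chart_dom_carrier[OF c]])
  then show ?thesis by (simp add: image_image)
qed

lemma image_chart_mem: "c \<in> M \<Longrightarrow> p \<in> carrier M \<Longrightarrow> f p \<in> fst (image_chart f M c) \<longleftrightarrow> p \<in> fst c"
  using inj chart_dom_carrier[of c M] by (auto simp: inj_on_def)

lemma inj_on_image_chart: "c \<in> M \<Longrightarrow> inj_on (snd (image_chart f M c)) (fst (image_chart f M c))"
proof (rule inj_onI)
  fix p q assume c: "c \<in> M" and "p \<in> fst (image_chart f M c)" "q \<in> fst (image_chart f M c)"
    and eq: "snd (image_chart f M c) p = snd (image_chart f M c) q"
  then obtain p' q' where p: "p = f p'" "p' \<in> fst c" and q: "q = f q'" "q' \<in> fst c" by auto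
  then have "snd c p' = snd c q'" using image_chart_apply[OF c] chart_dom_carrier[OF c] eq by metis
  then show "p = q" using chart_inv_chart[OF M c] p q by metis
qed

lemma chart_inv_image_chart:
  assumes "c \<in> M" "x \<in> snd c ` fst c"
  shows "chart_inv (image_chart f M c) x = f (chart_inv c x)"
proof -
  obtain p where p: "p \<in> fst c" "x = snd c p" using assms by blast
  have "chart_inv (image_chart f M c) (snd (image_chart f M c) (f p)) = f p"
    by (rule chart_inv_chart'[OF inj_on_image_chart[OF assms(1)]]) (use p in simp)
  then show ?thesis
    unfolding p(2) image_chart_apply[OF assms(1) chart_dom_carrier[OF assms(1) p(1)]]
      chart_inv_chart[OF M assms(1) p(1)] .
qed

lemma image_chart_overlap:
  assumes "c \<in> M" "c' \<in> M"
  shows "snd (image_chart f M c) ` (fst (image_chart f M c) \<inter> fst (image_chart f M c')) = snd c ` (fst c \<inter> fst c')"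
proof -
  have "f ` fst c \<inter> f ` fst c' = f ` (fst c \<inter> fst c')"
    using chart_dom_carrier[OF assms(1)] chart_dom_carrier[OF assms(2)]
    by (intro inj_on_image_Int[OF inj, symmetric] subsetI)
  then show ?thesis using image_chart_apply[OF assms(1)] chart_dom_carrier[OF assms(1)]
    by (simp add: image_image)
qed

lemma atlas_image_mfld: "atlas (image_mfld f M)"
proof -
  have "smooth_on (snd c ` (fst c \<inter> fst c')) (snd (image_chart f M c') \<circ> chart_inv (image_chart f M c))"
    if c: "c \<in> M" "c' \<in> M" for c c'
  proof (rule smooth_on_cong[where h="snd c' \<circ> chart_inv c"])
    show "open (snd c ` (fst c \<inter> fst c'))" "smooth_on (snd c ` (fst c \<inter> fst c')) (snd c' \<circ> chart_inv c)"
      using M c by (auto simp: atlas_def)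
    fix x assume "x \<in> snd c ` (fst c \<inter> fst c')"
    then obtain p where p: "p \<in> fst c" "x = snd c p" by blast
    then show "(snd (image_chart f M c') \<circ> chart_inv (image_chart f M c)) x = (snd c' \<circ> chart_inv c) x"
      using chart_inv_image_chart[OF c(1), of x] chart_inv_chart[OF M c(1) p(1)]
        image_chart_apply[OF c(2) chart_dom_carrier[OF c(1) p(1)]] by simp
  qed
  then show ?thesis
    using M unfolding atlas_def image_mfld_eq
    by (simp add: inj_on_image_chart[simplified] image_chart_overlap[simplified] image_chart_image[simplified])
qed

lemma diffeomorphism_image_mfld: "diffeomorphism M (image_mfld f M) f"
proof -
  note N = atlas_image_mfld
  have "smooth_map M (image_mfld f M) f"
  proof (rule smooth_mapI[OF M N])
    fix p assume p: "p \<in> carrier M"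
    then obtain a where a: "a \<in> M" "p \<in> fst a" by (auto simp: carrier_def)
    let ?X = "snd a ` fst a" and ?c = "image_chart f M a"
    have X: "open ?X" using M a by (auto simp: atlas_def)
    have "smooth_on ?X (snd ?c \<circ> f \<circ> chart_inv a)"
      by (rule smooth_on_cong[OF X _ smooth_on_ident])
         (use chart_inv_chart[OF M a(1)] image_chart_apply[OF a(1) chart_dom_carrier[OF a(1)]] in auto)
    then show "\<exists>a\<in>M. \<exists>c\<in>image_mfld f M. \<exists>X. p \<in> fst a \<and> open X \<and> snd a p \<in> X \<and> X \<subseteq> snd a ` fst a \<and>
      f ` chart_inv a ` X \<subseteq> fst c \<and> smooth_on X (snd c \<circ> f \<circ> chart_inv a)"
      using a X by (intro bexI[of _ a] bexI[of _ ?c] exI[of _ ?X])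
        (auto simp: chart_inv_chart[OF M a(1)] image_mfld_eq)
  qed
  moreover have "smooth_map (image_mfld f M) M (inv_into (carrier M) f)"
  proof (rule smooth_mapI[OF N M])
    fix q assume "q \<in> carrier (image_mfld f M)"
    then obtain p where p: "p \<in> carrier M" "q = f p" by (auto simp: carrier_image_mfld)
    then obtain a where a: "a \<in> M" "p \<in> fst a" by (auto simp: carrier_def)
    let ?X = "snd a ` fst a" and ?c = "image_chart f M a"
    have X: "open ?X" using M a by (auto simp: atlas_def)
    have eq: "inv_into (carrier M) f (chart_inv ?c x) = chart_inv a x" if "x \<in> ?X" for x
      using chart_inv_image_chart[OF a(1) that] inj chart_inv_in[OF that] chart_dom_carrier[OF a(1)] by simp
    have "smooth_on ?X (snd a \<circ> inv_into (carrier M) f \<circ> chart_inv ?c)"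
      by (rule smooth_on_cong[OF X _ smooth_on_ident])
         (use chart_chart_inv[of _ a] eq in simp)
    moreover have "snd ?c q = snd a p" using p inj by simp
    ultimately show "\<exists>a\<in>image_mfld f M. \<exists>c\<in>M. \<exists>X. q \<in> fst a \<and> open X \<and> snd a q \<in> X \<and> X \<subseteq> snd a ` fst a \<and>
      inv_into (carrier M) f ` chart_inv a ` X \<subseteq> fst c \<and> smooth_on X (snd c \<circ> inv_into (carrier M) f \<circ> chart_inv a)"
      using a X p eq chart_inv_in[of _ a] image_chart_image[OF a(1)]
      by (intro bexI[of _ ?c] bexI[of _ a] exI[of _ ?X]) (auto simp: image_mfld_eq simp del: o_apply)
  qed
  ultimately show ?thesis
    using inj by (simp add: diffeomorphism_def bij_betw_def carrier_image_mfld)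
qed

text \<open>An image chart is the old chart transported by \<open>f\<close>, so its inverse is
  \<open>f\<close> after the old inverse. Derivatives of maps on \<Sigma> thereby become derivatives
  on the cylinder.\<close>

lemma drep_image_chart_dom:
  assumes c: "c \<in> M" "p \<in> fst c"
  shows "drep (image_chart f M c) d h (f p) = drep c d (\<lambda>p. h (f p)) p"
proof -
  have "open (snd c ` fst c)" "snd c p \<in> snd c ` fst c" using M c by (auto simp: atlas_def)
  then have "frechet_derivative (snd d \<circ> h \<circ> chart_inv (image_chart f M c)) (at (snd c p)) =
    frechet_derivative (snd d \<circ> (\<lambda>p. h (f p)) \<circ> chart_inv c) (at (snd c p))"
    by (rule frechet_derivative_cong_open) (simp add: chart_inv_image_chart[OF c(1)])
  then show ?thesis
    using image_chart_apply[OF c(1) chart_dom_carrier[OF c]] unfolding drep_def by metis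
qed

end

lemma smooth_manifold_image_mfld:
  assumes "smooth_manifold M" "inj_on f (carrier M)"
  shows "smooth_manifold (image_mfld f M)"
proof -
  note M = smooth_manifold_atlas[OF assms(1)]
  note h = diffeomorphism_homeomorphic[OF diffeomorphism_image_mfld[OF M assms(2)]]
  have "Hausdorff_space (mtop (image_mfld f M))" "second_countable (mtop (image_mfld f M))"
    using assms(1) homeomorphic_Hausdorff_space[OF h] homeomorphic_space_second_countability[OF h]
    by (auto simp: smooth_manifold_def)
  then show ?thesis
    using atlas_image_mfld[OF M assms(2)] by (simp add: smooth_manifold_def atlas_def)
qed

section \<open>Open subsets of cylinders\<close>

abbreviation cyl_chart :: "('m \<times> real) set \<Rightarrow> ('m, 'e) chart \<Rightarrow> ('m \<times> real, 'e \<times> real) chart"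
  where "cyl_chart W a \<equiv> ((fst a \<times> UNIV) \<inter> W, \<lambda>(p, t). (snd a p, t))"

text \<open>\<open>flow_mfld\<close> with its charts indexed by those of \<open>S\<close>, the line
  having the identity as its only chart.\<close>

definition cylinder :: "('m, 'e) mfld \<Rightarrow> ('m \<times> real) set \<Rightarrow> ('m \<times> real, 'e \<times> real) mfld"
  where "cylinder S W = cyl_chart W ` S"

lemma flow_mfld_cylinder: "flow_mfld S \<xi> V = cylinder S (flow_domain S \<xi> V)"
proof -
  have 1: "prod_mfld S real_line = {(D \<times> UNIV, \<lambda>(p, t). (\<phi> p, t)) | D \<phi>. (D, \<phi>) \<in> S}"
    by (simp add: prod_mfld_def real_line_def)
  have "open_sub (prod_mfld S real_line) W = {cyl_chart W (D, \<phi>) | D \<phi>. (D, \<phi>) \<in> S}" for W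
    unfolding open_sub_def 1 by auto
  also have "\<dots> W = cyl_chart W ` S" for W
    by (auto simp: image_iff Bex_def simp del: fst_conv snd_conv)
  finally show ?thesis by (simp add: flow_mfld_def cylinder_def)
qed

text \<open>Openness of \<open>W\<close> is phrased in coordinates, the form in which it is later
  extracted from the topology of the normal bundle.\<close>

locale open_cylinder =
  fixes S :: "('m, 'e::euclidean_space) mfld" and W :: "('m \<times> real) set"
  assumes S: "atlas S"
    and open_W: "\<And>a. a \<in> S \<Longrightarrow> open ((\<lambda>(p, t). (snd a p, t)) ` ((fst a \<times> UNIV) \<inter> W))"
    and W_subset: "W \<subseteq> carrier S \<times> UNIV"
begin

lemma inj_cyl_chart: "a \<in> S \<Longrightarrow> inj_on (snd (cyl_chart W a)) (fst (cyl_chart W a))"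
  using S by (auto simp: atlas_def inj_on_def)

lemma carrier_cylinder: "carrier (cylinder S W) = W"
  using W_subset by (fastforce simp: cylinder_def carrier_def)

lemma chart_inv_cyl:
  assumes "a \<in> S" "p \<in> fst a" "(p, t) \<in> W"
  shows "chart_inv (cyl_chart W a) (snd a p, t) = (p, t)"
  using chart_inv_chart'[OF inj_cyl_chart[OF assms(1)], of "(p, t)"] assms by simp

lemma atlas_cylinder: "atlas (cylinder S W)"
proof -
  have ov: "open (snd (cyl_chart W a) ` (fst (cyl_chart W a) \<inter> fst (cyl_chart W b))) \<and>
    smooth_on (snd (cyl_chart W a) ` (fst (cyl_chart W a) \<inter> fst (cyl_chart W b))) (snd (cyl_chart W b) \<circ> chart_inv (cyl_chart W a))"
    if a: "a \<in> S" "b \<in> S" for a b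
  proof -
    let ?X = "snd (cyl_chart W a) ` (fst (cyl_chart W a) \<inter> fst (cyl_chart W b))"
    have o: "open (snd a ` (fst a \<inter> fst b))" and s: "smooth_on (snd a ` (fst a \<inter> fst b)) (snd b \<circ> chart_inv a)"
      using S a by (auto simp: atlas_def)
    have "?X = (\<lambda>(p, t). (snd a p, t)) ` ((fst a \<times> UNIV) \<inter> W) \<inter> (snd a ` (fst a \<inter> fst b)) \<times> UNIV"
    proof -
      have inj: "x = y" if "x \<in> fst a" "y \<in> fst a" "snd a x = snd a y" for x y
        using chart_inv_chart[OF S a(1)] that by metis
      show ?thesis by (fastforce dest: inj)
    qed
    then have X: "open ?X" using open_W[OF a(1)] o by (auto intro: open_Times)
    have "smooth_on ?X (\<lambda>x. ((snd b \<circ> chart_inv a) (fst x), snd x))"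
      by (intro smooth_on_Pair[OF X] smooth_on_compose[OF s] smooth_on_fst smooth_on_snd smooth_on_ident X) auto
    then have "smooth_on ?X (snd (cyl_chart W b) \<circ> chart_inv (cyl_chart W a))"
      by (rule smooth_on_cong[OF X, rotated])
         (use chart_inv_cyl[OF a(1)] chart_inv_chart[OF S a(1)] in auto)
    then show ?thesis using X by blast
  qed
  show ?thesis
    unfolding atlas_def cylinder_def using ov inj_cyl_chart open_W by simp
qed

lemma smooth_map_cylinder_fst: "smooth_map (cylinder S W) S fst"
proof (rule smooth_mapI[OF atlas_cylinder S])
  fix z assume "z \<in> carrier (cylinder S W)"
  then obtain p t where pt: "z = (p, t)" "(p, t) \<in> W" by (cases z) (simp add: carrier_cylinder)
  then have "p \<in> carrier S" using W_subset by auto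
  then obtain a where "a \<in> S" "p \<in> fst a" by (auto simp: carrier_def)
  note z = pt this
  let ?b = "cyl_chart W a"
  let ?X = "snd ?b ` fst ?b"
  have X: "open ?X" using open_W[OF z(3)] by simp
  have "smooth_on ?X (snd a \<circ> fst \<circ> chart_inv ?b)"
    by (rule smooth_on_cong[OF X _ smooth_on_fst[OF X smooth_on_ident]])
       (use chart_inv_cyl[OF z(3)] in auto)
  then show "\<exists>a\<in>cylinder S W. \<exists>c\<in>S. \<exists>X. z \<in> fst a \<and> open X \<and> snd a z \<in> X \<and> X \<subseteq> snd a ` fst a \<and>
      fst ` chart_inv a ` X \<subseteq> fst c \<and> smooth_on X (snd c \<circ> fst \<circ> chart_inv a)"
    using z X chart_inv_cyl[OF z(3)]
    by (intro bexI[of _ ?b] bexI[of _ a] exI[of _ ?X]) (auto simp: cylinder_def)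
qed

lemma smooth_map_slice:
  assumes t: "\<And>p. p \<in> carrier S \<Longrightarrow> (p, t) \<in> W"
  shows "smooth_map S (cylinder S W) (\<lambda>p. (p, t))"
proof (rule smooth_mapI[OF S atlas_cylinder])
  fix p assume p: "p \<in> carrier S"
  then obtain a where a: "a \<in> S" "p \<in> fst a" by (auto simp: carrier_def)
  let ?X = "snd a ` fst a" and ?b = "cyl_chart W a"
  have X: "open ?X" using S a by (auto simp: atlas_def)
  have "smooth_on ?X (snd ?b \<circ> (\<lambda>p. (p, t)) \<circ> chart_inv a)"
    by (rule smooth_on_cong[OF X _ smooth_on_Pair[OF X smooth_on_ident smooth_on_const]])
       (auto simp: chart_inv_chart[OF S a(1)])
  then show "\<exists>a\<in>S. \<exists>c\<in>cylinder S W. \<exists>X. p \<in> fst a \<and> open X \<and> snd a p \<in> X \<and> X \<subseteq> snd a ` fst a \<and>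
      (\<lambda>p. (p, t)) ` chart_inv a ` X \<subseteq> fst c \<and> smooth_on X (snd c \<circ> (\<lambda>p. (p, t)) \<circ> chart_inv a)"
    using a X t chart_dom_carrier[OF a(1)]
    by (intro bexI[of _ a] bexI[of _ ?b] exI[of _ ?X]) (auto simp: chart_inv_chart[OF S a(1)] cylinder_def)
qed

lemma drep_cyl_slice:
  assumes a: "a \<in> S" "p \<in> fst a" and b: "b \<in> S" "p \<in> fst b"
  shows "drep a (cyl_chart W b) (\<lambda>p. (p, t)) p v = (drep a b (\<lambda>p. p) p v, 0)"
proof -
  let ?X = "snd a ` (fst a \<inter> fst b)"
  have X: "open ?X" "snd a p \<in> ?X" using S a b by (auto simp: atlas_def)
  have "((\<lambda>x. ((snd b \<circ> (\<lambda>p. p) \<circ> chart_inv a) x, t)) has_derivative (\<lambda>v. (drep a b (\<lambda>p. p) p v, 0))) (at (snd a p))"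
    by (intro has_derivative_Pair smooth_map_has_derivative[OF smooth_map_id[OF S]] a b has_derivative_const)
  then have "((snd (cyl_chart W b) \<circ> (\<lambda>p. (p, t)) \<circ> chart_inv a) has_derivative (\<lambda>v. (drep a b (\<lambda>p. p) p v, 0))) (at (snd a p))"
    by (simp add: comp_def)
  then show ?thesis by (rule drep_eqI[THEN fun_cong])
qed

lemma drep_cyl_fst:
  assumes a: "a \<in> S" "p \<in> fst a" and b: "b \<in> S" "p \<in> fst b" and W: "(p, t) \<in> W"
  shows "drep (cyl_chart W a) b fst (p, t) v = drep a b (\<lambda>p. p) p (fst v)"
proof -
  let ?X = "snd (cyl_chart W a) ` fst (cyl_chart W a)"
  have X: "open ?X" using open_W[OF a(1)] by simp
  have "(snd a p, t) \<in> ?X" by (rule image_eqI[of _ _ "(p, t)"]) (use a W in auto)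
  note X = X this
  have "((\<lambda>x. (snd b \<circ> (\<lambda>p. p) \<circ> chart_inv a) (fst x)) has_derivative (\<lambda>v. drep a b (\<lambda>p. p) p (fst v))) (at (snd a p, t))"
    by (rule has_derivative_compose[OF has_derivative_fst[OF has_derivative_ident]])
      (use smooth_map_has_derivative[OF smooth_map_id[OF S] a(1) b(1) a(2) b(2)] in \<open>simp add: comp_def\<close>)
  then have "((snd b \<circ> fst \<circ> chart_inv (cyl_chart W a)) has_derivative (\<lambda>v. drep a b (\<lambda>p. p) p (fst v))) (at (snd a p, t))"
    by (rule has_derivative_transform_within_open[OF _ X])
       (use chart_inv_cyl[OF a(1)] chart_inv_chart[OF S a(1)] in auto)
  then show ?thesis using drep_eqI[of b fst "cyl_chart W a" _ "(p, t)"] by simp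
qed

text \<open>A change of product charts is the change on \<open>S\<close> times the identity. Its
  derivative does not involve \<open>t\<close>, which makes the notion of constant components along
  a generator independent of the product chart.\<close>

lemma drep_cyl_cyl:
  assumes a: "a \<in> S" "p \<in> fst a" and b: "b \<in> S" "p \<in> fst b" and W: "(p, t) \<in> W"
  shows "drep (cyl_chart W a) (cyl_chart W b) (\<lambda>z. z) (p, t) v = (drep a b (\<lambda>p. p) p (fst v), snd v)"
proof -
  let ?X = "snd (cyl_chart W a) ` fst (cyl_chart W a)"
  have X: "open ?X" using open_W[OF a(1)] by simp
  have "(snd a p, t) \<in> ?X" by (rule image_eqI[of _ _ "(p, t)"]) (use a W in auto)
  note X = X this
  have "((\<lambda>x. (snd b \<circ> (\<lambda>p. p) \<circ> chart_inv a) (fst x)) has_derivative (\<lambda>v. drep a b (\<lambda>p. p) p (fst v))) (at (snd a p, t))"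
    by (rule has_derivative_compose[OF has_derivative_fst[OF has_derivative_ident]])
      (use smooth_map_has_derivative[OF smooth_map_id[OF S] a(1) b(1) a(2) b(2)] in \<open>simp add: comp_def\<close>)
  then have "((\<lambda>x. ((snd b \<circ> (\<lambda>p. p) \<circ> chart_inv a) (fst x), snd x)) has_derivative
      (\<lambda>v. (drep a b (\<lambda>p. p) p (fst v), snd v))) (at (snd a p, t))"
    by (intro has_derivative_Pair has_derivative_snd has_derivative_ident)
  then have "((snd (cyl_chart W b) \<circ> (\<lambda>z. z) \<circ> chart_inv (cyl_chart W a)) has_derivative
      (\<lambda>v. (drep a b (\<lambda>p. p) p (fst v), snd v))) (at (snd a p, t))"
    by (rule has_derivative_transform_within_open[OF _ X])
       (use chart_inv_cyl[OF a(1)] chart_inv_chart[OF S a(1)] in auto)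
  then show ?thesis using drep_eqI[of "cyl_chart W b" "\<lambda>z. z" "cyl_chart W a" _ "(p, t)"] by simp
qed

lemma chart_at_cylinder:
  assumes "(p, t) \<in> W"
  obtains a where "a \<in> S" "p \<in> fst a" "chart_at (cylinder S W) (p, t) = cyl_chart W a"
  using chart_at_in[of "(p, t)" "cylinder S W"] assms unfolding carrier_cylinder
  by (auto simp: cylinder_def)

text \<open>Every chart of the cylinder is a product chart, so the one chosen at the point is as
  well, and horizontal vectors are those with last component 0 whatever the choice.\<close>

lemma range_mfderiv_slice:
  assumes W: "(p, t) \<in> W"
  shows "range (mfderiv S (cylinder S W) (\<lambda>p. (p, t)) p) = UNIV \<times> {0}"
proof -
  obtain b where b: "b \<in> S" "p \<in> fst b" "chart_at (cylinder S W) (p, t) = cyl_chart W b"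
    using chart_at_cylinder[OF W] .
  have p: "p \<in> carrier S" using W W_subset by auto
  note a = chart_at_in[OF p]
  have "mfderiv S (cylinder S W) (\<lambda>p. (p, t)) p v = (drep (chart_at S p) b (\<lambda>p. p) p v, 0)" for v
    by (simp add: mfderiv_drep b(3) drep_cyl_slice[OF a b(1,2)])
  moreover have "range (drep (chart_at S p) b (\<lambda>p. p) p) = UNIV"
    using drep_change[OF S b(1,2) a] by (metis surjI)
  ultimately show ?thesis by (auto simp: image_iff)
qed

lemma velocity_vertical:
  assumes W: "(p, t) \<in> W"
  shows "velocity (cylinder S W) (\<lambda>s. (p, s)) t = (0, 1)"
proof -
  obtain b where b: "b \<in> S" "p \<in> fst b" "chart_at (cylinder S W) (p, t) = cyl_chart W b"
    using chart_at_cylinder[OF W] .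
  have r: "chart_at real_line t = (UNIV, id)"
    using chart_at_in[of t real_line] by (auto simp: real_line_def carrier_def)
  have "chart_inv (UNIV, id) = (id :: real \<Rightarrow> real)"
    by (auto simp: chart_inv_def fun_eq_iff inv_into_def)
  then have "((snd (cyl_chart W b) \<circ> (\<lambda>s. (p, s)) \<circ> chart_inv (UNIV, id)) has_derivative (\<lambda>v. (0, v))) (at t)"
    by (auto simp: comp_def intro!: derivative_eq_intros)
  then show ?thesis
    using drep_eqI[of "cyl_chart W b" "\<lambda>s. (p, s)" "(UNIV, id)" "\<lambda>v. (0, v)" t]
    by (simp add: velocity_def mfderiv_drep r b(3))
qed

end

section \<open>Geodesics\<close>

text \<open>Product rule for a linear map applied to a vector when both depend on \<open>s\<close>,
  obtained by expanding the vector in the basis. It supplies the second derivative of a curve under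
  a change of coordinates.\<close>

lemma frechet_apply_has_derivative:
  fixes f :: "'b::euclidean_space \<Rightarrow> 'c::real_normed_vector"
  assumes f: "smooth_on X f" and X: "open X" "h t \<in> X"
    and h: "(h has_derivative h') (at t)" and w: "(w has_derivative w') (at t)"
  shows "((\<lambda>s. frechet_derivative f (at (h s)) (w s)) has_derivative
    (\<lambda>v. frechet_derivative (\<lambda>z. frechet_derivative f (at z) (w t)) (at (h t)) (h' v) +
         frechet_derivative f (at (h t)) (w' v))) (at t)"
proof -
  let ?D = "\<lambda>z. frechet_derivative f (at z)"
  let ?DD = "\<lambda>i. frechet_derivative (\<lambda>z. ?D z i) (at (h t))"
  have exp: "?D z u = (\<Sum>i\<in>Basis. (u \<bullet> i) *\<^sub>R ?D z i)" if "z \<in> X" for z u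
    by (rule linear_frechet_expand[OF smooth_on_linear_derivative[OF f that]])
  have D: "((\<lambda>z. ?D z i) has_derivative ?DD i) (at (h t))" for i
    by (rule smooth_on_has_derivative[OF smooth_on_frechet_derivative[OF f] X(2)])
  have 1: "((\<lambda>s. \<Sum>i\<in>Basis. (w s \<bullet> i) *\<^sub>R ?D (h s) i) has_derivative
     (\<lambda>v. \<Sum>i\<in>Basis. (w t \<bullet> i) *\<^sub>R ?DD i (h' v) + (w' v \<bullet> i) *\<^sub>R ?D (h t) i)) (at t)"
    by (intro has_derivative_sum has_derivative_scaleR has_derivative_inner_left w has_derivative_compose[OF h D])
  have "((\<lambda>z. \<Sum>i\<in>Basis. (w t \<bullet> i) *\<^sub>R ?D z i) has_derivative (\<lambda>v. \<Sum>i\<in>Basis. (w t \<bullet> i) *\<^sub>R ?DD i v)) (at (h t))"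
    by (intro has_derivative_sum has_derivative_scaleR_right D)
  then have "((\<lambda>z. ?D z (w t)) has_derivative (\<lambda>v. \<Sum>i\<in>Basis. (w t \<bullet> i) *\<^sub>R ?DD i v)) (at (h t))"
    by (rule has_derivative_transform_within_open[OF _ X]) (simp add: exp[symmetric])
  then have 2: "frechet_derivative (\<lambda>z. ?D z (w t)) (at (h t)) v = (\<Sum>i\<in>Basis. (w t \<bullet> i) *\<^sub>R ?DD i v)" for v
    by (rule frechet_derivative_at[THEN fun_cong, symmetric])
  have 3: "(\<lambda>v. \<Sum>i\<in>Basis. (w t \<bullet> i) *\<^sub>R ?DD i (h' v) + (w' v \<bullet> i) *\<^sub>R ?D (h t) i) =
    (\<lambda>v. frechet_derivative (\<lambda>z. ?D z (w t)) (at (h t)) (h' v) + ?D (h t) (w' v))"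
    by (simp only: 2 sum.distrib exp[OF X(2), symmetric])
  have "isCont h t" using h has_derivative_continuous by blast
  then have "\<forall>\<^sub>F s in at t. h s \<in> X"
    using X by (simp add: isCont_def topological_tendstoD)
  then have ev: "\<forall>\<^sub>F s in at t. (\<Sum>i\<in>Basis. (w s \<bullet> i) *\<^sub>R ?D (h s) i) = ?D (h s) (w s)"
    by eventually_elim (simp only: exp[symmetric])
  show ?thesis
    using has_derivative_transform_eventually[OF 1 ev] by (simp add: 3 exp[OF X(2), symmetric])
qed

text \<open>By Cauchy-Schwarz the nonnegative function \<open>?h\<close> has nonpositive derivative,
  and it starts at 0.\<close>

lemma gronwall_zero_right:
  fixes f :: "real \<Rightarrow> 'a::real_inner"
  assumes d: "\<And>t. a \<le> t \<Longrightarrow> t \<le> b \<Longrightarrow> (f has_vector_derivative f' t) (at t)"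
    and le: "\<And>t. a \<le> t \<Longrightarrow> t \<le> b \<Longrightarrow> norm (f' t) \<le> K * norm (f t)"
    and a: "f a = 0" and t: "a \<le> t" "t \<le> b"
  shows "f t = 0"
proof -
  let ?h = "\<lambda>t. (f t \<bullet> f t) * exp (- 2 * K * t)"
  have D: "(?h has_real_derivative (2 * (f s \<bullet> f' s) - 2 * K * (f s \<bullet> f s)) * exp (- 2 * K * s)) (at s)"
    if "a \<le> s" "s \<le> b" for s
  proof -
    have "((\<lambda>s. f s \<bullet> f s) has_real_derivative 2 * (f s \<bullet> f' s)) (at s)"
      using has_derivative_inner[OF d[OF that, unfolded has_vector_derivative_def] d[OF that, unfolded has_vector_derivative_def]]
      by (simp add: has_field_derivative_def inner_commute algebra_simps mult_commute_abs)
    then show ?thesis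
      by (auto intro!: derivative_eq_intros simp: algebra_simps)
  qed
  have "(2 * (f s \<bullet> f' s) - 2 * K * (f s \<bullet> f s)) * exp (- 2 * K * s) \<le> 0" if s: "a \<le> s" "s \<le> b" for s
  proof -
    have "f s \<bullet> f' s \<le> norm (f s) * norm (f' s)" by (rule norm_cauchy_schwarz)
    also have "\<dots> \<le> norm (f s) * (K * norm (f s))" using le[OF s] by (simp add: mult_left_mono)
    also have "\<dots> = K * (f s \<bullet> f s)" by (simp add: dot_square_norm power2_eq_square)
    finally show ?thesis by (simp add: mult_nonpos_nonneg)
  qed
  then have "?h t \<le> ?h a"
    using D t by (intro DERIV_nonpos_imp_nonincreasing[of a t ?h]) (meson order_trans)+
  then have "f t \<bullet> f t \<le> 0" using a by (simp add: mult_le_0_iff)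
  then show ?thesis by (metis inner_eq_zero_iff inner_ge_zero order_antisym)
qed

lemma gronwall_zero:
  fixes f :: "real \<Rightarrow> 'a::real_inner"
  assumes d: "\<And>t. \<bar>t - t0\<bar> < e \<Longrightarrow> (f has_vector_derivative f' t) (at t)"
    and le: "\<And>t. \<bar>t - t0\<bar> < e \<Longrightarrow> norm (f' t) \<le> K * norm (f t)"
    and 0: "f t0 = 0" and t: "\<bar>t - t0\<bar> < e"
  shows "f t = 0"
proof (cases "t0 \<le> t")
  case True
  then show ?thesis using t by (intro gronwall_zero_right[of t0 t f f' K t] d le 0) auto
next
  case False
  \<comment> \<open>Times before \<open>t0\<close> are reached by reversing time, which preserves
    the bound on the norm of the derivative.\<close>
  have "((\<lambda>s. f (- s)) has_vector_derivative - f' (- s)) (at s)" if "- t0 \<le> s" "s \<le> - t" for s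
  proof -
    have "(uminus has_real_derivative -1) (at s)" by (auto intro!: derivative_eq_intros)
    moreover have "(f has_vector_derivative f' (- s)) (at (- s))" using that t by (intro d) auto
    ultimately show ?thesis
      using vector_diff_chain_at[of uminus "-1" s f "f' (- s)"]
      by (simp add: has_real_derivative_iff_has_vector_derivative comp_def)
  qed
  then have "f (- (- t)) = 0"
    using False t 0 le by (intro gronwall_zero_right[of "- t0" "- t" "\<lambda>s. f (- s)" _ K "- t"]) auto
  then show ?thesis by simp
qed

text \<open>The operator norm of the derivative is at most the sum of its norms on the basis. That
  sum is continuous, hence at most 1 above its value at \<open>x\<close> on some ball, and balls are
  convex.\<close>

lemma smooth_on_locally_lipschitz:
  fixes f :: "'a::euclidean_space \<Rightarrow> 'b::real_normed_vector"
  assumes f: "smooth_on X f" and X: "open X" "x \<in> X"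
  obtains e K where "e > 0" "ball x e \<subseteq> X" 
    "\<And>y z. y \<in> ball x e \<Longrightarrow> z \<in> ball x e \<Longrightarrow> norm (f y - f z) \<le> K * norm (y - z)"
proof -
  let ?D = "\<lambda>y. frechet_derivative f (at y)"
  let ?N = "\<lambda>y. \<Sum>i\<in>Basis. norm (?D y i)"
  have "continuous_on X ?N"
    by (intro continuous_on_sum continuous_on_norm smooth_on_continuous[OF smooth_on_frechet_derivative[OF f]])
  then have "open (X \<inter> ?N -` {..< ?N x + 1})"
    using X continuous_open_preimage open_lessThan by blast
  moreover have "x \<in> X \<inter> ?N -` {..< ?N x + 1}" using X by simp
  ultimately obtain e where e: "e > 0" "ball x e \<subseteq> X \<inter> ?N -` {..< ?N x + 1}"
    using openE by blast
  have "norm (f y - f z) \<le> (?N x + 1) * norm (y - z)" if "y \<in> ball x e" "z \<in> ball x e" for y z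
  proof (rule differentiable_bound[of "ball x e" f ?D])
    show "convex (ball x e)" by simp
    fix w assume w: "w \<in> ball x e"
    then have "w \<in> X" using e by blast
    show "(f has_derivative ?D w) (at w within ball x e)"
      using smooth_on_has_derivative[OF f \<open>w \<in> X\<close>] has_derivative_at_withinI by blast
    show "onorm (?D w) \<le> ?N x + 1"
    proof (rule onorm_bound)
      show "0 \<le> ?N x + 1" by (simp add: sum_nonneg add_nonneg_nonneg)
      fix v
      have "norm (?D w v) = norm (\<Sum>i\<in>Basis. (v \<bullet> i) *\<^sub>R ?D w i)"
        using linear_frechet_expand[OF smooth_on_linear_derivative[OF f \<open>w \<in> X\<close>], of v] by simp
      also have "\<dots> \<le> (\<Sum>i\<in>Basis. \<bar>v \<bullet> i\<bar> * norm (?D w i))"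
        by (rule order_trans[OF norm_sum]) simp
      also have "\<dots> \<le> (\<Sum>i\<in>Basis. norm v * norm (?D w i))"
        by (intro sum_mono mult_right_mono Basis_le_norm) auto
      also have "\<dots> = ?N w * norm v" by (simp add: sum_distrib_left mult.commute)
      also have "\<dots> \<le> (?N x + 1) * norm v"
        using e w by (intro mult_right_mono) auto
      finally show "norm (?D w v) \<le> (?N x + 1) * norm v" .
    qed
  qed (use that in auto)
  then show thesis using e by (intro that[of e "?N x + 1"]) auto
qed

section \<open>Curves and the geodesic equation in charts\<close>

lemma chart_at_real_line: "chart_at real_line t = (UNIV, id)"
  using chart_at_in[of t real_line] by (auto simp: real_line_def carrier_def)

lemma chart_inv_ident: "t \<in> J \<Longrightarrow> chart_inv (J, id) t = t"
  using chart_inv_chart'[of "(J, id)" t] by simp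

lemma open_sub_real_line: "open_sub real_line J = {(J, id)}"
  by (simp add: open_sub_def real_line_def)

lemma atlas_open_sub_real_line: 
  assumes "open J" shows "atlas (open_sub real_line J)"
proof -
  have "smooth_on J (chart_inv (J, id))"
    by (rule smooth_on_cong[OF assms _ smooth_on_ident]) (simp add: chart_inv_ident)
  then show ?thesis using assms by (simp add: atlas_def open_sub_real_line)
qed

lemma carrier_open_sub_real_line: "carrier (open_sub real_line J) = J"
  by (simp add: carrier_def open_sub_real_line)

locale smooth_curve =
  fixes M :: "('m, 'e::euclidean_space) mfld" and J :: "real set" and \<gamma> :: "real \<Rightarrow> 'm"
  assumes atlas_M: "atlas M" and open_J: "open J" and smooth: "smooth_map (open_sub real_line J) M \<gamma>"
begin

lemma curve_in: "t \<in> J \<Longrightarrow> \<gamma> t \<in> carrier M"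
  using smooth_map_carrier[OF smooth] by (simp add: carrier_open_sub_real_line)

lemma open_preimage: "openin (mtop M) U \<Longrightarrow> open {t \<in> J. \<gamma> t \<in> U}"
  using smooth_map_open_rep[OF atlas_open_sub_real_line[OF open_J] smooth, of "(J, id)" U]
  by (simp add: open_sub_real_line)

lemma open_preimage_chart: "c \<in> M \<Longrightarrow> open {t \<in> J. \<gamma> t \<in> fst c}"
  by (rule open_preimage[OF openin_mtop_chart])

lemma smooth_on_chart: "c \<in> M \<Longrightarrow> smooth_on {t \<in> J. \<gamma> t \<in> fst c} (snd c \<circ> \<gamma>)"
  by (rule smooth_on_cong[OF open_preimage_chart])
     (use smooth_map_smooth_rep[OF smooth, of "(J, id)" c] in \<open>auto simp: open_sub_real_line chart_inv_ident\<close>)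

lemma velocity_chart_at: "velocity M \<gamma> t = frechet_derivative (snd (chart_at M (\<gamma> t)) \<circ> \<gamma>) (at t) 1"
proof -
  have "chart_inv (UNIV, id) = (id :: real \<Rightarrow> real)" by (auto simp: chart_inv_ident fun_eq_iff)
  then show ?thesis by (simp add: velocity_def mfderiv_def chart_at_real_line)
qed

lemma drep_curve:
  assumes "t \<in> J" shows "drep (J, id) c \<gamma> t = frechet_derivative (snd c \<circ> \<gamma>) (at t)"
proof -
  have "frechet_derivative (snd c \<circ> \<gamma> \<circ> chart_inv (J, id)) (at t) = frechet_derivative (snd c \<circ> \<gamma>) (at t)"
    by (rule frechet_derivative_cong_open[OF open_J assms]) (simp add: chart_inv_ident)
  then show ?thesis by (simp add: drep_def)
qed

lemma to_chart_velocity: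
  assumes t: "t \<in> J" and c: "c \<in> M" "\<gamma> t \<in> fst c"
  shows "to_chart M c (\<gamma> t) (velocity M \<gamma> t) = frechet_derivative (snd c \<circ> \<gamma>) (at t) 1"
  using drep_compose[OF atlas_open_sub_real_line[OF open_J] atlas_M smooth smooth_map_id[OF atlas_M] _ _
      chart_at_in[OF curve_in[OF t]] c, of "(J, id)"] t
  by (simp add: open_sub_real_line drep_curve velocity_chart_at to_chart_drep)

lemma cov_deriv_velocity:
  assumes t: "t \<in> J"
  defines "c \<equiv> chart_at M (\<gamma> t)"
  shows "cov_deriv real_line M \<Gamma> \<gamma> (velocity M \<gamma>) t 1 =
    frechet_derivative (\<lambda>s. frechet_derivative (snd c \<circ> \<gamma>) (at s) 1) (at t) 1 +
    \<Gamma> c (snd c (\<gamma> t)) (frechet_derivative (snd c \<circ> \<gamma>) (at t) 1) (frechet_derivative (snd c \<circ> \<gamma>) (at t) 1)"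
proof -
  have c: "c \<in> M" "\<gamma> t \<in> fst c" unfolding c_def by (rule chart_at_in[OF curve_in[OF t]])+
  \<comment> \<open>Near \<open>t\<close> the velocity, given in charts that vary with
    \<open>s\<close>, is converted to the single chart \<open>c\<close>, where it is an ordinary
    derivative.\<close>
  have "frechet_derivative (\<lambda>s. to_chart M c (\<gamma> s) (velocity M \<gamma> s)) (at t) =
    frechet_derivative (\<lambda>s. frechet_derivative (snd c \<circ> \<gamma>) (at s) 1) (at t)"
    by (rule frechet_derivative_cong_open[OF open_preimage_chart[OF c(1)]])
       (use t c to_chart_velocity in auto)
  moreover have "mfderiv real_line M \<gamma> t 1 = velocity M \<gamma> t" by (simp add: velocity_def)
  ultimately show ?thesis
    unfolding cov_deriv_def Let_def chart_at_real_line c_def[symmetric]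
    by (simp add: chart_inv_ident velocity_chart_at c_def[symmetric])
qed

text \<open>\<open>cov_deriv\<close> uses the chart chosen at the current point, which may change
  along the curve, while uniqueness needs one differential equation in one chart. The transformation
  law of the Christoffel symbols provides it.\<close>

lemma geodesic_in_chart:
  assumes \<Gamma>: "affine_connection M \<Gamma>" and t: "t \<in> J" and c: "c \<in> M" "\<gamma> t \<in> fst c"
    and geo: "cov_deriv real_line M \<Gamma> \<gamma> (velocity M \<gamma>) t 1 = 0"
  shows "frechet_derivative (\<lambda>s. frechet_derivative (snd c \<circ> \<gamma>) (at s) 1) (at t) 1 =
    - \<Gamma> c (snd c (\<gamma> t)) (frechet_derivative (snd c \<circ> \<gamma>) (at t) 1) (frechet_derivative (snd c \<circ> \<gamma>) (at t) 1)"
proof -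
  let ?d = "chart_at M (\<gamma> t)"
  have d: "?d \<in> M" "\<gamma> t \<in> fst ?d" by (rule chart_at_in[OF curve_in[OF t]])+
  let ?\<tau> = "snd c \<circ> chart_inv ?d" and ?X = "snd ?d ` (fst ?d \<inter> fst c)"
  let ?y = "snd ?d \<circ> \<gamma>" and ?x = "snd c \<circ> \<gamma>"
  let ?y' = "frechet_derivative ?y (at t) 1"
  let ?Y = "{s \<in> J. \<gamma> s \<in> fst ?d} \<inter> {s \<in> J. \<gamma> s \<in> fst c}"
  have X: "open ?X" "smooth_on ?X ?\<tau>" using atlas_M c d by (auto simp: atlas_def)
  have Y: "open ?Y" "t \<in> ?Y" using open_preimage_chart[OF c(1)] open_preimage_chart[OF d(1)] t c d by auto
  have y: "smooth_on ?Y ?y" by (rule smooth_on_subset[OF smooth_on_chart[OF d(1)]]) auto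
  have tx: "?y t \<in> ?X" using c d by simp
  have x': "frechet_derivative ?x (at s) = (\<lambda>v. frechet_derivative ?\<tau> (at (?y s)) (frechet_derivative ?y (at s) v))"
    if s: "s \<in> ?Y" for s
  proof -
    have "((\<lambda>s. ?\<tau> (?y s)) has_derivative (\<lambda>v. frechet_derivative ?\<tau> (at (?y s)) (frechet_derivative ?y (at s) v))) (at s)"
      by (rule has_derivative_compose[OF smooth_on_has_derivative[OF y s] smooth_on_has_derivative[OF X(2)]])
         (use s in auto)
    then have "(?x has_derivative (\<lambda>v. frechet_derivative ?\<tau> (at (?y s)) (frechet_derivative ?y (at s) v))) (at s)"
      by (rule has_derivative_transform_within_open[OF _ Y(1) s]) (auto simp: chart_inv_chart[OF atlas_M d(1)])
    then show ?thesis by (rule frechet_derivative_at[symmetric])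
  qed
  have y1: "(?y has_derivative frechet_derivative ?y (at t)) (at t)"
    by (rule smooth_on_has_derivative[OF y Y(2)])
  have y2: "((\<lambda>s. frechet_derivative ?y (at s) 1) has_derivative
      frechet_derivative (\<lambda>s. frechet_derivative ?y (at s) 1) (at t)) (at t)"
    by (rule smooth_on_has_derivative[OF smooth_on_frechet_derivative[OF y] Y(2)])
  \<comment> \<open>The second derivative of the coordinate change, by which accelerations fail to
    transform as vectors. The law for \<open>\<Gamma>\<close> contains the same term with the
    opposite sign.\<close>
  let ?P = "frechet_derivative (\<lambda>z. frechet_derivative ?\<tau> (at z) ?y') (at (?y t)) ?y'"
  let ?y'' = "frechet_derivative (\<lambda>s. frechet_derivative ?y (at s) 1) (at t) 1"
  have "frechet_derivative (\<lambda>s. frechet_derivative ?x (at s) 1) (at t) =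
    frechet_derivative (\<lambda>s. frechet_derivative ?\<tau> (at (?y s)) (frechet_derivative ?y (at s) 1)) (at t)"
    by (rule frechet_derivative_cong_open[OF Y]) (simp only: x')
  then have x'': "frechet_derivative (\<lambda>s. frechet_derivative ?x (at s) 1) (at t) 1 =
    ?P + frechet_derivative ?\<tau> (at (?y t)) ?y''"
    using fun_cong[OF frechet_derivative_at[OF frechet_apply_has_derivative[OF X(2,1) tx y1 y2]], of 1] by simp
  have "?y'' = - \<Gamma> ?d (?y t) ?y' ?y'"
    using geo cov_deriv_velocity[OF t, of \<Gamma>] by (simp add: eq_neg_iff_add_eq_0)
  then have y'': "frechet_derivative ?\<tau> (at (?y t)) ?y'' = - frechet_derivative ?\<tau> (at (?y t)) (\<Gamma> ?d (?y t) ?y' ?y')"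
    by (simp only: linear_neg[OF smooth_on_linear_derivative[OF X(2) tx]])
  have "\<Gamma> c (?\<tau> (?y t)) (frechet_derivative ?\<tau> (at (?y t)) ?y') (frechet_derivative ?\<tau> (at (?y t)) ?y') =
     frechet_derivative ?\<tau> (at (?y t)) (\<Gamma> ?d (?y t) ?y' ?y') - ?P"
    using \<Gamma> d(1) c(1) tx unfolding affine_connection_def Let_def by blast
  moreover have "?\<tau> (?y t) = ?x t" using chart_inv_chart[OF atlas_M d] by simp
  ultimately show ?thesis
    using x'' y'' x'[OF Y(2)] by simp
qed

end

section \<open>Uniqueness and scaling of geodesics, and the exponential map\<close>

lemma smooth_on_has_vector_derivative:
  fixes f :: "real \<Rightarrow> 'a::real_normed_vector"
  assumes "smooth_on X f" "t \<in> X"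
  shows "(f has_vector_derivative frechet_derivative f (at t) 1) (at t)"
proof -
  have "frechet_derivative f (at t) v = v *\<^sub>R frechet_derivative f (at t) 1" for v
    using linear_scale[OF smooth_on_linear_derivative[OF assms], of v 1] by (simp only: real_scaleR_def mult_1_right)
  then have "frechet_derivative f (at t) = (\<lambda>v. v *\<^sub>R frechet_derivative f (at t) 1)" by (rule ext)
  then show ?thesis
    unfolding has_vector_derivative_def using smooth_on_has_derivative[OF assms] by metis
qed

text \<open>Position and velocity together solve a first-order system with locally Lipschitz
  right-hand side, so their difference vanishes by the Gronwall estimate. Equality of the velocities
  is carried in the conclusion to allow continuation.\<close>

lemma geodesic_unique_chart:
  fixes M :: "('m, 'e::euclidean_space) mfld"
  assumes c1: "smooth_curve M J1 \<gamma>1" and c2: "smooth_curve M J2 \<gamma>2"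
    and \<Gamma>: "affine_connection M \<Gamma>" and c: "c \<in> M"
    and ode1: "\<And>t. t \<in> J1 \<Longrightarrow> \<gamma>1 t \<in> fst c \<Longrightarrow>
      frechet_derivative (\<lambda>s. frechet_derivative (snd c \<circ> \<gamma>1) (at s) 1) (at t) 1 =
      - \<Gamma> c (snd c (\<gamma>1 t)) (frechet_derivative (snd c \<circ> \<gamma>1) (at t) 1) (frechet_derivative (snd c \<circ> \<gamma>1) (at t) 1)"
    and ode2: "\<And>t. t \<in> J2 \<Longrightarrow> \<gamma>2 t \<in> fst c \<Longrightarrow>
      frechet_derivative (\<lambda>s. frechet_derivative (snd c \<circ> \<gamma>2) (at s) 1) (at t) 1 =
      - \<Gamma> c (snd c (\<gamma>2 t)) (frechet_derivative (snd c \<circ> \<gamma>2) (at t) 1) (frechet_derivative (snd c \<circ> \<gamma>2) (at t) 1)"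
    and t0: "t0 \<in> J1" "t0 \<in> J2" "\<gamma>1 t0 \<in> fst c" "\<gamma>2 t0 = \<gamma>1 t0"
    and v0: "frechet_derivative (snd c \<circ> \<gamma>1) (at t0) 1 = frechet_derivative (snd c \<circ> \<gamma>2) (at t0) 1"
  shows "\<exists>e>0. \<forall>t. \<bar>t - t0\<bar> < e \<longrightarrow> t \<in> J1 \<and> t \<in> J2 \<and> \<gamma>1 t \<in> fst c \<and> \<gamma>1 t = \<gamma>2 t \<and>
    frechet_derivative (snd c \<circ> \<gamma>1) (at t) 1 = frechet_derivative (snd c \<circ> \<gamma>2) (at t) 1"
proof -
  interpret a: smooth_curve M J1 \<gamma>1 by (rule c1)
  interpret b: smooth_curve M J2 \<gamma>2 by (rule c2)
  let ?X = "snd c ` fst c"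
  \<comment> \<open>The geodesic spray in coordinates.\<close>
  define G where "G z = (snd z, - \<Gamma> c (fst z) (snd z) (snd z))" for z
  let ?x1 = "snd c \<circ> \<gamma>1" and ?x2 = "snd c \<circ> \<gamma>2"
  let ?v1 = "\<lambda>t. frechet_derivative ?x1 (at t) 1" and ?v2 = "\<lambda>t. frechet_derivative ?x2 (at t) 1"
  let ?Y1 = "{t \<in> J1. \<gamma>1 t \<in> fst c}" and ?Y2 = "{t \<in> J2. \<gamma>2 t \<in> fst c}"
  have Z: "open (?X \<times> (UNIV :: 'e set))" using a.atlas_M c by (auto simp: atlas_def intro: open_Times)
  have bil: "bilinear (\<Gamma> c x)" if "x \<in> ?X" for x using \<Gamma> c that by (auto simp: affine_connection_def)
  have sm: "smooth_on (?X \<times> (UNIV :: 'e set)) (\<lambda>z. \<Gamma> c (fst z) i j)" for i j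
  proof -
    have "smooth_on ?X (\<lambda>x. \<Gamma> c x i j)" using \<Gamma> c by (auto simp: affine_connection_def)
    then show ?thesis
      using smooth_on_compose[where h="\<lambda>x. \<Gamma> c x i j" and f=fst and X="?X", OF _ smooth_on_fst[OF Z smooth_on_ident] Z] by simp
  qed
  have "smooth_on (?X \<times> UNIV) (\<lambda>z. (snd z, (-1) *\<^sub>R (\<Sum>i\<in>Basis. \<Sum>j\<in>Basis. (snd z \<bullet> i) *\<^sub>R ((snd z \<bullet> j) *\<^sub>R \<Gamma> c (fst z) i j))))"
    by (intro smooth_on_Pair[OF Z] smooth_on_snd[OF Z] smooth_on_scaleR[OF Z] smooth_on_sum[OF Z] smooth_on_inner[OF Z]
          smooth_on_ident smooth_on_const sm)
  then have G: "smooth_on (?X \<times> UNIV) G"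
  proof (rule smooth_on_cong[OF Z, rotated])
    fix z assume "z \<in> ?X \<times> (UNIV :: 'e set)"
    then have "fst z \<in> ?X" by auto
    from bilinear_euclidean_expand[OF bil[OF this], of "snd z" "snd z"]
    show "G z = (snd z, (-1) *\<^sub>R (\<Sum>i\<in>Basis. \<Sum>j\<in>Basis. (snd z \<bullet> i) *\<^sub>R ((snd z \<bullet> j) *\<^sub>R \<Gamma> c (fst z) i j)))"
      by (simp add: G_def)
  qed
  have z0: "(?x1 t0, ?v1 t0) \<in> ?X \<times> UNIV" using t0 by simp
  obtain d K where d: "d > 0" and
    K: "\<And>y z. y \<in> ball (?x1 t0, ?v1 t0) d \<Longrightarrow> z \<in> ball (?x1 t0, ?v1 t0) d \<Longrightarrow> norm (G y - G z) \<le> K * norm (y - z)"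
    using smooth_on_locally_lipschitz[OF G Z z0] by metis
  have Y: "open ?Y1" "open ?Y2" "t0 \<in> ?Y1" "t0 \<in> ?Y2"
    using a.open_preimage_chart[OF c] b.open_preimage_chart[OF c] t0 by auto
  note s1 = a.smooth_on_chart[OF c] and s2 = b.smooth_on_chart[OF c]
  let ?z1 = "\<lambda>t. (?x1 t, ?v1 t)" and ?z2 = "\<lambda>t. (?x2 t, ?v2 t)"
  let ?B = "ball (?x1 t0, ?v1 t0) d"
  have "open (?Y1 \<inter> ?z1 -` ?B)" "open (?Y2 \<inter> ?z2 -` ?B)"
    by (intro continuous_open_preimage continuous_on_Pair smooth_on_continuous[OF s1] smooth_on_continuous[OF s2]
        smooth_on_continuous[OF smooth_on_frechet_derivative[OF s1]] open_ball
        smooth_on_continuous[OF smooth_on_frechet_derivative[OF s2]] Y)+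
  then have "open ((?Y1 \<inter> ?z1 -` ?B) \<inter> (?Y2 \<inter> ?z2 -` ?B))" by (rule open_Int)
  moreover have "t0 \<in> (?Y1 \<inter> ?z1 -` ?B) \<inter> (?Y2 \<inter> ?z2 -` ?B)"
    using Y d t0(4) v0 by simp
  ultimately obtain e where e: "e > 0" "ball t0 e \<subseteq> (?Y1 \<inter> ?z1 -` ?B) \<inter> (?Y2 \<inter> ?z2 -` ?B)"
    using openE by blast
  have sub: "t \<in> ?Y1 \<and> t \<in> ?Y2 \<and> ?z1 t \<in> ?B \<and> ?z2 t \<in> ?B" if "\<bar>t - t0\<bar> < e" for t
  proof -
    have "t \<in> ball t0 e" using that by (simp add: dist_real_def abs_minus_commute)
    then show ?thesis using e(2) by blast
  qed
  have D: "((\<lambda>t. ?z1 t - ?z2 t) has_vector_derivative G (?z1 t) - G (?z2 t)) (at t)" if "\<bar>t - t0\<bar> < e" for t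
  proof -
    have t: "t \<in> ?Y1" "t \<in> ?Y2" using sub[OF that] by auto
    have "(?v1 has_vector_derivative - \<Gamma> c (?x1 t) (?v1 t) (?v1 t)) (at t)"
      using smooth_on_has_vector_derivative[OF smooth_on_frechet_derivative[OF s1] t(1), of 1] ode1[of t] t(1) by simp
    moreover have "(?v2 has_vector_derivative - \<Gamma> c (?x2 t) (?v2 t) (?v2 t)) (at t)"
      using smooth_on_has_vector_derivative[OF smooth_on_frechet_derivative[OF s2] t(2), of 1] ode2[of t] t(2) by simp
    ultimately show ?thesis
      unfolding G_def fst_conv snd_conv
      by (intro has_vector_derivative_diff has_vector_derivative_Pair
          smooth_on_has_vector_derivative[OF s1 t(1)] smooth_on_has_vector_derivative[OF s2 t(2)])
  qed
  have eq: "?z1 t - ?z2 t = 0" if t: "\<bar>t - t0\<bar> < e" for t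
  proof (rule gronwall_zero[OF D _ _ t])
    show "norm (G (?z1 t) - G (?z2 t)) \<le> K * norm (?z1 t - ?z2 t)" if "\<bar>t - t0\<bar> < e" for t
      using K sub[OF that] by blast
    show "?z1 t0 - ?z2 t0 = 0" using t0(4) v0 by simp
  qed
  show ?thesis
  proof (intro exI[of _ e] conjI[OF e(1)] allI impI)
    fix t assume t: "\<bar>t - t0\<bar> < e"
    have "snd c (\<gamma>1 t) = snd c (\<gamma>2 t)" "?v1 t = ?v2 t" using eq[OF t] by (simp_all add: zero_prod_def)
    moreover have "\<gamma>1 t \<in> fst c" "\<gamma>2 t \<in> fst c" "t \<in> J1" "t \<in> J2" using sub[OF t] by auto
    moreover have "\<gamma>1 t = \<gamma>2 t" using calculation(1,3,4) chart_inv_chart[OF a.atlas_M c] by metis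
    ultimately show "t \<in> J1 \<and> t \<in> J2 \<and> \<gamma>1 t \<in> fst c \<and> \<gamma>1 t = \<gamma>2 t \<and> ?v1 t = ?v2 t" by blast
  qed
qed

lemma geodesic_on_curve: "atlas M \<Longrightarrow> open J \<Longrightarrow> geodesic_on M \<Gamma> J \<gamma> \<Longrightarrow> smooth_curve M J \<gamma>"
  by (simp add: smooth_curve_def geodesic_on_def)

text \<open>The common domain is an intersection of intervals, hence connected. The set where both
  position and velocity agree is open by local uniqueness, and so is its complement.\<close>

lemma geodesic_unique:
  assumes M: "atlas M" "Hausdorff_space (mtop M)" and \<Gamma>: "affine_connection M \<Gamma>"
    and J: "open J1" "open J2" "is_interval J1" "is_interval J2" "t0 \<in> J1" "t0 \<in> J2"
    and g1: "geodesic_on M \<Gamma> J1 \<gamma>1" and g2: "geodesic_on M \<Gamma> J2 \<gamma>2"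
    and init: "\<gamma>1 t0 = \<gamma>2 t0" "velocity M \<gamma>1 t0 = velocity M \<gamma>2 t0"
    and t: "t \<in> J1" "t \<in> J2"
  shows "\<gamma>1 t = \<gamma>2 t"
proof -
  note c1 = geodesic_on_curve[OF M(1) J(1) g1] and c2 = geodesic_on_curve[OF M(1) J(2) g2]
  interpret a: smooth_curve M J1 \<gamma>1 by (rule c1)
  interpret b: smooth_curve M J2 \<gamma>2 by (rule c2)
  let ?J = "J1 \<inter> J2"
  let ?A = "{t \<in> ?J. \<gamma>1 t = \<gamma>2 t \<and> velocity M \<gamma>1 t = velocity M \<gamma>2 t}"
  have veq: "frechet_derivative (snd c \<circ> \<gamma>1) (at t) 1 = frechet_derivative (snd c \<circ> \<gamma>2) (at t) 1 \<longleftrightarrow>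
     velocity M \<gamma>1 t = velocity M \<gamma>2 t" 
    if "t \<in> ?J" "c \<in> M" "\<gamma>1 t \<in> fst c" "\<gamma>1 t = \<gamma>2 t" for t c
  proof -
    have "to_chart M c (\<gamma>1 t) (velocity M \<gamma>1 t) = frechet_derivative (snd c \<circ> \<gamma>1) (at t) 1"
      using that by (intro a.to_chart_velocity) auto
    moreover have "to_chart M c (\<gamma>2 t) (velocity M \<gamma>2 t) = frechet_derivative (snd c \<circ> \<gamma>2) (at t) 1"
      using that by (intro b.to_chart_velocity) auto
    ultimately show ?thesis
      unfolding that(4)[symmetric] using from_to_chart(1)[OF M(1) that(2,3)] by metis
  qed
  have oA: "open ?A"
  proof (rule openI)
    fix s assume s: "s \<in> ?A"
    let ?c = "chart_at M (\<gamma>1 s)"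
    have "s \<in> J1" using s by simp
    note c = chart_at_in[OF a.curve_in[OF this]]
    have ode1: "frechet_derivative (\<lambda>s. frechet_derivative (snd ?c \<circ> \<gamma>1) (at s) 1) (at t) 1 =
      - \<Gamma> ?c (snd ?c (\<gamma>1 t)) (frechet_derivative (snd ?c \<circ> \<gamma>1) (at t) 1) (frechet_derivative (snd ?c \<circ> \<gamma>1) (at t) 1)"
      if "t \<in> J1" "\<gamma>1 t \<in> fst ?c" for t
      using a.geodesic_in_chart[OF \<Gamma> that(1) c(1) that(2)] g1 that(1) by (simp add: geodesic_on_def)
    have ode2: "frechet_derivative (\<lambda>s. frechet_derivative (snd ?c \<circ> \<gamma>2) (at s) 1) (at t) 1 =
      - \<Gamma> ?c (snd ?c (\<gamma>2 t)) (frechet_derivative (snd ?c \<circ> \<gamma>2) (at t) 1) (frechet_derivative (snd ?c \<circ> \<gamma>2) (at t) 1)"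
      if "t \<in> J2" "\<gamma>2 t \<in> fst ?c" for t
      using b.geodesic_in_chart[OF \<Gamma> that(1) c(1) that(2)] g2 that(1) by (simp add: geodesic_on_def)
    have s': "s \<in> J1" "s \<in> J2" "\<gamma>2 s = \<gamma>1 s" using s by auto
    have v: "frechet_derivative (snd ?c \<circ> \<gamma>1) (at s) 1 = frechet_derivative (snd ?c \<circ> \<gamma>2) (at s) 1"
      using veq[of s ?c] s c by simp
    have "\<exists>e>0. \<forall>t. \<bar>t - s\<bar> < e \<longrightarrow> t \<in> J1 \<and> t \<in> J2 \<and> \<gamma>1 t \<in> fst ?c \<and> \<gamma>1 t = \<gamma>2 t \<and>
      frechet_derivative (snd ?c \<circ> \<gamma>1) (at t) 1 = frechet_derivative (snd ?c \<circ> \<gamma>2) (at t) 1"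
      by (rule geodesic_unique_chart[OF c1 c2 \<Gamma> c(1) _ _ s'(1,2) c(2) s'(3) v]; (erule (1) ode1 | erule (1) ode2))
    then obtain e where e: "e > 0" "\<And>t. \<bar>t - s\<bar> < e \<Longrightarrow> t \<in> J1 \<and> t \<in> J2 \<and> \<gamma>1 t \<in> fst ?c \<and> \<gamma>1 t = \<gamma>2 t \<and>
      frechet_derivative (snd ?c \<circ> \<gamma>1) (at t) 1 = frechet_derivative (snd ?c \<circ> \<gamma>2) (at t) 1"
      by metis
    have "ball s e \<subseteq> ?A"
    proof
      fix t assume "t \<in> ball s e"
      then have "\<bar>t - s\<bar> < e" by (simp add: dist_real_def abs_minus_commute)
      note e' = e(2)[OF this]
      then have "velocity M \<gamma>1 t = velocity M \<gamma>2 t" using veq[of t ?c] c(1) by blast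
      then show "t \<in> ?A" using e' by simp
    qed
    then show "\<exists>e>0. ball s e \<subseteq> ?A" using e(1) by blast
  qed
  \<comment> \<open>Where the positions differ, Hausdorff separation keeps them apart nearby. Where
    only the velocities differ, both curves lie in a common chart and the difference of the
    coordinate velocities stays nonzero.\<close>
  have oB: "open (?J - ?A)"
  proof (subst open_subopen, intro ballI)
    fix s assume s: "s \<in> ?J - ?A"
    show "\<exists>T. open T \<and> s \<in> T \<and> T \<subseteq> ?J - ?A"
    proof (cases "\<gamma>1 s = \<gamma>2 s")
      case False
      obtain U V where U: "openin (mtop M) U" "openin (mtop M) V" "\<gamma>1 s \<in> U" "\<gamma>2 s \<in> V" "disjnt U V"
      proof -
        have "\<gamma>1 s \<in> topspace (mtop M)" "\<gamma>2 s \<in> topspace (mtop M)"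
          using a.curve_in b.curve_in s by auto
        then show thesis using M(2) False that unfolding Hausdorff_space_def by meson
      qed
      let ?T = "{t \<in> J1. \<gamma>1 t \<in> U} \<inter> {t \<in> J2. \<gamma>2 t \<in> V}"
      have "open ?T" using a.open_preimage[OF U(1)] b.open_preimage[OF U(2)] by blast
      moreover have "s \<in> ?T" "?T \<subseteq> ?J - ?A" using U s by (auto simp: disjnt_iff)
      ultimately show ?thesis by blast
    next
      case True
      let ?c = "chart_at M (\<gamma>1 s)"
      have sJ: "s \<in> J1" "s \<in> J2" using s by auto
      note c = chart_at_in[OF a.curve_in[OF sJ(1)]]
      let ?Y = "{t \<in> J1. \<gamma>1 t \<in> fst ?c} \<inter> {t \<in> J2. \<gamma>2 t \<in> fst ?c}"
      let ?w = "\<lambda>t. frechet_derivative (snd ?c \<circ> \<gamma>1) (at t) 1 - frechet_derivative (snd ?c \<circ> \<gamma>2) (at t) 1"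
      have Y: "open ?Y" using a.open_preimage_chart[OF c(1)] b.open_preimage_chart[OF c(1)] by blast
      have "continuous_on ?Y ?w"
        by (intro continuous_on_diff smooth_on_continuous[OF smooth_on_frechet_derivative[OF smooth_on_subset[OF a.smooth_on_chart[OF c(1)]]]]
          smooth_on_continuous[OF smooth_on_frechet_derivative[OF smooth_on_subset[OF b.smooth_on_chart[OF c(1)]]]]) auto
      then have o: "open (?Y \<inter> ?w -` (- {0}))" by (intro continuous_open_preimage Y) auto
      have "s \<in> ?Y \<inter> ?w -` (- {0})"
        using veq[of s ?c] s sJ c True by simp
      moreover have "?Y \<inter> ?w -` (- {0}) \<subseteq> ?J - ?A"
        using veq[of _ ?c] c(1) by auto
      ultimately show ?thesis using o by blast
    qed
  qed
  have conn: "connected ?J"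
    by (intro is_interval_connected is_interval_Int J)
  have "t0 \<in> ?A \<inter> ?J" using J(5,6) init by simp
  moreover have "?A \<inter> ?J = {} \<or> (?J - ?A) \<inter> ?J = {}"
    by (rule connectedD[OF conn oA oB]) auto
  ultimately have "(?J - ?A) \<inter> ?J = {}" by auto
  then show ?thesis using t by auto
qed

lemma smooth_map_real_scale:
  assumes "open J" shows "smooth_map (open_sub real_line {r. r * s \<in> J}) (open_sub real_line J) (\<lambda>r. r * s)"
proof -
  have J': "open {r. r * s \<in> J}"
    using open_vimage[OF assms, of "\<lambda>r. r * s"] by (simp add: vimage_def continuous_on_mult_right)
  show ?thesis
  proof (rule smooth_mapI[OF atlas_open_sub_real_line[OF J'] atlas_open_sub_real_line[OF assms]])
    fix r assume r: "r \<in> carrier (open_sub real_line {r. r * s \<in> J})"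
    let ?J' = "{r. r * s \<in> J}"
    have r': "r * s \<in> J" using r by (simp add: carrier_open_sub_real_line)
    have "smooth_on ?J' (\<lambda>r. r * s)" by (intro smooth_on_mult J' smooth_on_ident smooth_on_const)
    then have "smooth_on ?J' (snd (J, id) \<circ> (\<lambda>r. r * s) \<circ> chart_inv (?J', id))"
      by (rule smooth_on_cong[OF J', rotated]) (simp add: chart_inv_ident)
    then show "\<exists>a\<in>open_sub real_line ?J'. \<exists>c\<in>open_sub real_line J. \<exists>X. r \<in> fst a \<and> open X \<and> snd a r \<in> X \<and>
        X \<subseteq> snd a ` fst a \<and> (\<lambda>r. r * s) ` chart_inv a ` X \<subseteq> fst c \<and>
        smooth_on X (snd c \<circ> (\<lambda>r. r * s) \<circ> chart_inv a)"
      using r' J' by (auto simp: open_sub_real_line carrier_open_sub_real_line chart_inv_ident intro!: exI[of _ ?J'])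
  qed
qed

lemma frechet_derivative_scale_arg:
  fixes f :: "real \<Rightarrow> 'a::real_normed_vector"
  assumes "f differentiable at (r * s)"
  shows "frechet_derivative (\<lambda>r. f (r * s)) (at r) 1 = s *\<^sub>R frechet_derivative f (at (r * s)) 1"
proof -
  have "((\<lambda>r. f (r * s)) has_derivative (\<lambda>v. frechet_derivative f (at (r * s)) (v * s))) (at r)"
    by (rule has_derivative_compose[where f="\<lambda>r. r * s" and g=f])
       (use assms in \<open>auto simp: frechet_derivative_works[symmetric] intro!: derivative_eq_intros\<close>)
  from fun_cong[OF frechet_derivative_at[OF this], of 1] show ?thesis
    using linear_scale[OF linear_frechet_derivative[OF assms], of s 1] by simp
qed

text \<open>The acceleration and the quadratic Christoffel term both scale by the square of
  \<open>s\<close>. The factor may be negative or 0; the value 0 is what gives the exponential of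
  the zero vector.\<close>

lemma geodesic_rescale:
  fixes s :: real
  assumes M: "atlas M" and \<Gamma>: "affine_connection M \<Gamma>" and J: "open J" and g: "geodesic_on M \<Gamma> J \<gamma>"
  defines "J' \<equiv> {r. r * s \<in> J}"
  shows "geodesic_on M \<Gamma> J' (\<lambda>r. \<gamma> (r * s))" "r \<in> J' \<Longrightarrow> velocity M (\<lambda>r. \<gamma> (r * s)) r = s *\<^sub>R velocity M \<gamma> (r * s)"
proof -
  interpret a: smooth_curve M J \<gamma> by (rule geodesic_on_curve[OF M J g])
  have J': "open J'"
    unfolding J'_def using open_vimage[OF J, of "\<lambda>r. r * s"] by (simp add: vimage_def continuous_on_mult_right)
  have sm: "smooth_map (open_sub real_line J') M (\<lambda>r. \<gamma> (r * s))"
    unfolding J'_def using J' J'_def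
    by (intro smooth_map_compose[OF _ _ M smooth_map_real_scale[OF J] a.smooth] atlas_open_sub_real_line J) auto
  interpret b: smooth_curve M J' "\<lambda>r. \<gamma> (r * s)"
    by (simp add: smooth_curve_def M J' sm)
  have v: "frechet_derivative (snd c \<circ> (\<lambda>r. \<gamma> (r * s))) (at r) 1 = s *\<^sub>R frechet_derivative (snd c \<circ> \<gamma>) (at (r * s)) 1"
    if "r \<in> J'" "c \<in> M" "\<gamma> (r * s) \<in> fst c" for r c
    using frechet_derivative_scale_arg[of "snd c \<circ> \<gamma>" r s] smooth_on_differentiable[OF a.smooth_on_chart[OF that(2)]] that
    by (simp add: comp_def J'_def)
  show "velocity M (\<lambda>r. \<gamma> (r * s)) r = s *\<^sub>R velocity M \<gamma> (r * s)" if "r \<in> J'" for r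
    unfolding b.velocity_chart_at a.velocity_chart_at
    using that by (intro v chart_at_in a.curve_in) (auto simp: J'_def)
  have "cov_deriv real_line M \<Gamma> (\<lambda>r. \<gamma> (r * s)) (velocity M (\<lambda>r. \<gamma> (r * s))) r 1 = 0" if r: "r \<in> J'" for r
  proof -
    let ?c = "chart_at M (\<gamma> (r * s))"
    have rs: "r * s \<in> J" using r by (simp add: J'_def)
    have c: "?c \<in> M" "\<gamma> (r * s) \<in> fst ?c" by (rule chart_at_in[OF a.curve_in[OF rs]])+
    let ?Y = "{t \<in> J'. \<gamma> (t * s) \<in> fst ?c}"
    let ?f = "\<lambda>t. frechet_derivative (snd ?c \<circ> \<gamma>) (at t) 1"
    have f: "?f differentiable at (r * s)"
      using smooth_on_differentiable[OF smooth_on_frechet_derivative[OF a.smooth_on_chart[OF c(1)]]] rs c by simp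
    have "((\<lambda>t. ?f (t * s)) has_derivative frechet_derivative (\<lambda>t. ?f (t * s)) (at r)) (at r)"
      unfolding frechet_derivative_works[symmetric]
      by (rule differentiable_compose[where g="\<lambda>t. t * s" and f="?f"]) (auto intro: f)
    then have "((\<lambda>t. s *\<^sub>R ?f (t * s)) has_derivative (\<lambda>v. s *\<^sub>R frechet_derivative (\<lambda>t. ?f (t * s)) (at r) v)) (at r)"
      by (rule has_derivative_scaleR_right)
    from fun_cong[OF frechet_derivative_at[OF this], of 1]
    have 1: "frechet_derivative (\<lambda>t. s *\<^sub>R ?f (t * s)) (at r) 1 = s *\<^sub>R (s *\<^sub>R frechet_derivative ?f (at (r * s)) 1)"
      by (simp add: frechet_derivative_scale_arg[OF f])
    have "frechet_derivative (\<lambda>t. frechet_derivative (snd ?c \<circ> (\<lambda>r. \<gamma> (r * s))) (at t) 1) (at r) =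
       frechet_derivative (\<lambda>t. s *\<^sub>R ?f (t * s)) (at r)"
      by (rule frechet_derivative_cong_open[OF b.open_preimage_chart[OF c(1)]]) (use r c v in auto)
    moreover have "frechet_derivative ?f (at (r * s)) 1 = - \<Gamma> ?c (snd ?c (\<gamma> (r * s))) (?f (r * s)) (?f (r * s))"
      by (rule a.geodesic_in_chart[OF \<Gamma> rs c]) (use g rs in \<open>simp add: geodesic_on_def\<close>)
    moreover have "bilinear (\<Gamma> ?c (snd ?c (\<gamma> (r * s))))" using \<Gamma> c by (auto simp: affine_connection_def)
    ultimately show ?thesis
      by (simp add: b.cov_deriv_velocity[OF r] v[OF r c] 1 bilinear_lmul bilinear_rmul)
  qed
  then show "geodesic_on M \<Gamma> J' (\<lambda>r. \<gamma> (r * s))"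
    using sm by (simp add: geodesic_on_def)
qed

lemma exp_map_eqI:
  assumes M: "atlas M" "Hausdorff_space (mtop M)" and \<Gamma>: "affine_connection M \<Gamma>" and q: "exp_rel M \<Gamma> z q"
  shows "exp_map M \<Gamma> z = q"
  unfolding exp_map_def
proof (rule the_equality[of "exp_rel M \<Gamma> z", OF q])
  fix q' assume "exp_rel M \<Gamma> z q'"
  then obtain J' \<gamma>' where 1: "open J'" "is_interval J'" "{0..1} \<subseteq> J'" "geodesic_on M \<Gamma> J' \<gamma>'"
     "\<gamma>' 0 = fst z" "velocity M \<gamma>' 0 = snd z" "\<gamma>' 1 = q'" by (auto simp: exp_rel_def)
  obtain J \<gamma> where 2: "open J" "is_interval J" "{0..1} \<subseteq> J" "geodesic_on M \<Gamma> J \<gamma>"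
     "\<gamma> 0 = fst z" "velocity M \<gamma> 0 = snd z" "\<gamma> 1 = q" using q by (auto simp: exp_rel_def)
  have "(0::real) \<in> {0..1}" "(1::real) \<in> {0..1}" by auto
  then have "0 \<in> J" "0 \<in> J'" "1 \<in> J" "1 \<in> J'" using 1(3) 2(3) by blast+
  then have "\<gamma> 1 = \<gamma>' 1"
    by (intro geodesic_unique[OF M \<Gamma> 2(1) 1(1) 2(2) 1(2) _ _ 2(4) 1(4), of 0 1])
       (simp_all add: 1 2)
  then show "q' = q" using 1 2 by simp
qed

text \<open>The rescaled curve through \<open>\<gamma> s\<close> witnesses the exponential of
  \<open>s *\<^sub>R v\<close>: its domain is an interval containing 0 and 1. As \<open>J\<close> is
  open, parameters on both sides of 0 are covered, so a derivative at 0 can be taken.\<close>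

lemma exp_domain_geodesic:
  assumes M: "atlas M" "Hausdorff_space (mtop M)" and \<Gamma>: "affine_connection M \<Gamma>" and z: "(p, v) \<in> exp_domain M \<Gamma>"
  obtains J \<gamma> where "open J" "is_interval J" "{0..1} \<subseteq> J" "smooth_curve M J \<gamma>" 
    "\<gamma> 0 = p" "velocity M \<gamma> 0 = v" "\<And>s. s \<in> J \<Longrightarrow> exp_map M \<Gamma> (p, s *\<^sub>R v) = \<gamma> s"
proof -
  obtain J \<gamma> where J: "open J" "is_interval J" "{0..1} \<subseteq> J" "geodesic_on M \<Gamma> J \<gamma>"
     "\<gamma> 0 = p" "velocity M \<gamma> 0 = v" using z by (auto simp: exp_domain_def exp_rel_def)
  have 0: "0 \<in> J" using J(3) by force
  have "exp_map M \<Gamma> (p, s *\<^sub>R v) = \<gamma> s" if s: "s \<in> J" for s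
  proof (rule exp_map_eqI[OF M \<Gamma>])
    let ?J = "{r. r * s \<in> J}"
    have o: "open ?J" using open_vimage[OF J(1), of "\<lambda>r. r * s"] by (simp add: vimage_def continuous_on_mult_right)
    have i: "is_interval ?J"
      unfolding is_interval_1
    proof (intro ballI allI impI)
      fix a b x assume "a \<in> ?J" "b \<in> ?J" "a \<le> x \<and> x \<le> b"
      then have ab: "a * s \<in> J" "b * s \<in> J" "a \<le> x" "x \<le> b" by auto
      then have "a * s \<le> x * s \<and> x * s \<le> b * s \<or> b * s \<le> x * s \<and> x * s \<le> a * s"
        by (meson mult_right_mono mult_right_mono_neg linear)
      then show "x \<in> ?J" using ab J(2) unfolding is_interval_1 by blast
    qed
    have "0 \<in> ?J" "1 \<in> ?J" using 0 s by auto
    then have sub: "{0..1} \<subseteq> ?J" using i unfolding is_interval_1 by (meson atLeastAtMost_iff subsetI)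
    have "velocity M (\<lambda>r. \<gamma> (r * s)) 0 = s *\<^sub>R v"
      using geodesic_rescale(2)[OF M(1) \<Gamma> J(1,4), of 0 s] 0 J(6) by simp
    then show "exp_rel M \<Gamma> (p, s *\<^sub>R v) (\<gamma> s)"
      unfolding exp_rel_def
      by (intro exI[of _ ?J] exI[of _ "\<lambda>r. \<gamma> (r * s)"])
         (use o i sub geodesic_rescale(1)[OF M(1) \<Gamma> J(1,4)] J(5) in auto)
  qed
  then show thesis using that[OF J(1-3) geodesic_on_curve[OF M(1) J(1,4)] J(5,6)] by blast
qed

section \<open>The normal bundle\<close>

lemma lorentzian_form_nondegenerate:
  fixes b :: "'e::euclidean_space \<Rightarrow> 'e \<Rightarrow> real"
  assumes b: "lorentzian_form b" and z: "\<And>v. b v w = 0" shows "w = 0"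
proof -
  obtain i and e :: "'e \<Rightarrow> 'e" where i: "i \<in> Basis" and e: "linear e" "bij e"
    and be: "\<forall>x y. b (e x) (e y) = x \<bullet> y - 2 * (x \<bullet> i) * (y \<bullet> i)"
    using b unfolding lorentzian_form_def by blast
  obtain y where y: "w = e y" using e(2) by (metis bij_pointE)
  have "i \<bullet> i = 1" using i by (simp add: inner_Basis)
  \<comment> \<open>The first argument is the reflection of \<open>y\<close> in the hyperplane
    orthogonal to \<open>i\<close>; it undoes the single negative sign and leaves the Euclidean
    square of \<open>y\<close>.\<close>
  then have "b (e (y - (2 * (y \<bullet> i)) *\<^sub>R i)) (e y) = y \<bullet> y"
    by (simp add: be inner_diff_left algebra_simps inner_commute)
  then have "y = 0" using z y by simp
  then show ?thesis using y e(1) by (simp add: linear_0)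
qed

text \<open>\<open>L w\<close> represents the functional \<open>b v (f w)\<close> of
  \<open>v\<close> by the Euclidean inner product. Nondegeneracy makes \<open>L\<close> injective,
  and the set in question is the Euclidean orthogonal complement of its range, whether or not
  \<open>b\<close> is degenerate on the range of \<open>f\<close>.\<close>

lemma dim_orthogonal_nondegenerate:
  fixes b :: "'e::euclidean_space \<Rightarrow> 'e \<Rightarrow> real" and f :: "'a::euclidean_space \<Rightarrow> 'e"
  assumes b: "bilinear b" and nd: "\<And>w. (\<And>v. b v w = 0) \<Longrightarrow> w = 0" and f: "linear f" "inj f"
  shows "dim {v. \<forall>w. b v (f w) = 0} + DIM('a) = DIM('e)"
proof -
  define L where "L w = (\<Sum>j\<in>Basis. b j (f w) *\<^sub>R j)" for w
  have bl: "linear (\<lambda>v. b v u)" "linear (b u)" for u using b by (auto simp: bilinear_def)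
  have L: "v \<bullet> L w = b v (f w)" for v w
  proof -
    have "b v (f w) = b (\<Sum>j\<in>Basis. (v \<bullet> j) *\<^sub>R j) (f w)" by (simp add: euclidean_representation)
    also have "\<dots> = (\<Sum>j\<in>Basis. (v \<bullet> j) * b j (f w))"
      by (simp add: linear_sum[OF bl(1)] linear_scale[OF bl(1)])
    finally show ?thesis by (simp add: L_def inner_sum_right mult.commute)
  qed
  have lin: "linear L"
  proof (rule linearI)
    show "L (x + y) = L x + L y" for x y
      by (simp add: L_def linear_add[OF f(1)] linear_add[OF bl(2)] scaleR_add_left sum.distrib)
    show "L (r *\<^sub>R x) = r *\<^sub>R L x" for r x
      by (simp add: L_def linear_scale[OF f(1)] linear_scale[OF bl(2)] scaleR_sum_right)
  qed
  have "inj L"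
  proof (subst linear_injective_0[OF lin], intro allI impI)
    fix w assume "L w = 0"
    then have "b v (f w) = 0" for v using L[of v w] by simp
    then have "f w = f 0" using nd linear_0[OF f(1)] by metis
    then show "w = 0" using f(2) by (simp add: inj_eq)
  qed
  then have "dim (range L) = DIM('a)"
    using dim_image_eq[OF lin, of UNIV] by simp
  moreover have "{y \<in> UNIV. \<forall>x\<in>range L. orthogonal x y} = {v. \<forall>w. b v (f w) = 0}"
    using L by (auto simp: orthogonal_def inner_commute)
  moreover have "subspace (range L)" using linear_subspace_image[OF lin] by simp
  ultimately show ?thesis
    using dim_subspace_orthogonal_to_vectors[of "range L" "UNIV :: 'e set"] by simp
qed

lemma two_dim_frame_span:
  fixes e1 e2 :: "'e::euclidean_space"
  assumes N: "dim N = 2" "e1 \<in> N" "e2 \<in> N" "v \<in> N"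
    and ind: "\<And>a b. a *\<^sub>R e1 + b *\<^sub>R e2 = 0 \<Longrightarrow> a = 0 \<and> b = 0"
  shows "\<exists>a b. v = a *\<^sub>R e1 + b *\<^sub>R e2"
proof -
  have e2: "e2 \<noteq> 0" using ind[of 0 1] by auto
  have e1: "e1 \<notin> span {e2}"
  proof
    assume "e1 \<in> span {e2}"
    then obtain k where "e1 = k *\<^sub>R e2" by (auto simp: span_singleton)
    then show False using ind[of 1 "- k"] by simp
  qed
  then have ne: "e1 \<noteq> e2" using span_base[of e2 "{e2}"] by auto
  have "independent {e1, e2}" using e1 e2 by (simp add: independent_insert ne)
  then have "N \<subseteq> span {e1, e2}" using N ne by (intro card_ge_dim_independent) auto
  then have "v \<in> span {e1, e2}" using N(4) by blast
  then obtain k where "v - k *\<^sub>R e1 \<in> span {e2}" by (auto simp: span_breakdown_eq)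
  then obtain b where "v - k *\<^sub>R e1 = b *\<^sub>R e2" by (auto simp: span_singleton)
  then have "v = k *\<^sub>R e1 + b *\<^sub>R e2" by (simp add: algebra_simps)
  then show ?thesis by blast
qed

text \<open>Cramer's rule with the Gram determinant \<Delta>: coefficients become quotients of inner
  products, so they vary smoothly with the frame and the vector. The inner product is merely
  auxiliary and unrelated to the metric of the spacetime.\<close>

lemma gram_cramer:
  fixes e1 e2 v :: "'e::real_inner"
  assumes ind: "\<And>a b. a *\<^sub>R e1 + b *\<^sub>R e2 = 0 \<Longrightarrow> a = 0 \<and> b = 0" and v: "v = a *\<^sub>R e1 + b *\<^sub>R e2"
  defines "\<Delta> \<equiv> (e1 \<bullet> e1) * (e2 \<bullet> e2) - (e1 \<bullet> e2) * (e1 \<bullet> e2)"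
  shows "\<Delta> \<noteq> 0" "a = ((v \<bullet> e1) * (e2 \<bullet> e2) - (v \<bullet> e2) * (e1 \<bullet> e2)) / \<Delta>"
    "b = ((v \<bullet> e2) * (e1 \<bullet> e1) - (v \<bullet> e1) * (e1 \<bullet> e2)) / \<Delta>"
proof -
  show \<Delta>: "\<Delta> \<noteq> 0"
  proof
    assume 0: "\<Delta> = 0"
    \<comment> \<open>The part of \<open>e1\<close> orthogonal to \<open>e2\<close>, scaled to avoid
      a division; its square is \<Delta> times that of \<open>e2\<close>.\<close>
    let ?w = "(e2 \<bullet> e2) *\<^sub>R e1 + (- (e1 \<bullet> e2)) *\<^sub>R e2"
    have "?w \<bullet> ?w = (e2 \<bullet> e2) * \<Delta>"
      by (simp add: \<Delta>_def inner_add_left inner_add_right inner_diff_left inner_diff_right inner_commute algebra_simps)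
    then have "?w = 0" using 0 by simp
    then have "e2 \<bullet> e2 = 0" using ind by blast
    then show False using ind[of 0 1] by simp
  qed
  have "(v \<bullet> e1) * (e2 \<bullet> e2) - (v \<bullet> e2) * (e1 \<bullet> e2) = a * \<Delta>"
    "(v \<bullet> e2) * (e1 \<bullet> e1) - (v \<bullet> e1) * (e1 \<bullet> e2) = b * \<Delta>"
    unfolding v \<Delta>_def by (simp_all add: inner_add_left inner_commute algebra_simps)
  then show "a = ((v \<bullet> e1) * (e2 \<bullet> e2) - (v \<bullet> e2) * (e1 \<bullet> e2)) / \<Delta>"
    "b = ((v \<bullet> e2) * (e1 \<bullet> e1) - (v \<bullet> e1) * (e1 \<bullet> e2)) / \<Delta>" using \<Delta> by simp_all
qed

section \<open>Smooth sections and open submanifolds\<close>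

lemma vector_field_along_smooth:
  assumes N: "atlas N" and X: "vector_field_along N M f X" and c: "c \<in> N" and d: "d \<in> M"
  shows "smooth_on (snd c ` {p \<in> fst c. f p \<in> fst d}) (\<lambda>x. to_chart M d (f (chart_inv c x)) (X (chart_inv c x)))"
proof -
  let ?d = "(fst d \<times> UNIV, \<lambda>(p, v). (snd d p, to_chart M d p v))"
  have d': "?d \<in> tangent_bundle M"
    unfolding tangent_bundle_def by (intro CollectI exI[of _ d] conjI refl d)
  note X' = X[unfolded vector_field_along_def]
  have "{p \<in> fst c. (f p, X p) \<in> fst ?d} = {p \<in> fst c. f p \<in> fst d}" by auto
  then have "open (snd c ` {p \<in> fst c. f p \<in> fst d})"
    using smooth_map_open_rep[OF N X' c openin_mtop_chart[OF d']] by simp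
  moreover have "smooth_on (snd c ` {p \<in> fst c. f p \<in> fst d})
    (\<lambda>x. (snd d (f (chart_inv c x)), to_chart M d (f (chart_inv c x)) (X (chart_inv c x))))"
    using smooth_map_smooth_rep[OF X' c d'] by (simp add: comp_def)
  ultimately show ?thesis using smooth_on_snd by fastforce
qed

lemma openin_mtop_open_sub:
  assumes V: "openin (mtop M) V" and U: "openin (mtop (open_sub M V)) U"
  shows "openin (mtop M) U"
proof -
  have "generate_topology_on {{p\<in>D. \<phi> p \<in> B} | D \<phi> B. (D, \<phi>) \<in> open_sub M V \<and> open B} U"
    using U by (simp add: mtop_def openin_topology_generated_by_iff)
  then show ?thesis
  proof induction
    case (Basis s)
    then obtain D \<phi> B where s: "s = {p\<in>D \<inter> V. \<phi> p \<in> B}" "(D, \<phi>) \<in> M" "open B" 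
      unfolding open_sub_def by blast
    have "s = {p\<in>fst (D, \<phi>). snd (D, \<phi>) p \<in> B} \<inter> V" using s by auto
    moreover have "openin (mtop M) ({p\<in>fst (D, \<phi>). snd (D, \<phi>) p \<in> B} \<inter> V)"
      by (intro openin_Int openin_mtop_preimage s V)
    ultimately show ?case by simp
  qed auto
qed

lemma carrier_open_sub: "carrier (open_sub M W) = carrier M \<inter> W"
proof -
  have "open_sub M W = (\<lambda>c. (fst c \<inter> W, snd c)) ` M" by (force simp: open_sub_def)
  then show ?thesis by (auto simp: carrier_def)
qed

lemma atlas_open_sub:
  assumes M: "atlas M" and W: "openin (mtop M) W"
  shows "atlas (open_sub M W)"
proof -
  have "open (snd c ` (fst c \<inter> W \<inter> (fst c' \<inter> W))) \<and>
     smooth_on (snd c ` (fst c \<inter> W \<inter> (fst c' \<inter> W))) (snd c' \<circ> chart_inv (fst c \<inter> W, snd c))"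
    if c: "c \<in> M" "c' \<in> M" for c c'
  proof -
    have eq: "fst c \<inter> W \<inter> (fst c' \<inter> W) = fst c \<inter> (W \<inter> fst c')" by blast
    have o: "open (snd c ` (fst c \<inter> (W \<inter> fst c')))"
      by (intro open_chart_image[OF M c(1)] openin_Int W openin_mtop_chart c)
    have inj: "inj_on (snd c) (fst c)" using M c by (auto simp: atlas_def)
    then have inj': "inj_on (snd (fst c \<inter> W, snd c)) (fst (fst c \<inter> W, snd c))" by (auto simp: inj_on_def)
    have "smooth_on (snd c ` (fst c \<inter> fst c')) (snd c' \<circ> chart_inv c)" using M c by (auto simp: atlas_def)
    then have "smooth_on (snd c ` (fst c \<inter> (W \<inter> fst c'))) (snd c' \<circ> chart_inv c)"
      by (rule smooth_on_subset) blast
    then have "smooth_on (snd c ` (fst c \<inter> (W \<inter> fst c'))) (snd c' \<circ> chart_inv (fst c \<inter> W, snd c))"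
      by (rule smooth_on_cong[OF o, rotated]) 
         (use chart_inv_chart'[OF inj] chart_inv_chart'[OF inj'] in auto)
    then show ?thesis using o unfolding eq by blast
  qed
  note 1 = this
  have 2: "inj_on (snd c) (fst c \<inter> W)" if "c \<in> M" for c
    using M that by (auto simp: atlas_def inj_on_def)
  have e: "open_sub M W = (\<lambda>c. (fst c \<inter> W, snd c)) ` M" by (force simp: open_sub_def)
  show ?thesis unfolding atlas_def e using 1 2 open_chart_image[OF M _ W] by simp
qed

section \<open>The normal exponential map along a lightlike field\<close>

abbreviation normal_chart ::
    "('m, 'e::euclidean_space) mfld \<Rightarrow> ('m \<Rightarrow> 'e \<Rightarrow> 'e \<Rightarrow> real) \<Rightarrow> ('m, 'a::euclidean_space) mfld \<Rightarrow>
       ('m, 'a) chart \<Rightarrow> 'm set \<Rightarrow> ('m \<Rightarrow> 'e) \<Rightarrow> ('m \<Rightarrow> 'e) \<Rightarrow> ('m \<times> 'e, 'a \<times> real \<times> real) chart"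
  where "normal_chart M g S a W e1 e2 \<equiv> ({(p, v). p \<in> fst a \<inter> W \<and> v \<in> normal_space M g S p},
       \<lambda>(p, v). (snd a p, THE ab. v = fst ab *\<^sub>R e1 p + snd ab *\<^sub>R e2 p))"

lemma normal_bundle_cases:
  assumes "c \<in> normal_bundle M g S"
  obtains a W e1 e2 where "a \<in> S" "openin (mtop S) W" "normal_frame M g S W e1 e2" "c = normal_chart M g S a W e1 e2"
proof -
  obtain D \<phi> W e1 e2 where "(D, \<phi>) \<in> S" "openin (mtop S) W" "normal_frame M g S W e1 e2"
    "c = ({(p, v). p \<in> D \<inter> W \<and> v \<in> normal_space M g S p},
       \<lambda>(p, v). (\<phi> p, THE ab. v = fst ab *\<^sub>R e1 p + snd ab *\<^sub>R e2 p))"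
    using assms unfolding normal_bundle_def by blast
  then show thesis using that[of "(D, \<phi>)" W e1 e2] by simp
qed

locale lightlike_emanation =
  fixes M :: "('m, 'e::euclidean_space) mfld" and S :: "('m, 'a::euclidean_space) mfld"
    and g :: "'m \<Rightarrow> 'e \<Rightarrow> 'e \<Rightarrow> real" and \<Gamma> :: "('m, 'e) christoffel" and \<xi> :: "'m \<Rightarrow> 'e"
    and V :: "('m \<times> 'e) set"
  assumes dim: "DIM('e) = DIM('a) + 2"
    and manifold_M: "smooth_manifold M" and lorentzian: "lorentzian_metric M g"
    and LC: "levi_civita M g \<Gamma>" and embedded: "embedded_submanifold S M"
    and \<xi>: "lightlike_normal_field M g S \<xi>" and V: "normal_exp_neighborhood M g \<Gamma> S V"
begin

lemma M: "atlas M" and Hausdorff_M: "Hausdorff_space (mtop M)"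
  using manifold_M smooth_manifold_atlas by (auto simp: smooth_manifold_def)

lemma S: "atlas S"
  using embedded smooth_manifold_atlas by (auto simp: embedded_submanifold_def)

lemma connection: "affine_connection M \<Gamma>"
  using LC by (simp add: levi_civita_def)

lemma symmetric_g: "symmetric_tensor M g"
  using lorentzian by (simp add: lorentzian_metric_def)

lemma smooth_inclusion: "smooth_map S M (\<lambda>p. p)" and inj_inclusion: "p \<in> carrier S \<Longrightarrow> inj (mfderiv S M (\<lambda>p. p) p)"
  using embedded by (auto simp: embedded_submanifold_def immersion_def id_def)

lemma S_subset: "p \<in> carrier S \<Longrightarrow> p \<in> carrier M"
  using smooth_map_carrier[OF smooth_inclusion] .

text \<open>Here codimension two and the Lorentzian signature enter: the metric is nondegenerate, so
  orthogonality to the injected tangent space cuts the dimension by exactly that of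
  \<open>S\<close>.\<close>

lemma dim_normal_space:
  assumes p: "p \<in> carrier S" shows "dim (normal_space M g S p) = 2"
proof -
  have pM: "p \<in> carrier M" by (rule S_subset[OF p])
  have "bilinear (g p)" using symmetric_g pM by (simp add: symmetric_tensor_def)
  moreover have "w = 0" if "\<And>v. g p v w = 0" for w
    using lorentzian_form_nondegenerate[of "g p" w] lorentzian pM that by (simp add: lorentzian_metric_def)
  ultimately have "dim {v. \<forall>w. g p v (mfderiv S M (\<lambda>p. p) p w) = 0} + DIM('a) = DIM('e)"
    by (rule dim_orthogonal_nondegenerate[OF _ _ linear_mfderiv[OF smooth_inclusion p] inj_inclusion[OF p]])
  then show ?thesis using dim by (simp add: normal_space_def id_def)
qed

lemma frame_THE:
  assumes "normal_frame M g S W e1 e2" "p \<in> W" "v = a *\<^sub>R e1 p + b *\<^sub>R e2 p"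
  shows "(THE ab. v = fst ab *\<^sub>R e1 p + snd ab *\<^sub>R e2 p) = (a, b)"
proof (rule the_equality)
  fix ab assume "v = fst ab *\<^sub>R e1 p + snd ab *\<^sub>R e2 p"
  then have "(fst ab - a) *\<^sub>R e1 p + (snd ab - b) *\<^sub>R e2 p = 0"
    using assms(3) by (simp add: algebra_simps)
  then have "fst ab - a = 0 \<and> snd ab - b = 0" using assms(1,2) unfolding normal_frame_def by blast
  then show "ab = (a, b)" by (simp add: prod_eq_iff)
qed (use assms in simp)

text \<open>Frames are only required to be independent; two independent vectors in a two-dimensional
  normal space span it. This gives existence for the definite description in the bundle charts,
  independence gives uniqueness.\<close>

lemma frame_span:
  assumes W: "openin (mtop S) W" and fr: "normal_frame M g S W e1 e2" and p: "p \<in> W" "v \<in> normal_space M g S p"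
  shows "\<exists>a b. v = a *\<^sub>R e1 p + b *\<^sub>R e2 p"
proof -
  have "p \<in> carrier S" using openin_subset[OF W] p by auto
  then show ?thesis
    using fr p by (intro two_dim_frame_span[OF dim_normal_space]) (auto simp: normal_frame_def)
qed

lemma inj_on_normal_chart:
  assumes a: "a \<in> S" and W: "openin (mtop S) W" and fr: "normal_frame M g S W e1 e2"
  shows "inj_on (snd (normal_chart M g S a W e1 e2)) (fst (normal_chart M g S a W e1 e2))"
proof (rule inj_onI)
  fix z z' assume z: "z \<in> fst (normal_chart M g S a W e1 e2)" "z' \<in> fst (normal_chart M g S a W e1 e2)"
    and eq: "snd (normal_chart M g S a W e1 e2) z = snd (normal_chart M g S a W e1 e2) z'"
  obtain p v p' v' where zp: "z = (p, v)" "z' = (p', v')" by fastforce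
  have p: "p \<in> fst a" "p' \<in> fst a" "p \<in> W" "v \<in> normal_space M g S p" "v' \<in> normal_space M g S p'"
    using z zp by auto
  have pp: "p = p'" using eq zp p chart_inv_chart[OF S a] by (auto simp: prod_eq_iff) metis
  obtain x y where v: "v = x *\<^sub>R e1 p + y *\<^sub>R e2 p" using frame_span[OF W fr p(3,4)] by blast
  obtain x' y' where v': "v' = x' *\<^sub>R e1 p + y' *\<^sub>R e2 p"
    using frame_span[OF W fr p(3), of v'] p(5) pp by blast
  have "(x, y) = (x', y')"
    using eq frame_THE[OF fr p(3) v] frame_THE[OF fr p(3) v'] by (simp add: zp pp[symmetric])
  then show "z = z'" using zp pp v v' by simp
qed

definition coef :: "('m \<Rightarrow> 'e) \<Rightarrow> ('m \<Rightarrow> 'e) \<Rightarrow> 'm \<Rightarrow> real \<times> real"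
  where "coef e1 e2 p = (THE ab. \<xi> p = fst ab *\<^sub>R e1 p + snd ab *\<^sub>R e2 p)"

lemma \<xi>_normal: "p \<in> carrier S \<Longrightarrow> t *\<^sub>R \<xi> p \<in> normal_space M g S p"
proof -
  assume p: "p \<in> carrier S"
  have "bilinear (g p)" using symmetric_g S_subset[OF p] by (simp add: symmetric_tensor_def)
  then show ?thesis using \<xi> p by (simp add: lightlike_normal_field_def normal_space_def bilinear_lmul)
qed

lemma coef_eq:
  assumes W: "openin (mtop S) W" and fr: "normal_frame M g S W e1 e2" and p: "p \<in> W"
  shows "\<xi> p = fst (coef e1 e2 p) *\<^sub>R e1 p + snd (coef e1 e2 p) *\<^sub>R e2 p"
    and "(THE ab. t *\<^sub>R \<xi> p = fst ab *\<^sub>R e1 p + snd ab *\<^sub>R e2 p) = t *\<^sub>R coef e1 e2 p"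
proof -
  have pS: "p \<in> carrier S" using openin_subset[OF W] p by auto
  obtain a b where ab: "\<xi> p = a *\<^sub>R e1 p + b *\<^sub>R e2 p"
    using frame_span[OF W fr p, of "\<xi> p"] \<xi>_normal[OF pS, of 1] by auto
  have c: "coef e1 e2 p = (a, b)" unfolding coef_def by (rule frame_THE[OF fr p ab])
  then show "\<xi> p = fst (coef e1 e2 p) *\<^sub>R e1 p + snd (coef e1 e2 p) *\<^sub>R e2 p" using ab by simp
  have "t *\<^sub>R \<xi> p = (t * a) *\<^sub>R e1 p + (t * b) *\<^sub>R e2 p" by (simp add: ab scaleR_add_right)
  from frame_THE[OF fr p this] show "(THE ab. t *\<^sub>R \<xi> p = fst ab *\<^sub>R e1 p + snd ab *\<^sub>R e2 p) = t *\<^sub>R coef e1 e2 p"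
    by (simp add: c)
qed

text \<open>In one chart of \<open>M\<close> around \<open>p\<close> the components of
  \<open>\<xi>\<close>, \<open>e1\<close> and \<open>e2\<close> are smooth. The linear isomorphism
  \<open>to_chart\<close> keeps the frame independent there, so Cramer's rule yields the
  coefficients with nonvanishing denominator.\<close>

lemma coef_smooth:
  assumes W: "openin (mtop S) W" and fr: "normal_frame M g S W e1 e2" and a: "a \<in> S"
  shows "smooth_on (snd a ` (fst a \<inter> W)) (\<lambda>x. coef e1 e2 (chart_inv a x))"
proof (rule smooth_on_local)
  fix x assume "x \<in> snd a ` (fst a \<inter> W)"
  then obtain p where p: "p \<in> fst a" "p \<in> W" "x = snd a p" by blast
  have pM: "p \<in> carrier M" by (rule S_subset[OF chart_dom_carrier[OF a p(1)]])
  let ?d = "chart_at M p"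
  note d = chart_at_in[OF pM]
  let ?X = "snd a ` (fst a \<inter> (W \<inter> {q \<in> carrier S. q \<in> fst ?d}))"
  have X: "open ?X"
    by (intro open_chart_image[OF S a] openin_Int W smooth_map_openin[OF smooth_inclusion openin_mtop_chart] d)
  have xX: "x \<in> ?X" using p d chart_dom_carrier[OF a] by auto
  let ?E = "\<lambda>e x. to_chart M ?d (chart_inv a x) (e (chart_inv a x))"
  let ?c = "(fst a \<inter> W, snd a)"
  have inv: "chart_inv a (snd a q) = q" if "q \<in> fst a" for q by (rule chart_inv_chart[OF S a that])
  have inv': "chart_inv ?c (snd a q) = q" if "q \<in> fst a" "q \<in> W" for q
  proof -
    have "inj_on (snd ?c) (fst ?c)" using S a by (auto simp: atlas_def inj_on_def)
    from chart_inv_chart'[OF this, of q] show ?thesis using that by simp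
  qed
  have E: "smooth_on ?X (?E e)" if "vector_field_along (open_sub S W) M id e" for e
  proof -
    have c: "?c \<in> open_sub S W" unfolding open_sub_def using a by (cases a) auto
    have sub: "?X \<subseteq> snd ?c ` {p \<in> fst ?c. id p \<in> fst ?d}" by auto
    show ?thesis
      by (rule smooth_on_cong[OF X _ smooth_on_subset[OF vector_field_along_smooth[OF atlas_open_sub[OF S W] that c d(1)] sub]])
         (auto simp: inv inv')
  qed
  have E1: "smooth_on ?X (?E e1)" and E2: "smooth_on ?X (?E e2)"
    using fr by (auto simp: normal_frame_def intro: E)
  have sub: "?X \<subseteq> snd a ` {p \<in> fst a. id p \<in> fst ?d}" by auto
  have v\<xi>: "vector_field_along S M id \<xi>" using \<xi> by (simp add: lightlike_normal_field_def)
  have E0: "smooth_on ?X (?E \<xi>)"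
    using smooth_on_subset[OF vector_field_along_smooth[OF S v\<xi> a d(1)] sub] by simp
  let ?D = "\<lambda>x. (?E e1 x \<bullet> ?E e1 x) * (?E e2 x \<bullet> ?E e2 x) - (?E e1 x \<bullet> ?E e2 x) * (?E e1 x \<bullet> ?E e2 x)"
  let ?A = "\<lambda>x. (?E \<xi> x \<bullet> ?E e1 x) * (?E e2 x \<bullet> ?E e2 x) - (?E \<xi> x \<bullet> ?E e2 x) * (?E e1 x \<bullet> ?E e2 x)"
  let ?B = "\<lambda>x. (?E \<xi> x \<bullet> ?E e2 x) * (?E e1 x \<bullet> ?E e1 x) - (?E \<xi> x \<bullet> ?E e1 x) * (?E e1 x \<bullet> ?E e2 x)"
  have cramer: "?D y \<noteq> 0 \<and> coef e1 e2 (chart_inv a y) = (?A y / ?D y, ?B y / ?D y)" if "y \<in> ?X" for y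
  proof -
    obtain q where q: "q \<in> fst a" "q \<in> W" "q \<in> fst ?d" "y = snd a q" using \<open>y \<in> ?X\<close> by auto
    have l: "linear (to_chart M ?d q)" by (rule linear_to_chart[OF M d(1) q(3)])
    have ind: "u = 0 \<and> v = 0" if "u *\<^sub>R to_chart M ?d q (e1 q) + v *\<^sub>R to_chart M ?d q (e2 q) = 0" for u v
    proof -
      have "to_chart M ?d q (u *\<^sub>R e1 q + v *\<^sub>R e2 q) = to_chart M ?d q 0"
        using that by (simp add: linear_add[OF l] linear_scale[OF l] linear_0[OF l])
      then have "u *\<^sub>R e1 q + v *\<^sub>R e2 q = 0" using from_to_chart(1)[OF M d(1) q(3)] by metis
      then show ?thesis using fr q(2) unfolding normal_frame_def by blast
    qed
    have eq: "to_chart M ?d q (\<xi> q) = fst (coef e1 e2 q) *\<^sub>R to_chart M ?d q (e1 q) + snd (coef e1 e2 q) *\<^sub>R to_chart M ?d q (e2 q)"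
      using arg_cong[OF coef_eq(1)[OF W fr q(2)], of "to_chart M ?d q"] by (simp add: linear_add[OF l] linear_scale[OF l])
    show ?thesis
      using gram_cramer[OF ind eq] by (simp add: q(4) inv[OF q(1)] prod_eq_iff)
  qed
  have "smooth_on ?X (\<lambda>x. (?A x / ?D x, ?B x / ?D x))"
    by (intro smooth_on_Pair[OF X] smooth_on_divide[OF X] smooth_on_diff[OF X] smooth_on_mult[OF X] smooth_on_inner[OF X] E1 E2 E0)
       (use cramer in blast)+
  then have "smooth_on ?X (\<lambda>x. coef e1 e2 (chart_inv a x))"
    by (rule smooth_on_cong[OF X, rotated]) (use cramer in blast)
  then show "\<exists>Y. open Y \<and> x \<in> Y \<and> smooth_on Y (\<lambda>x. coef e1 e2 (chart_inv a x))"
    using X xX by blast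
qed

text \<open>Continuity, in coordinates, of the map taking (p, t) to t\<xi> in the normal bundle. It
  serves twice: for the openness of the flow domain and for the neighbourhoods used in the
  smoothness of \<open>\<Phi>\<close>.\<close>

lemma open_scaled_section:
  assumes U: "openin (mtop (normal_bundle M g S)) U" and a: "a \<in> S"
  shows "open ((\<lambda>(p, t). (snd a p, t)) ` {(p, t). p \<in> fst a \<and> (p, t *\<^sub>R \<xi> p) \<in> U})"
proof -
  have inj: "p = q" if "p \<in> fst a" "q \<in> fst a" "snd a p = snd a q" for p q
    using chart_inv_chart[OF S a] that by metis
  have "generate_topology_on {{p\<in>D. \<phi> p \<in> B} | D \<phi> B. (D, \<phi>) \<in> normal_bundle M g S \<and> open B} U"
    using U by (simp add: mtop_def openin_topology_generated_by_iff)
  then show ?thesis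
  proof induction
    case Empty
    then show ?case by simp
  next
    case (Int U1 U2)
    have eq: "(\<lambda>(p, t). (snd a p, t)) ` {(p, t). p \<in> fst a \<and> (p, t *\<^sub>R \<xi> p) \<in> U1 \<inter> U2} =
      (\<lambda>(p, t). (snd a p, t)) ` {(p, t). p \<in> fst a \<and> (p, t *\<^sub>R \<xi> p) \<in> U1} \<inter>
      (\<lambda>(p, t). (snd a p, t)) ` {(p, t). p \<in> fst a \<and> (p, t *\<^sub>R \<xi> p) \<in> U2}"
      by (fastforce dest: inj)
    show ?case unfolding eq by (rule open_Int[OF Int.IH])
  next
    case (UN K)
    have "(\<lambda>(p, t). (snd a p, t)) ` {(p, t). p \<in> fst a \<and> (p, t *\<^sub>R \<xi> p) \<in> \<Union>K} =
      (\<Union>k\<in>K. (\<lambda>(p, t). (snd a p, t)) ` {(p, t). p \<in> fst a \<and> (p, t *\<^sub>R \<xi> p) \<in> k})" by auto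
    moreover have "open (\<Union>k\<in>K. (\<lambda>(p, t). (snd a p, t)) ` {(p, t). p \<in> fst a \<and> (p, t *\<^sub>R \<xi> p) \<in> k})"
      by (intro open_UN ballI UN.IH)
    ultimately show ?case by (simp only:)
  next
    case (Basis s)
    then obtain D \<phi> B where s: "s = {z\<in>D. \<phi> z \<in> B}" "(D, \<phi>) \<in> normal_bundle M g S" "open B" by blast
    obtain b W e1 e2 where b: "b \<in> S" "openin (mtop S) W" "normal_frame M g S W e1 e2" "(D, \<phi>) = normal_chart M g S b W e1 e2"
      using normal_bundle_cases[OF s(2)] .
    let ?X = "snd a ` (fst a \<inter> (fst b \<inter> W))"
    \<comment> \<open>The scaled section in the chart \<open>a\<close> and the bundle chart over
      \<open>b\<close>: a change of chart on \<open>S\<close>, and \<open>t\<close> times the frame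
      coefficients of \<open>\<xi>\<close>.\<close>
    let ?f = "\<lambda>z. ((snd b \<circ> chart_inv a) (fst z), snd z *\<^sub>R coef e1 e2 (chart_inv a (fst z)))"
    have X: "open ?X" by (intro open_chart_image[OF S a] openin_Int b openin_mtop_chart)
    have 1: "continuous_on ?X (snd b \<circ> chart_inv a)"
      by (rule smooth_on_continuous, rule smooth_on_subset[of "snd a ` (fst a \<inter> fst b)"]) (use S a b in \<open>auto simp: atlas_def\<close>)
    have 2: "continuous_on ?X (\<lambda>x. coef e1 e2 (chart_inv a x))"
      by (rule smooth_on_continuous, rule smooth_on_subset[OF coef_smooth[OF b(2,3) a]]) auto
    have "continuous_on (?X \<times> (UNIV :: real set)) ?f"
      by (intro continuous_on_Pair continuous_on_scaleR continuous_on_snd continuous_on_id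
          continuous_on_compose2[OF 1 continuous_on_fst] continuous_on_compose2[OF 2 continuous_on_fst]) auto
    then have "open (?X \<times> UNIV \<inter> ?f -` B)"
      by (rule continuous_open_preimage) (use X s(3) in \<open>auto intro: open_Times\<close>)
    moreover have "(\<lambda>(p, t). (snd a p, t)) ` {(p, t). p \<in> fst a \<and> (p, t *\<^sub>R \<xi> p) \<in> s} = ?X \<times> UNIV \<inter> ?f -` B"
    proof -
      have D: "D = {(p, v). p \<in> fst b \<inter> W \<and> v \<in> normal_space M g S p}"
        and \<phi>: "\<phi> = (\<lambda>(p, v). (snd b p, THE ab. v = fst ab *\<^sub>R e1 p + snd ab *\<^sub>R e2 p))"
        using b(4) by simp_all
      have key: "(p, t *\<^sub>R \<xi> p) \<in> s \<longleftrightarrow> p \<in> fst b \<inter> W \<and> (snd b p, t *\<^sub>R coef e1 e2 p) \<in> B" if "p \<in> fst a" for p t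
        using \<xi>_normal[OF chart_dom_carrier[OF a that]] coef_eq(2)[OF b(2,3), of p t]
        by (auto simp: s(1) D \<phi>)
      have inv: "chart_inv a (snd a p) = p" if "p \<in> fst a" for p by (rule chart_inv_chart[OF S a that])
      show ?thesis
      proof (intro equalityI subsetI)
        fix z assume "z \<in> (\<lambda>(p, t). (snd a p, t)) ` {(p, t). p \<in> fst a \<and> (p, t *\<^sub>R \<xi> p) \<in> s}"
        then obtain p t where pt: "z = (snd a p, t)" "p \<in> fst a" "(p, t *\<^sub>R \<xi> p) \<in> s" by auto
        then show "z \<in> ?X \<times> UNIV \<inter> ?f -` B" using key[OF pt(2)] by (auto simp: inv)
      next
        fix z assume z: "z \<in> ?X \<times> UNIV \<inter> ?f -` B"
        then obtain p where p: "fst z = snd a p" "p \<in> fst a" "p \<in> fst b \<inter> W" by auto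
        then have "(p, snd z *\<^sub>R \<xi> p) \<in> s" using z key[OF p(2)] by (auto simp: inv)
        then show "z \<in> (\<lambda>(p, t). (snd a p, t)) ` {(p, t). p \<in> fst a \<and> (p, t *\<^sub>R \<xi> p) \<in> s}"
          using p by (intro image_eqI[of _ _ "(p, snd z)"]) (auto simp: prod_eq_iff)
      qed
    qed
    ultimately show ?case by simp
  qed
qed

end

lemma open_subI: "c \<in> M \<Longrightarrow> (fst c \<inter> W, snd c) \<in> open_sub M W"
  unfolding open_sub_def by (intro CollectI exI[of _ "fst c"] exI[of _ "snd c"]) simp

section \<open>The flow map of the lightlike field on its domain\<close>

context lightlike_emanation
begin

abbreviation W :: "('m \<times> real) set" where "W \<equiv> flow_domain S \<xi> V"
abbreviation \<O> :: "('m \<times> real, 'a \<times> real) mfld" where "\<O> \<equiv> cylinder S W"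
abbreviation \<Phi> :: "'m \<times> real \<Rightarrow> 'm" where "\<Phi> \<equiv> flow_map M \<Gamma> \<xi>"

lemma V_open: "openin (mtop (normal_bundle M g S)) V"
  using V by (simp add: normal_exp_neighborhood_def)

lemma W_iff: "(p, t) \<in> W \<longleftrightarrow> p \<in> carrier S \<and> (p, t *\<^sub>R \<xi> p) \<in> V"
  by (simp add: flow_domain_def)

sublocale open_cylinder S W
proof
  show "atlas S" by (rule S)
  show "W \<subseteq> carrier S \<times> UNIV" by (auto simp: flow_domain_def)
  fix a assume a: "a \<in> S"
  have "fst a \<times> UNIV \<inter> W = {(p, t). p \<in> fst a \<and> (p, t *\<^sub>R \<xi> p) \<in> V}"
    using chart_dom_carrier[OF a] by (auto simp: flow_domain_def)
  then show "open ((\<lambda>(p, t). (snd a p, t)) ` (fst a \<times> UNIV \<inter> W))"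
    using open_scaled_section[OF V_open a] by simp
qed

lemma zero_in_W: "p \<in> carrier S \<Longrightarrow> (p, 0) \<in> W"
  using V by (simp add: W_iff normal_exp_neighborhood_def)

lemma W_star: 
  assumes "(p, t) \<in> W" "0 \<le> s" "s \<le> 1" shows "(p, s * t) \<in> W"
proof -
  have "(p, s *\<^sub>R (t *\<^sub>R \<xi> p)) \<in> V"
    using V assms unfolding W_iff normal_exp_neighborhood_def by blast
  then show ?thesis using assms by (simp add: W_iff)
qed

lemma open_fiber: "open {t. (p, t) \<in> W}"
proof (cases "p \<in> carrier S")
  case True
  then obtain a where a: "a \<in> S" "p \<in> fst a" by (auto simp: carrier_def)
  have inj: "p = q" if "q \<in> fst a" "snd a p = snd a q" for q
    using chart_inv_chart[OF S a(1)] a(2) that by metis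
  have "{t. (p, t) \<in> W} = (\<lambda>t. (snd a p, t)) -` ((\<lambda>(p, t). (snd a p, t)) ` (fst a \<times> UNIV \<inter> W))"
  proof (intro equalityI subsetI)
    fix t assume "t \<in> {t. (p, t) \<in> W}"
    then show "t \<in> (\<lambda>t. (snd a p, t)) -` ((\<lambda>(p, t). (snd a p, t)) ` (fst a \<times> UNIV \<inter> W))"
      using a by (intro vimageI[OF refl] image_eqI[of _ _ "(p, t)"]) auto
  qed (auto dest: inj)
  moreover have "open \<dots>"
    by (intro open_vimage open_W a continuous_intros)
  ultimately show ?thesis by simp
next
  case False
  then have "{t. (p, t) \<in> W} = {}" by (auto simp: W_iff)
  then show ?thesis by simp
qed

lemma carrier_V: "carrier (open_sub (normal_bundle M g S) V) = V"
  using openin_subset[OF V_open] by (auto simp: carrier_open_sub)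

text \<open>Injectivity of the exponential map on \<open>V\<close> recovers the pair of
  \<open>p\<close> and t\<xi>, and \<open>\<xi> p\<close> being nonzero recovers
  \<open>t\<close>.\<close>

lemma inj_\<Phi>: "inj_on \<Phi> (carrier \<O>)"
proof (rule inj_onI)
  fix z z' assume z: "z \<in> carrier \<O>" "z' \<in> carrier \<O>" and eq: "\<Phi> z = \<Phi> z'"
  obtain p t p' t' where zp: "z = (p, t)" "z' = (p', t')" by fastforce
  have W: "(p, t) \<in> W" "(p', t') \<in> W" using z zp by (simp_all add: carrier_cylinder)
  have "inj_on (exp_map M \<Gamma>) V"
    using V carrier_V by (auto simp: normal_exp_neighborhood_def diffeomorphism_def bij_betw_def)
  then have "(p, t *\<^sub>R \<xi> p) = (p', t' *\<^sub>R \<xi> p')"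
    by (rule inj_onD) (use eq zp W in \<open>auto simp: flow_map_def W_iff\<close>)
  then have pp: "p = p'" "t *\<^sub>R \<xi> p = t' *\<^sub>R \<xi> p" by auto
  have "\<xi> p \<noteq> 0" using \<xi> W by (simp add: lightlike_normal_field_def W_iff)
  then have "t = t'" using pp(2) by auto
  then show "z = z'" using zp pp(1) by simp
qed

text \<open>\<open>\<Phi>\<close> is the exponential map after the scaled section. The former is
  smooth on \<open>V\<close> by hypothesis, the latter is \<open>?h\<close> in a bundle chart,
  smooth because the frame coefficients of \<open>\<xi>\<close> are.\<close>

lemma smooth_\<Phi>: "smooth_map \<O> M \<Phi>"
proof (rule smooth_mapI[OF atlas_cylinder M])
  obtain Z where Z: "openin (mtop M) Z"
    and ex: "diffeomorphism (open_sub (normal_bundle M g S) V) (open_sub M Z) (exp_map M \<Gamma>)"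
    using V by (auto simp: normal_exp_neighborhood_def)
  have sm: "smooth_map (open_sub (normal_bundle M g S) V) (open_sub M Z) (exp_map M \<Gamma>)"
    using ex by (simp add: diffeomorphism_def)
  fix z assume "z \<in> carrier \<O>"
  then obtain p t where z: "z = (p, t)" "(p, t) \<in> W" by (cases z) (simp add: carrier_cylinder)
  let ?v = "t *\<^sub>R \<xi> p"
  have pV: "(p, ?v) \<in> V" using z by (simp add: W_iff)
  then have "(p, ?v) \<in> carrier (normal_bundle M g S)" using openin_subset[OF V_open] by auto
  then obtain k where k: "k \<in> normal_bundle M g S" "(p, ?v) \<in> fst k" by (auto simp: carrier_def)
  obtain a U e1 e2 where a: "a \<in> S" "openin (mtop S) U" "normal_frame M g S U e1 e2" "k = normal_chart M g S a U e1 e2"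
    using normal_bundle_cases[OF k(1)] .
  have p: "p \<in> fst a" "p \<in> U" using k(2) a(4) by auto
  let ?q = "exp_map M \<Gamma> (p, ?v)"
  have "(p, ?v) \<in> carrier (open_sub (normal_bundle M g S) V)" using pV by (simp only: carrier_V)
  from smooth_map_carrier[OF sm this] have q: "?q \<in> carrier M" "?q \<in> Z"
    by (simp_all add: carrier_open_sub)
  let ?d = "chart_at M ?q"
  note d = chart_at_in[OF q(1)]
  let ?d' = "(fst ?d \<inter> Z, snd ?d)" and ?k' = "(fst k \<inter> V, snd k)"
  have d': "?d' \<in> open_sub M Z" and k': "?k' \<in> open_sub (normal_bundle M g S) V"
    by (rule open_subI[OF d(1)], rule open_subI[OF k(1)])
  let ?N = "{w \<in> carrier (open_sub (normal_bundle M g S) V). exp_map M \<Gamma> w \<in> fst ?d'}"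
  have "openin (mtop (open_sub (normal_bundle M g S) V)) ?N"
    by (rule smooth_map_openin[OF sm openin_mtop_chart[OF d']])
  then have N: "openin (mtop (normal_bundle M g S)) ?N" by (rule openin_mtop_open_sub[OF V_open])
  let ?c = "cyl_chart W a"
  \<comment> \<open>The first set keeps t\<xi> in \<open>V\<close> and its exponential in the chart
    \<open>?d'\<close>; the second keeps the base point in the domain of the frame.\<close>
  let ?X = "(\<lambda>(p, t). (snd a p, t)) ` {(p, t). p \<in> fst a \<and> (p, t *\<^sub>R \<xi> p) \<in> ?N} \<inter> (snd a ` (fst a \<inter> U)) \<times> UNIV"
  have U: "open (snd a ` (fst a \<inter> U))" by (rule open_chart_image[OF S a(1,2)])
  have X: "open ?X"
    by (intro open_Int open_scaled_section[OF N a(1)] open_Times U open_UNIV)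
  have inv: "chart_inv a (snd a p) = p" if "p \<in> fst a" for p by (rule chart_inv_chart[OF S a(1) that])
  have Xelem: "\<exists>p s. x = (snd a p, s) \<and> p \<in> fst a \<and> p \<in> U \<and> (p, s) \<in> W \<and> (p, s *\<^sub>R \<xi> p) \<in> fst ?k' \<and>
      exp_map M \<Gamma> (p, s *\<^sub>R \<xi> p) \<in> fst ?d'" if xX: "x \<in> ?X" for x
  proof -
    obtain p s where x: "x = (snd a p, s)" "p \<in> fst a" "(p, s *\<^sub>R \<xi> p) \<in> ?N" using xX by auto
    have "snd a p \<in> snd a ` (fst a \<inter> U)" using xX x(1) by auto
    then obtain q where q': "q \<in> fst a" "q \<in> U" "snd a p = snd a q" by auto
    have "p = q" using inv[OF x(2)] inv[OF q'(1)] unfolding q'(3) by (rule trans[OF sym])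
    then have "p \<in> U" using q'(2) by (simp only:)
    moreover have "p \<in> carrier S" by (rule chart_dom_carrier[OF a(1) x(2)])
    moreover have "(p, s *\<^sub>R \<xi> p) \<in> V" "exp_map M \<Gamma> (p, s *\<^sub>R \<xi> p) \<in> fst ?d'"
      using x(3) by (simp_all only: carrier_V mem_Collect_eq)
    ultimately show ?thesis
      using x(1,2) \<xi>_normal[of p s] by (intro exI[of _ p] exI[of _ s]) (simp add: W_iff a(4))
  qed
  let ?h = "\<lambda>x. (fst x, snd x *\<^sub>R coef e1 e2 (chart_inv a (fst x)))"
  have fX: "fst ` ?X \<subseteq> snd a ` (fst a \<inter> U)"
  proof (intro subsetI, elim imageE)
    fix y x assume "y = fst x" "x \<in> ?X"
    from Xelem[OF this(2)] obtain p s where "x = (snd a p, s)" "p \<in> fst a" "p \<in> U" by (elim exE conjE)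
    then show "y \<in> snd a ` (fst a \<inter> U)" using \<open>y = fst x\<close> by (intro image_eqI[of _ _ p]) auto
  qed
  have coefs: "smooth_on ?X (\<lambda>x. coef e1 e2 (chart_inv a (fst x)))"
    by (rule smooth_on_compose[where h="\<lambda>x. coef e1 e2 (chart_inv a x)" and f=fst,
          OF coef_smooth[OF a(2,3,1)] smooth_on_fst[OF X smooth_on_ident] X fX])
  have h: "smooth_on ?X ?h"
    by (intro smooth_on_Pair[OF X] smooth_on_fst[OF X] smooth_on_snd[OF X] smooth_on_scaleR[OF X] smooth_on_ident coefs)
  have kval: "snd ?k' (p, s *\<^sub>R \<xi> p) = ?h (snd a p, s)" if "p \<in> fst a" "p \<in> U" for p s
    using coef_eq(2)[OF a(2,3) that(2)] by (simp add: a(4) inv that)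
  have injk: "inj_on (snd ?k') (fst ?k')"
    using inj_on_normal_chart[OF a(1-3)] unfolding a(4)[symmetric] by (auto simp: inj_on_def)
  have "smooth_on ?X (\<lambda>x. (snd ?d' \<circ> exp_map M \<Gamma> \<circ> chart_inv ?k') (?h x))"
  proof (rule smooth_on_compose[OF smooth_map_smooth_rep[OF sm k' d'] h X], intro subsetI)
    fix y assume "y \<in> ?h ` ?X"
    then obtain x where x: "y = ?h x" "x \<in> ?X" by (rule imageE)
    obtain p s where ps: "x = (snd a p, s)" "p \<in> fst a" "p \<in> U" "(p, s *\<^sub>R \<xi> p) \<in> fst ?k'"
      "exp_map M \<Gamma> (p, s *\<^sub>R \<xi> p) \<in> fst ?d'" using Xelem[OF x(2)] by (elim exE conjE)
    show "y \<in> snd ?k' ` {p \<in> fst ?k'. exp_map M \<Gamma> p \<in> fst ?d'}"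
      using ps x kval[OF ps(2,3), of s] by (intro image_eqI[of _ _ "(p, s *\<^sub>R \<xi> p)"]) auto
  qed
  then have "smooth_on ?X (snd ?d \<circ> \<Phi> \<circ> chart_inv ?c)"
  proof (rule smooth_on_cong[OF X, rotated])
    fix x assume "x \<in> ?X"
    from Xelem[OF this] obtain p s where ps: "x = (snd a p, s)" "p \<in> fst a" "p \<in> U" "(p, s) \<in> W"
      "(p, s *\<^sub>R \<xi> p) \<in> fst ?k'" by (elim exE conjE)
    have "chart_inv ?k' (?h x) = (p, s *\<^sub>R \<xi> p)"
      using chart_inv_chart'[OF injk ps(5)] kval[OF ps(2,3), of s] ps(1) by simp
    then show "(snd ?d \<circ> \<Phi> \<circ> chart_inv ?c) x = (snd ?d' \<circ> exp_map M \<Gamma> \<circ> chart_inv ?k') (?h x)"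
      using chart_inv_cyl[OF a(1) ps(2,4)] ps(1) by (simp add: flow_map_def)
  qed
  moreover have "snd ?c z \<in> ?X"
  proof
    show "snd ?c z \<in> (\<lambda>(p, t). (snd a p, t)) ` {(p, t). p \<in> fst a \<and> (p, t *\<^sub>R \<xi> p) \<in> ?N}"
      using p pV q d z by (intro image_eqI[of _ _ "(p, t)"]) (simp_all add: carrier_V)
    show "snd ?c z \<in> (snd a ` (fst a \<inter> U)) \<times> UNIV" using p z by simp
  qed
  moreover have "?X \<subseteq> snd ?c ` fst ?c"
  proof
    fix x assume "x \<in> ?X"
    from Xelem[OF this] obtain p s where "x = (snd a p, s)" "p \<in> fst a" "(p, s) \<in> W" by (elim exE conjE)
    then show "x \<in> snd ?c ` fst ?c" by (intro image_eqI[of _ _ "(p, s)"]) auto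
  qed
  moreover have "\<Phi> ` chart_inv ?c ` ?X \<subseteq> fst ?d"
  proof (intro subsetI, elim imageE)
    fix y w x assume y: "y = \<Phi> w" "w = chart_inv ?c x" and "x \<in> ?X"
    from Xelem[OF this(3)] obtain p s where ps: "x = (snd a p, s)" "p \<in> fst a" "(p, s) \<in> W"
      "exp_map M \<Gamma> (p, s *\<^sub>R \<xi> p) \<in> fst ?d'" by (elim exE conjE)
    then show "y \<in> fst ?d" using y chart_inv_cyl[OF a(1) ps(2,3)] by (simp add: flow_map_def)
  qed
  moreover have "?c \<in> \<O>" "z \<in> fst ?c" using a(1) p z by (auto simp: cylinder_def)
  ultimately show "\<exists>a\<in>\<O>. \<exists>c\<in>M. \<exists>X. z \<in> fst a \<and> open X \<and> snd a z \<in> X \<and> X \<subseteq> snd a ` fst a \<and>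
      \<Phi> ` chart_inv a ` X \<subseteq> fst c \<and> smooth_on X (snd c \<circ> \<Phi> \<circ> chart_inv a)"
    by (intro bexI[of _ ?c] bexI[of _ ?d] exI[of _ ?X] conjI X d(1))
qed

lemma \<Phi>_vertical_derivative:
  assumes z: "(p, t) \<in> W" and a: "a \<in> S" "p \<in> fst a" and d: "d \<in> M" "\<Phi> (p, t) \<in> fst d"
  shows "((\<lambda>s. snd d (\<Phi> (p, s))) has_vector_derivative drep (cyl_chart W a) d \<Phi> (p, t) (0, 1)) (at t)"
proof -
  let ?c = "cyl_chart W a"
  have c: "?c \<in> \<O>" "(p, t) \<in> fst ?c" using a z by (auto simp: cylinder_def)
  note D = smooth_map_has_derivative[OF smooth_\<Phi> c(1) d(1) c(2) d(2)]
  have "((\<lambda>s. (snd d \<circ> \<Phi> \<circ> chart_inv ?c) (snd a p, s)) has_derivative (\<lambda>r. drep ?c d \<Phi> (p, t) (0, r))) (at t)"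
    by (rule has_derivative_compose[where f="\<lambda>s. (snd a p, s)" and g="snd d \<circ> \<Phi> \<circ> chart_inv ?c"])
       (use D in \<open>auto intro!: derivative_eq_intros\<close>)
  then have "((\<lambda>s. snd d (\<Phi> (p, s))) has_derivative (\<lambda>r. drep ?c d \<Phi> (p, t) (0, r))) (at t)"
    by (rule has_derivative_transform_within_open[OF _ open_fiber[of p]])
       (use z chart_inv_cyl[OF a] in auto)
  moreover have "drep ?c d \<Phi> (p, t) (0, r) = r *\<^sub>R drep ?c d \<Phi> (p, t) (0, 1)" for r
    using linear_scale[OF linear_drep[OF smooth_\<Phi> c(1) d(1) c(2) d(2)], of r "(0, 1)"] by simp
  then have "(\<lambda>r. drep ?c d \<Phi> (p, t) (0, r)) = (\<lambda>r. r *\<^sub>R drep ?c d \<Phi> (p, t) (0, 1))" by (rule ext)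
  ultimately show ?thesis unfolding has_vector_derivative_def by (simp only:)
qed

text \<open>The vertical curve through \<open>p\<close> is a reparametrised geodesic, since \<open>V\<close> lies in the domain of
  the exponential map and geodesics are unique.\<close>

lemma \<Phi>_initial:
  assumes p: "p \<in> carrier S"
  shows "\<Phi> (p, 0) = p"
    and "d \<in> M \<Longrightarrow> p \<in> fst d \<Longrightarrow> ((\<lambda>s. snd d (\<Phi> (p, s))) has_vector_derivative to_chart M d p (\<xi> p)) (at 0)"
proof -
  obtain e where e: "e > 0" "ball 0 e \<subseteq> {t. (p, t) \<in> W}"
    using open_fiber[of p] zero_in_W[OF p] openE[of "{t. (p, t) \<in> W}" 0] by blast
  \<comment> \<open>Any positive parameter of the fibre would do. The geodesic with initial velocity
    \<open>t *\<^sub>R \<xi> p\<close> is the generator run at speed \<open>t\<close>, whence the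
    arguments \<open>s / t\<close> below.\<close>
  define t where "t = e / 2"
  have "t \<in> ball 0 e" using e(1) by (simp add: t_def)
  then have "(p, t) \<in> W" using e(2) by blast
  moreover have "t > 0" using e(1) by (simp add: t_def)
  ultimately have t: "t > 0" "(p, t) \<in> W" by simp_all
  then have "(p, t *\<^sub>R \<xi> p) \<in> exp_domain M \<Gamma>"
    using V by (auto simp: W_iff normal_exp_neighborhood_def)
  then obtain J \<gamma> where J: "open J" "is_interval J" "{0..1} \<subseteq> J" "smooth_curve M J \<gamma>" "\<gamma> 0 = p"
    "velocity M \<gamma> 0 = t *\<^sub>R \<xi> p" and ex: "\<And>s. s \<in> J \<Longrightarrow> exp_map M \<Gamma> (p, s *\<^sub>R t *\<^sub>R \<xi> p) = \<gamma> s"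
    using exp_domain_geodesic[OF M Hausdorff_M connection] by metis
  interpret c: smooth_curve M J \<gamma> by (rule J(4))
  have 0: "0 \<in> J" using J(3) by auto
  show "\<Phi> (p, 0) = p" using ex[OF 0] J(5) by (simp add: flow_map_def)
  show "((\<lambda>s. snd d (\<Phi> (p, s))) has_vector_derivative to_chart M d p (\<xi> p)) (at 0)" if d: "d \<in> M" "p \<in> fst d"
  proof -
    have "0 \<in> {s \<in> J. \<gamma> s \<in> fst d}" using 0 d J(5) by simp
    from smooth_on_has_vector_derivative[OF c.smooth_on_chart[OF d(1)] this]
    have D: "((snd d \<circ> \<gamma>) has_vector_derivative to_chart M d p (t *\<^sub>R \<xi> p)) (at (0 / t))"
      using c.to_chart_velocity[OF 0 d(1)] d(2) J(5,6) by simp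
    have "((\<lambda>s. s / t) has_real_derivative 1 / t) (at 0)" using t by (auto intro!: derivative_eq_intros)
    from vector_diff_chain_at[OF this[unfolded has_real_derivative_iff_has_vector_derivative] D]
    have "((\<lambda>s. snd d (\<gamma> (s / t))) has_vector_derivative to_chart M d p (\<xi> p)) (at 0)"
      using t linear_scale[OF linear_to_chart[OF M d]] by (simp add: comp_def)
    then show ?thesis
    proof (rule has_vector_derivative_transform_within_open[of _ _ _ "(\<lambda>s. s / t) -` J"])
      show "open ((\<lambda>s. s / t) -` J)" using t by (intro open_vimage J continuous_intros) auto
      show "snd d (\<gamma> (s / t)) = snd d (\<Phi> (p, s))" if "s \<in> (\<lambda>s. s / t) -` J" for s
        using ex[of "s / t"] that t by (simp add: flow_map_def)
    qed (use 0 in auto)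
  qed
qed

text \<open>By linearity it suffices to treat the slice at 0, on which \<open>\<Phi>\<close>
  restricts to the inclusion of \<open>S\<close>, and the generator, whose initial velocity is
  \<open>\<xi> p\<close>.\<close>

lemma drep_\<Phi>_initial:
  assumes a: "a \<in> S" "p \<in> fst a" and d: "d \<in> M" "p \<in> fst d"
  shows "drep (cyl_chart W a) d \<Phi> (p, 0) (u, r) = drep a d (\<lambda>p. p) p u + r *\<^sub>R to_chart M d p (\<xi> p)"
proof -
  let ?c = "cyl_chart W a"
  have p: "p \<in> carrier S" by (rule chart_dom_carrier[OF a])
  have c: "?c \<in> \<O>" "(p, 0) \<in> fst ?c" using a zero_in_W[OF p] by (auto simp: cylinder_def)
  have d': "\<Phi> (p, 0) \<in> fst d" using \<Phi>_initial(1)[OF p] d by simp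
  have l: "linear (drep ?c d \<Phi> (p, 0))" by (rule linear_drep[OF smooth_\<Phi> c(1) d(1) c(2) d'])
  have "drep a d (\<lambda>p. p) p u = drep a d (\<lambda>p. \<Phi> (p, 0)) p u"
    using drep_cong[OF S a openin_topspace, of "\<lambda>p. p" "\<lambda>p. \<Phi> (p, 0)" d] p \<Phi>_initial(1) by simp
  also have "\<dots> = drep ?c d \<Phi> (p, 0) (drep a ?c (\<lambda>p. (p, 0)) p u)"
    by (rule drep_compose[OF S atlas_cylinder smooth_map_slice[OF zero_in_W] smooth_\<Phi> a c d(1) d'])
  also have "\<dots> = drep ?c d \<Phi> (p, 0) (u, 0)"
    by (simp add: drep_cyl_slice[OF a a] drep_ident[OF S a])
  finally have 1: "drep ?c d \<Phi> (p, 0) (u, 0) = drep a d (\<lambda>p. p) p u" ..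
  have 2: "drep ?c d \<Phi> (p, 0) (0, 1) = to_chart M d p (\<xi> p)"
    using vector_derivative_unique_at[OF \<Phi>_vertical_derivative[OF zero_in_W[OF p] a d(1) d'] \<Phi>_initial(2)[OF p d]] .
  have "(u, r) = (u, 0) + r *\<^sub>R (0, 1)" by simp
  then show ?thesis using 1 2 linear_add[OF l, of "(u, 0)" "r *\<^sub>R (0, 1)"] linear_scale[OF l, of r "(0, 1)"]
    by simp
qed

end

section \<open>The metric along the null generators\<close>

text \<open>Expanded in the basis, the expression is a sum of products of three functions of
  \<open>s\<close>: a coefficient along the curve and one component of each vector. The three
  summands come from the product rule.\<close>

lemma metric_along_curve:
  assumes M: "atlas M" and g: "symmetric_tensor M g" and c: "c \<in> M" and xt: "x t \<in> snd c ` fst c"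
    and x: "(x has_vector_derivative x') (at t)" and u: "(u has_vector_derivative u') (at t)"
    and v: "(v has_vector_derivative v') (at t)"
  shows "((\<lambda>s. metric_in_chart M g c (x s) (u s) (v s)) has_real_derivative
    frechet_derivative (\<lambda>y. metric_in_chart M g c y (u t) (v t)) (at (x t)) x' +
    metric_in_chart M g c (x t) u' (v t) + metric_in_chart M g c (x t) (u t) v') (at t)"
proof -
  let ?m = "metric_in_chart M g c" and ?X = "snd c ` fst c"
  have X: "open ?X" using M c by (auto simp: atlas_def)
  have bil: "bilinear (?m y)" if y: "y \<in> ?X" for y
  proof -
    obtain p where "y = snd c p" "p \<in> fst c" using y by (rule imageE)
    then show ?thesis using bilinear_metric_in_chart[OF M g c, of p] by (simp only:)
  qed
  have exp: "?m y a b = (\<Sum>i\<in>Basis. \<Sum>j\<in>Basis. (a \<bullet> i) * ((b \<bullet> j) * ?m y i j))" if "y \<in> ?X" for y a b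
    using bilinear_euclidean_expand[OF bil[OF that], of a b] by (simp only: real_scaleR_def)
  have sm: "smooth_on ?X (\<lambda>y. ?m y i j)" for i j using g c by (simp add: symmetric_tensor_def)
  let ?Dm = "\<lambda>i j. frechet_derivative (\<lambda>y. ?m y i j) (at (x t))"
  have "((\<lambda>y. \<Sum>i\<in>Basis. \<Sum>j\<in>Basis. (u t \<bullet> i) * ((v t \<bullet> j) * ?m y i j)) has_derivative
     (\<lambda>w. \<Sum>i\<in>Basis. \<Sum>j\<in>Basis. (u t \<bullet> i) * ((v t \<bullet> j) * ?Dm i j w))) (at (x t))"
    by (intro has_derivative_sum has_derivative_mult_right smooth_on_has_derivative[OF sm xt])
  then have "((\<lambda>y. ?m y (u t) (v t)) has_derivative
     (\<lambda>w. \<Sum>i\<in>Basis. \<Sum>j\<in>Basis. (u t \<bullet> i) * ((v t \<bullet> j) * ?Dm i j w))) (at (x t))"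
    by (rule has_derivative_transform_within_open[OF _ X xt]) (rule exp[symmetric])
  from fun_cong[OF frechet_derivative_at[OF this]]
  have D: "frechet_derivative (\<lambda>y. ?m y (u t) (v t)) (at (x t)) x' =
      (\<Sum>i\<in>Basis. \<Sum>j\<in>Basis. (u t \<bullet> i) * ((v t \<bullet> j) * ?Dm i j x'))" by (rule sym)
  have mx: "((\<lambda>s. ?m (x s) i j) has_real_derivative ?Dm i j x') (at t)" for i j
  proof -
    have "((\<lambda>s. ?m (x s) i j) has_derivative (\<lambda>r. ?Dm i j (r *\<^sub>R x'))) (at t)"
      by (rule has_derivative_compose[where g="\<lambda>y. ?m y i j"])
         (use x smooth_on_has_derivative[OF sm xt] in \<open>auto simp: has_vector_derivative_def\<close>)
    moreover have "?Dm i j (r *\<^sub>R x') = ?Dm i j x' * r" for r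
      using linear_scale[OF smooth_on_linear_derivative[OF sm xt], of i j r x'] by simp
    ultimately show ?thesis by (simp only: has_field_derivative_def)
  qed
  have ui: "((\<lambda>s. u s \<bullet> i) has_real_derivative (u' \<bullet> i)) (at t)" for i
    using has_derivative_inner_left[OF u[unfolded has_vector_derivative_def], of i]
    by (simp add: has_field_derivative_def mult.commute[of _ "u' \<bullet> i"])
  have vi: "((\<lambda>s. v s \<bullet> i) has_real_derivative (v' \<bullet> i)) (at t)" for i
    using has_derivative_inner_left[OF v[unfolded has_vector_derivative_def], of i]
    by (simp add: has_field_derivative_def mult.commute[of _ "v' \<bullet> i"])
  have 1: "((\<lambda>s. \<Sum>i\<in>Basis. \<Sum>j\<in>Basis. (u s \<bullet> i) * ((v s \<bullet> j) * ?m (x s) i j)) has_real_derivative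
     (\<Sum>i\<in>Basis. \<Sum>j\<in>Basis. (u' \<bullet> i) * ((v t \<bullet> j) * ?m (x t) i j) +
        ((v' \<bullet> j) * ?m (x t) i j + ?Dm i j x' * (v t \<bullet> j)) * (u t \<bullet> i))) (at t)"
    by (intro DERIV_sum DERIV_mult ui vi mx)
  have "isCont x t" using x has_vector_derivative_continuous by blast
  then have "\<forall>\<^sub>F s in nhds t. x s \<in> ?X"
    using X xt by (simp add: isCont_def tendsto_at_iff_tendsto_nhds topological_tendstoD)
  then have ev: "\<forall>\<^sub>F s in nhds t. ?m (x s) (u s) (v s) = (\<Sum>i\<in>Basis. \<Sum>j\<in>Basis. (u s \<bullet> i) * ((v s \<bullet> j) * ?m (x s) i j))"
    by eventually_elim (rule exp)
  have "(\<Sum>i\<in>Basis. \<Sum>j\<in>Basis. (u' \<bullet> i) * ((v t \<bullet> j) * ?m (x t) i j) +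
        ((v' \<bullet> j) * ?m (x t) i j + ?Dm i j x' * (v t \<bullet> j)) * (u t \<bullet> i)) =
     frechet_derivative (\<lambda>y. ?m y (u t) (v t)) (at (x t)) x' + ?m (x t) u' (v t) + ?m (x t) (u t) v'"
    unfolding D exp[OF xt, of u' "v t"] exp[OF xt, of "u t" v'] sum.distrib[symmetric]
    by (intro sum.cong refl) (simp add: algebra_simps)
  then show ?thesis using 1 DERIV_cong_ev[OF refl ev refl] by simp
qed

text \<open>Metric compatibility replaces the derivative of the coefficients by Christoffel terms.
  Torsion-freeness then swaps their arguments, so that \<open>x'\<close> stands in the place of the
  differentiated field: along a generator it will be U.\<close>

lemma levi_civita_along_curve:
  assumes M: "atlas M" and g: "symmetric_tensor M g" and LC: "levi_civita M g \<Gamma>"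
    and c: "c \<in> M" and xt: "x t \<in> snd c ` fst c"
    and x: "(x has_vector_derivative x') (at t)" and u: "(u has_vector_derivative u') (at t)"
    and v: "(v has_vector_derivative v') (at t)"
  shows "((\<lambda>s. metric_in_chart M g c (x s) (u s) (v s)) has_real_derivative
    metric_in_chart M g c (x t) (u' + \<Gamma> c (x t) (u t) x') (v t) +
    metric_in_chart M g c (x t) (v' + \<Gamma> c (x t) (v t) x') (u t)) (at t)"
proof -
  let ?m = "metric_in_chart M g c (x t)"
  have bil: "bilinear ?m"
  proof -
    obtain p where "x t = snd c p" "p \<in> fst c" using xt by (rule imageE)
    then show ?thesis using bilinear_metric_in_chart[OF M g c, of p] by (simp only:)
  qed
  have sym: "?m a b = ?m b a" for a b
  proof -
    obtain p where p: "p \<in> fst c" "x t = snd c p" using xt by blast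
    show ?thesis using g chart_dom_carrier[OF c p(1)] 
      by (simp add: p(2) metric_in_chart_at[OF M c p(1)] symmetric_tensor_def)
  qed
  have "frechet_derivative (\<lambda>y. metric_in_chart M g c y (u t) (v t)) (at (x t)) x' =
      ?m (\<Gamma> c (x t) x' (u t)) (v t) + ?m (u t) (\<Gamma> c (x t) x' (v t))"
    and "\<Gamma> c (x t) x' (u t) = \<Gamma> c (x t) (u t) x'" "\<Gamma> c (x t) x' (v t) = \<Gamma> c (x t) (v t) x'"
    using LC c xt unfolding levi_civita_def by blast+
  then have "frechet_derivative (\<lambda>y. metric_in_chart M g c y (u t) (v t)) (at (x t)) x' + ?m u' (v t) + ?m (u t) v' =
    ?m (u' + \<Gamma> c (x t) (u t) x') (v t) + ?m (v' + \<Gamma> c (x t) (v t) x') (u t)"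
    using sym[of "u t"] by (simp add: bilinear_ladd[OF bil])
  then show ?thesis using metric_along_curve[OF M g c xt x u v] by simp
qed

lemma from_chart_change:
  assumes N: "atlas N" and a: "a \<in> N" "p \<in> fst a" and b: "b \<in> N" "p \<in> fst b"
  shows "from_chart N a p u = from_chart N b p (drep a b (\<lambda>p. p) p u)"
  unfolding from_chart_drep
  using drep_compose[OF N N smooth_map_id[OF N] smooth_map_id[OF N] a b chart_at_in[OF chart_dom_carrier[OF a]]] by simp

section \<open>Umbilicity as a differential equation along the generators\<close>

locale umbilical_emanation = lightlike_emanation M S g \<Gamma> \<xi> V
  for M :: "('m, 'e::euclidean_space) mfld" and S :: "('m, 'a::euclidean_space) mfld" and g \<Gamma> \<xi> V +
  fixes \<mu> :: "'m \<Rightarrow> real"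
  assumes umbilical: "totally_umbilical_with M g \<Gamma> (image_mfld \<Phi> \<O>) (push_dt \<O> (image_mfld \<Phi> \<O>) \<Phi>) \<mu>"
begin

abbreviation \<Sigma> :: "('m, 'a \<times> real) mfld" where "\<Sigma> \<equiv> image_mfld \<Phi> \<O>"
abbreviation U :: "'m \<Rightarrow> 'a \<times> real" where "U \<equiv> push_dt \<O> \<Sigma> \<Phi>"

lemma atlas_\<Sigma>: "atlas \<Sigma>"
  by (rule atlas_image_mfld[OF atlas_cylinder inj_\<Phi>])

lemma diffeomorphism_\<Phi>: "diffeomorphism \<O> \<Sigma> \<Phi>"
  by (rule diffeomorphism_image_mfld[OF atlas_cylinder inj_\<Phi>])

lemma smooth_\<Phi>_\<Sigma>: "smooth_map \<O> \<Sigma> \<Phi>"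
  and smooth_\<Phi>_inverse: "smooth_map \<Sigma> \<O> (inv_into (carrier \<O>) \<Phi>)"
  using diffeomorphism_\<Phi> by (auto simp: diffeomorphism_def)

lemma inv_\<Phi>: "z \<in> W \<Longrightarrow> inv_into (carrier \<O>) \<Phi> (\<Phi> z) = z"
  using inj_\<Phi> by (simp add: carrier_cylinder)

lemma carrier_\<Sigma>: "carrier \<Sigma> = \<Phi> ` W"
  by (simp add: carrier_image_mfld carrier_cylinder)

text \<open>On \<Sigma> the inclusion is \<open>\<Phi>\<close> after its inverse.\<close>

lemma smooth_\<Sigma>_M: "smooth_map \<Sigma> M (\<lambda>q. q)"
  by (rule smooth_map_cong[OF atlas_\<Sigma> smooth_map_compose[OF atlas_\<Sigma> atlas_cylinder M smooth_\<Phi>_inverse smooth_\<Phi>]])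
     (auto simp: carrier_\<Sigma> inv_\<Phi>)

lemma mfderiv_\<Sigma>_M:
  "z \<in> W \<Longrightarrow> mfderiv \<Sigma> M (\<lambda>q. q) (\<Phi> z) (mfderiv \<O> \<Sigma> \<Phi> z v) = mfderiv \<O> M \<Phi> z v"
  using mfderiv_compose[OF atlas_cylinder atlas_\<Sigma> smooth_\<Phi>_\<Sigma> smooth_\<Sigma>_M, of z v] by (simp add: carrier_cylinder)

lemma U_\<Phi>: "z \<in> W \<Longrightarrow> U (\<Phi> z) = mfderiv \<O> \<Sigma> \<Phi> z (0, 1)"
  using velocity_vertical[of "fst z" "snd z"] by (simp add: push_dt_def Let_def inv_\<Phi>)

lemma to_chart_vertical:
  assumes z: "(p, t) \<in> W" and a: "a \<in> S" "p \<in> fst a"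
  shows "to_chart \<O> (cyl_chart W a) (p, t) (0, r) = (0, r)"
proof -
  obtain b where b: "b \<in> S" "p \<in> fst b" "chart_at \<O> (p, t) = cyl_chart W b" using chart_at_cylinder[OF z] .
  show ?thesis
    unfolding to_chart_drep b(3) drep_cyl_cyl[OF b(1,2) a z]
    using linear_0[OF linear_drep[OF smooth_map_id[OF S] b(1) a(1) b(2) a(2)]] by simp
qed

text \<open>The covariant derivative of U on \<Sigma> is computed in the chart chosen at the point.
  Assuming for now that this chart comes from the product chart over \<open>a\<close>, everything is
  expressed by \<open>?R\<close>, its first derivatives and its second derivatives.\<close>

lemma generator_metric_derivative:
  assumes z: "(p, t) \<in> W" and a: "a \<in> S" "p \<in> fst a"
    and \<Sigma>c: "chart_at \<Sigma> (\<Phi> (p, t)) = image_chart \<Phi> \<O> (cyl_chart W a)"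
  shows "((\<lambda>s. pullback_metric \<O> M \<Phi> g (p, s) (from_chart \<O> (cyl_chart W a) (p, s) x) (from_chart \<O> (cyl_chart W a) (p, s) y))
      has_real_derivative
      - 2 * \<mu> (\<Phi> (p, t)) * pullback_metric \<O> M \<Phi> g (p, t) (from_chart \<O> (cyl_chart W a) (p, t) x) (from_chart \<O> (cyl_chart W a) (p, t) y)) (at t)"
proof -
  let ?b = "cyl_chart W a" and ?q = "\<Phi> (p, t)"
  let ?c = "chart_at M ?q" and ?i = "image_chart \<Phi> \<O> (cyl_chart W a)"
  have zO: "(p, t) \<in> carrier \<O>" using z by (simp add: carrier_cylinder)
  have b: "?b \<in> \<O>" "(p, t) \<in> fst ?b" using a z by (auto simp: cylinder_def)
  have qM: "?q \<in> carrier M" by (rule smooth_map_carrier[OF smooth_\<Phi> zO])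
  note c = chart_at_in[OF qM]
  have q\<Sigma>: "?q \<in> carrier \<Sigma>" using z by (simp add: carrier_\<Sigma>)
  \<comment> \<open>\<open>\<Phi>\<close> in coordinates; \<open>?D y v\<close> is then d\<Phi> on
    the vector with constant components \<open>v\<close>, and \<open>?D y (0, 1)\<close> is
    U.\<close>
  let ?R = "snd ?c \<circ> \<Phi> \<circ> chart_inv ?b" and ?X = "snd ?b ` {w \<in> fst ?b. \<Phi> w \<in> fst ?c}"
  let ?D = "\<lambda>y. frechet_derivative ?R (at y)" and ?y0 = "(snd a p, t)"
  have X: "open ?X" by (rule smooth_map_open_rep[OF atlas_cylinder smooth_\<Phi> b(1) openin_mtop_chart[OF c(1)]])
  have y0: "?y0 \<in> ?X" using a z c by (intro image_eqI[of _ _ "(p, t)"]) auto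
  have R: "smooth_on ?X ?R" by (rule smooth_map_smooth_rep[OF smooth_\<Phi> b(1) c(1)])
  have drep: "drep ?b ?c \<Phi> w = ?D (snd ?b w)" for w by (simp add: drep_def)
  have Rz: "?R ?y0 = snd ?c ?q" using chart_inv_cyl[OF a z] by simp
  let ?m = "metric_in_chart M g ?c (snd ?c ?q)"
  have to_c: "to_chart M ?c ?q v = v" for v unfolding to_chart_drep by (rule drep_ident[OF M c])
  have gm: "g ?q u v = ?m u v" for u v using metric_in_chart_to_chart[OF M c, of g u v] by (simp add: to_c)
  have inc: "mfderiv \<Sigma> M (\<lambda>q. q) ?q v = ?D ?y0 v" for v
    using drep_image_chart_dom[OF atlas_cylinder inj_\<Phi> b, of ?c "\<lambda>q. q"]
    by (simp add: mfderiv_drep \<Sigma>c drep)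
  \<comment> \<open>Proved on a whole neighbourhood, since U is going to be differentiated and its
    chosen components may jump from point to point.\<close>
  have Uc: "to_chart M ?c (\<Phi> w) (mfderiv \<Sigma> M (\<lambda>q. q) (\<Phi> w) (U (\<Phi> w))) = ?D (snd ?b w) (0, 1)"
    if w: "w \<in> fst ?b" "\<Phi> w \<in> fst ?c" for w
  proof -
    have wW: "(fst w, snd w) \<in> W" "fst w \<in> fst a" using w(1) by auto
    have "mfderiv \<Sigma> M (\<lambda>q. q) (\<Phi> w) (U (\<Phi> w)) = mfderiv \<O> M \<Phi> w (0, 1)"
      using wW(1) by (simp add: U_\<Phi> mfderiv_\<Sigma>_M)
    then show ?thesis
      using to_chart_mfderiv[OF atlas_cylinder M smooth_\<Phi> b(1) w(1) c(1) w(2), of "(0, 1)"]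
        to_chart_vertical[OF wW(1) a(1) wW(2), of 1] by (simp add: drep)
  qed
  have cov: "cov_deriv \<Sigma> M \<Gamma> id (\<lambda>r. mfderiv \<Sigma> M id r (U r)) ?q v =
      frechet_derivative (\<lambda>y. ?D y (0, 1)) (at ?y0) v + \<Gamma> ?c (snd ?c ?q) (?D ?y0 v) (?D ?y0 (0, 1))" for v
  proof -
    have "frechet_derivative (\<lambda>y. to_chart M ?c (chart_inv ?i y) (mfderiv \<Sigma> M (\<lambda>q. q) (chart_inv ?i y) (U (chart_inv ?i y)))) (at ?y0) =
      frechet_derivative (\<lambda>y. ?D y (0, 1)) (at ?y0)"
    proof (rule frechet_derivative_cong_open[OF X y0])
      fix y assume "y \<in> ?X"
      then obtain w where w: "w \<in> fst ?b" "\<Phi> w \<in> fst ?c" "y = snd ?b w" by blast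
      have "chart_inv ?i y = \<Phi> w"
        using chart_inv_image_chart[OF atlas_cylinder inj_\<Phi> b(1), of y] w chart_inv_chart[OF atlas_cylinder b(1) w(1)] by auto
      then show "to_chart M ?c (chart_inv ?i y) (mfderiv \<Sigma> M (\<lambda>q. q) (chart_inv ?i y) (U (chart_inv ?i y))) = ?D y (0, 1)"
        using Uc[OF w(1,2)] w(3) by (simp only:)
    qed
    moreover have "snd ?i ?q = ?y0" using image_chart_apply[OF atlas_cylinder inj_\<Phi> b(1) zO] by simp
    moreover have "mfderiv \<Sigma> M (\<lambda>q. q) ?q (U ?q) = ?D ?y0 (0, 1)"
      using Uc[OF b(2) c(2)] by (simp add: to_c)
    ultimately show ?thesis
      unfolding cov_deriv_def Let_def id_def \<Sigma>c by (simp only: inc)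
  qed
  \<comment> \<open>The minus sign is that in the definition of the null second fundamental form.
    One such term for each argument of the metric makes the coefficient -2\<mu>.\<close>
  have umb: "?m (frechet_derivative (\<lambda>y. ?D y (0, 1)) (at ?y0) u + \<Gamma> ?c (snd ?c ?q) (?D ?y0 u) (?D ?y0 (0, 1))) (?D ?y0 v) =
      - \<mu> ?q * ?m (?D ?y0 u) (?D ?y0 v)" for u v
  proof -
    have "null_second_fundamental_form M g \<Gamma> \<Sigma> U ?q u v = \<mu> ?q * induced_metric \<Sigma> M g ?q u v"
      using umbilical q\<Sigma> unfolding totally_umbilical_with_def by blast
    then show ?thesis
      using inc unfolding null_second_fundamental_form_def cov induced_metric_def pullback_metric_def
      by (simp add: id_def gm)
  qed
  let ?x = "\<lambda>s. ?R (snd a p, s)"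
  have curve: "((\<lambda>s. (snd a p, s)) has_derivative (\<lambda>r. (0, r))) (at t)" by (auto intro!: derivative_eq_intros)
  have curve_deriv: "((\<lambda>s. f (snd a p, s)) has_vector_derivative frechet_derivative f (at ?y0) (0, 1)) (at t)"
    if f: "smooth_on ?X f" for f :: "'a \<times> real \<Rightarrow> 'e"
  proof -
    have "((\<lambda>s. f (snd a p, s)) has_derivative (\<lambda>r. frechet_derivative f (at ?y0) (0, r))) (at t)"
      by (rule has_derivative_compose[OF curve smooth_on_has_derivative[OF f y0]])
    moreover have "frechet_derivative f (at ?y0) (0, r) = r *\<^sub>R frechet_derivative f (at ?y0) (0, 1)" for r
      using linear_scale[OF smooth_on_linear_derivative[OF f y0], of r "(0, 1)"] by simp
    then have "(\<lambda>r. frechet_derivative f (at ?y0) (0, r)) = (\<lambda>r. r *\<^sub>R frechet_derivative f (at ?y0) (0, 1))" by (rule ext)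
    ultimately show ?thesis unfolding has_vector_derivative_def by (simp only:)
  qed
  \<comment> \<open>The change of d\<Phi>(v) along the generator is the change of U in direction
    \<open>v\<close>; this is the point at which the evolution of the metric meets
    umbilicity.\<close>
  have swap: "frechet_derivative (\<lambda>y. ?D y v) (at ?y0) (0, 1) = frechet_derivative (\<lambda>y. ?D y (0, 1)) (at ?y0) v" for v
    by (rule second_derivative_symmetric[OF R X y0])
  have xt: "?x t \<in> snd ?c ` fst ?c" using Rz c by simp
  have "((\<lambda>s. metric_in_chart M g ?c (?x s) (?D (snd a p, s) x) (?D (snd a p, s) y)) has_real_derivative
     metric_in_chart M g ?c (?x t) (frechet_derivative (\<lambda>y. ?D y x) (at ?y0) (0, 1) + \<Gamma> ?c (?x t) (?D ?y0 x) (?D ?y0 (0, 1))) (?D ?y0 y) +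
     metric_in_chart M g ?c (?x t) (frechet_derivative (\<lambda>z. ?D z y) (at ?y0) (0, 1) + \<Gamma> ?c (?x t) (?D ?y0 y) (?D ?y0 (0, 1))) (?D ?y0 x)) (at t)"
    by (rule levi_civita_along_curve[OF M symmetric_g LC c(1) xt curve_deriv[OF R]
          curve_deriv[OF smooth_on_frechet_derivative[OF R]] curve_deriv[OF smooth_on_frechet_derivative[OF R]]])
  then have D: "((\<lambda>s. metric_in_chart M g ?c (?x s) (?D (snd a p, s) x) (?D (snd a p, s) y)) has_real_derivative
     - \<mu> ?q * ?m (?D ?y0 x) (?D ?y0 y) + - \<mu> ?q * ?m (?D ?y0 y) (?D ?y0 x)) (at t)"
    unfolding swap Rz umb .
  have symm: "?m u v = ?m v u" for u v
    using symmetric_g qM by (simp add: gm[symmetric] symmetric_tensor_def)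
  have pb: "pullback_metric \<O> M \<Phi> g (p, s) (from_chart \<O> ?b (p, s) x) (from_chart \<O> ?b (p, s) y) =
    metric_in_chart M g ?c (?x s) (?D (snd a p, s) x) (?D (snd a p, s) y)"
    if s: "(p, s) \<in> W" "\<Phi> (p, s) \<in> fst ?c" for s
  proof -
    have "(p, s) \<in> fst ?b" using s a by simp
    from pullback_metric_drep[OF atlas_cylinder M smooth_\<Phi> b(1) this c(1) s(2), of g x y] show ?thesis
      using chart_inv_cyl[OF a s(1)] by (simp add: drep)
  qed
  have T: "open ((\<lambda>s. (snd a p, s)) -` ?X)" by (intro open_vimage X continuous_intros)
  have Ts: "(p, s) \<in> W \<and> \<Phi> (p, s) \<in> fst ?c" if sX: "s \<in> (\<lambda>s. (snd a p, s)) -` ?X" for s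
  proof -
    have "(snd a p, s) \<in> ?X" using sX by (rule vimageD)
    then obtain w where w: "(snd a p, s) = snd ?b w" "w \<in> {w \<in> fst ?b. \<Phi> w \<in> fst ?c}" by (rule imageE)
    obtain p' s' where w': "w = (p', s')" by (cases w)
    have p': "p' \<in> fst a" "(p', s') \<in> W" "\<Phi> (p', s') \<in> fst ?c" "snd a p = snd a p'" "s = s'"
      using w by (simp_all add: w')
    have "p = p'" using chart_inv_chart[OF S a] chart_inv_chart[OF S a(1) p'(1)] unfolding p'(4) by (rule trans[OF sym])
    then show ?thesis using p' by (simp only:)
  qed
  have t: "t \<in> (\<lambda>s. (snd a p, s)) -` ?X" using y0 by (rule vimageI2)
  have "((\<lambda>s. pullback_metric \<O> M \<Phi> g (p, s) (from_chart \<O> ?b (p, s) x) (from_chart \<O> ?b (p, s) y)) has_real_derivative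
     - \<mu> ?q * ?m (?D ?y0 x) (?D ?y0 y) + - \<mu> ?q * ?m (?D ?y0 y) (?D ?y0 x)) (at t)"
    by (rule has_field_derivative_transform_within_open[OF D T t]) (use pb Ts in simp)
  moreover have "- \<mu> ?q * ?m (?D ?y0 x) (?D ?y0 y) + - \<mu> ?q * ?m (?D ?y0 y) (?D ?y0 x) =
    - 2 * \<mu> ?q * pullback_metric \<O> M \<Phi> g (p, t) (from_chart \<O> ?b (p, t) x) (from_chart \<O> ?b (p, t) y)"
    using pb[OF z c(2)] Rz symm[of "?D ?y0 y"] by simp
  ultimately show ?thesis by (simp only:)
qed

end

lemma atlas_real_line: "atlas real_line"
proof -
  have "open_sub real_line UNIV = real_line" unfolding open_sub_real_line by (simp only: real_line_def)
  then show ?thesis using atlas_open_sub_real_line[OF open_UNIV] by simp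
qed

context umbilical_emanation
begin

text \<open>Removes the assumption on the chosen chart. That chart comes from some product chart
  over \<open>b\<close>, possibly another one for each \<open>t\<close>, but the change from
  \<open>a\<close> to \<open>b\<close> takes components constant along the generator to components
  constant along it.\<close>

lemma pullback_metric_ode:
  assumes z: "(p, t) \<in> W" and a: "a \<in> S" "p \<in> fst a"
  shows "((\<lambda>s. pullback_metric \<O> M \<Phi> g (p, s) (from_chart \<O> (cyl_chart W a) (p, s) x) (from_chart \<O> (cyl_chart W a) (p, s) y))
      has_real_derivative
      - 2 * \<mu> (\<Phi> (p, t)) * pullback_metric \<O> M \<Phi> g (p, t) (from_chart \<O> (cyl_chart W a) (p, t) x) (from_chart \<O> (cyl_chart W a) (p, t) y)) (at t)"
proof -
  have zO: "(p, t) \<in> carrier \<O>" using z by (simp add: carrier_cylinder)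
  have q: "\<Phi> (p, t) \<in> carrier \<Sigma>" using z by (simp add: carrier_\<Sigma>)
  obtain k where k: "k \<in> \<O>" "chart_at \<Sigma> (\<Phi> (p, t)) = image_chart \<Phi> \<O> k"
    using chart_at_in(1)[OF q] by (auto simp: image_mfld_eq)
  then obtain b where b: "b \<in> S" "k = cyl_chart W b" by (auto simp: cylinder_def)
  have "(p, t) \<in> fst k"
    using chart_at_in(2)[OF q] image_chart_mem[OF atlas_cylinder inj_\<Phi> k(1) zO] unfolding k(2) by blast
  then have pb: "p \<in> fst b" by (simp add: b(2))
  let ?c = "\<lambda>x. (drep a b (\<lambda>p. p) p (fst x), snd x)"
  have change: "from_chart \<O> (cyl_chart W a) (p, s) x = from_chart \<O> (cyl_chart W b) (p, s) (?c x)"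
    if "(p, s) \<in> W" for s x
    using from_chart_change[OF atlas_cylinder, of "cyl_chart W a" "(p, s)" "cyl_chart W b" x] a b pb that
      drep_cyl_cyl[OF a b(1) pb that] by (simp add: cylinder_def)
  have D: "((\<lambda>s. pullback_metric \<O> M \<Phi> g (p, s) (from_chart \<O> (cyl_chart W b) (p, s) (?c x)) (from_chart \<O> (cyl_chart W b) (p, s) (?c y)))
      has_real_derivative
      - 2 * \<mu> (\<Phi> (p, t)) * pullback_metric \<O> M \<Phi> g (p, t) (from_chart \<O> (cyl_chart W b) (p, t) (?c x)) (from_chart \<O> (cyl_chart W b) (p, t) (?c y))) (at t)"
    by (rule generator_metric_derivative[OF z b(1) pb]) (simp add: k(2) b(2))
  show ?thesis
    unfolding change[OF z]
    by (rule has_field_derivative_transform_within_open[OF D open_fiber[of p]]) (use z change in auto)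
qed

lemma continuous_\<mu>: "continuous_on {s. (p, s) \<in> W} (\<lambda>s. \<mu> (\<Phi> (p, s)))"
proof (cases "p \<in> carrier S")
  case True
  then obtain a where a: "a \<in> S" "p \<in> fst a" by (auto simp: carrier_def)
  let ?b = "cyl_chart W a"
  have b: "?b \<in> \<O>" using a by (simp add: cylinder_def)
  have "smooth_map \<Sigma> real_line \<mu>" using umbilical by (simp add: totally_umbilical_with_def)
  then have sm: "smooth_map \<O> real_line (\<lambda>z. \<mu> (\<Phi> z))"
    by (rule smooth_map_compose[OF atlas_cylinder atlas_\<Sigma> atlas_real_line smooth_\<Phi>_\<Sigma>])
  have eq: "{w \<in> fst ?b. \<mu> (\<Phi> w) \<in> fst (UNIV, id)} = fst ?b" by auto
  have "(UNIV, id) \<in> real_line" by (simp add: real_line_def)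
  from smooth_map_smooth_rep[OF sm b this, unfolded eq]
  have "smooth_on (snd ?b ` fst ?b) ((\<lambda>z. \<mu> (\<Phi> z)) \<circ> chart_inv ?b)" by simp
  then have "continuous_on (snd ?b ` fst ?b) ((\<lambda>z. \<mu> (\<Phi> z)) \<circ> chart_inv ?b)" by (rule smooth_on_continuous)
  then have "continuous_on {s. (p, s) \<in> W} (\<lambda>s. ((\<lambda>z. \<mu> (\<Phi> z)) \<circ> chart_inv ?b) (snd a p, s))"
    by (rule continuous_on_compose2) (use a in \<open>auto intro!: continuous_intros image_eqI[of _ _ "(p, _)"]\<close>)
  then show ?thesis
    by (rule continuous_on_eq) (use chart_inv_cyl[OF a] in auto)
next
  case False
  then have "{s. (p, s) \<in> W} = {}" by (auto simp: W_iff)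
  then show ?thesis by (simp only: continuous_on_empty)
qed

text \<open>Star-shapedness of \<open>V\<close> with factor s/t; the bounds by min and max cover
  negative \<open>t\<close> as well.\<close>

lemma segment_in_W:
  assumes z: "(p, t) \<in> W" and s: "s \<in> {min 0 t..max 0 t}" shows "(p, s) \<in> W"
proof (cases "t = 0")
  case False
  then have "0 \<le> s / t" "s / t \<le> 1" "s / t * t = s"
    using s by (auto simp: min_def max_def divide_simps split: if_splits)
  then show ?thesis using W_star[OF z, of "s / t"] by simp
qed (use z s in simp)

text \<open>Integrating factor: the metric coefficient times exp of twice the integral of \<mu> has
  derivative 0 on the segment between 0 and \<open>t\<close>. The integral is oriented, so both
  signs of \<open>t\<close> are treated together.\<close>

lemma pullback_metric_solution:
  assumes z: "(p, t) \<in> W" and a: "a \<in> S" "p \<in> fst a"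
  shows "pullback_metric \<O> M \<Phi> g (p, t) (from_chart \<O> (cyl_chart W a) (p, t) x) (from_chart \<O> (cyl_chart W a) (p, t) y) =
    exp (- 2 * (LBINT s=0..t. \<mu> (\<Phi> (p, s)))) *
    pullback_metric \<O> M \<Phi> g (p, 0) (from_chart \<O> (cyl_chart W a) (p, 0) x) (from_chart \<O> (cyl_chart W a) (p, 0) y)"
proof -
  let ?H = "\<lambda>s. pullback_metric \<O> M \<Phi> g (p, s) (from_chart \<O> (cyl_chart W a) (p, s) x) (from_chart \<O> (cyl_chart W a) (p, s) y)"
  let ?k = "\<lambda>s::real. LBINT r=0..s. \<mu> (\<Phi> (p, r))"
  let ?I = "{min 0 t..max 0 t}"
  have cont: "continuous_on ?I (\<lambda>s. \<mu> (\<Phi> (p, s)))"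
    by (rule continuous_on_subset[OF continuous_\<mu>]) (use segment_in_W[OF z] in auto)
  have k: "(?k has_real_derivative \<mu> (\<Phi> (p, s))) (at s within ?I)" if s: "s \<in> ?I" for s
    using interval_integral_FTC2[of "min 0 t" 0 "max 0 t", OF _ _ cont, of s] s
    by (simp add: has_real_derivative_iff_has_vector_derivative zero_ereal_def)
  have "((\<lambda>s. ?H s * exp (2 * ?k s)) has_real_derivative 0) (at s within ?I)" if s: "s \<in> ?I" for s
  proof -
    note H = has_field_derivative_at_within[OF pullback_metric_ode[OF segment_in_W[OF z s] a, of x y], of ?I]
    have "((\<lambda>s. exp (2 * ?k s)) has_real_derivative exp (2 * ?k s) * (2 * \<mu> (\<Phi> (p, s)))) (at s within ?I)"
      using k[OF s] by (auto intro!: derivative_eq_intros)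
    from DERIV_mult[OF H this] show ?thesis by (simp add: algebra_simps)
  qed
  then have "\<exists>c. \<forall>s\<in>?I. ?H s * exp (2 * ?k s) = c"
    by (intro has_field_derivative_zero_constant) auto
  moreover have "0 \<in> ?I" "t \<in> ?I" by auto
  ultimately have "?H t * exp (2 * ?k t) = ?H 0 * exp (2 * ?k 0)" by metis
  moreover have "?k 0 = 0" by (simp add: zero_ereal_def[symmetric])
  ultimately have "?H t * exp (2 * ?k t) = ?H 0" by simp
  then have "?H t = ?H 0 * inverse (exp (2 * ?k t))" by (simp add: field_simps)
  then show ?thesis by (simp add: exp_minus mult.commute)
qed

lemma initial_metric:
  assumes a: "a \<in> S" "p \<in> fst a"
  shows "pullback_metric \<O> M \<Phi> g (p, 0) (from_chart \<O> (cyl_chart W a) (p, 0) x) (from_chart \<O> (cyl_chart W a) (p, 0) y) =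
    pullback_metric S M (\<lambda>p. p) g p (from_chart S a p (fst x)) (from_chart S a p (fst y))"
proof -
  have p: "p \<in> carrier S" by (rule chart_dom_carrier[OF a])
  have pM: "p \<in> carrier M" by (rule S_subset[OF p])
  let ?d = "chart_at M p" and ?c = "cyl_chart W a"
  note d = chart_at_in[OF pM]
  have c: "?c \<in> \<O>" "(p, 0) \<in> fst ?c" using a zero_in_W[OF p] by (auto simp: cylinder_def)
  have d': "\<Phi> (p, 0) \<in> fst ?d" using \<Phi>_initial(1)[OF p] d by simp
  let ?A = "\<lambda>x. mfderiv S M (\<lambda>p. p) p (from_chart S a p (fst x))"
  have l: "linear (to_chart M ?d p)" by (rule linear_to_chart[OF M d])
  have drep: "drep ?c ?d \<Phi> (p, 0) x = to_chart M ?d p (?A x + snd x *\<^sub>R \<xi> p)" for x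
    using drep_\<Phi>_initial[OF a d, of "fst x" "snd x"]
      to_chart_mfderiv_from_chart[OF S M smooth_inclusion a d, of "fst x"]
    by (simp add: linear_add[OF l] linear_scale[OF l])
  have bil: "bilinear (g p)" and sym: "\<And>u v. g p u v = g p v u"
    using symmetric_g pM by (auto simp: symmetric_tensor_def)
  have orth: "g p (\<xi> p) (mfderiv S M (\<lambda>p. p) p w) = 0" for w
    using \<xi>_normal[OF p, of 1] by (simp add: normal_space_def id_def)
  then have orth': "g p (mfderiv S M (\<lambda>p. p) p w) (\<xi> p) = 0" for w using sym by metis
  have null: "g p (\<xi> p) (\<xi> p) = 0" using \<xi> p by (simp add: lightlike_normal_field_def)
  have "pullback_metric \<O> M \<Phi> g (p, 0) (from_chart \<O> ?c (p, 0) x) (from_chart \<O> ?c (p, 0) y) =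
     metric_in_chart M g ?d (snd ?d p) (to_chart M ?d p (?A x + snd x *\<^sub>R \<xi> p)) (to_chart M ?d p (?A y + snd y *\<^sub>R \<xi> p))"
    using pullback_metric_drep[OF atlas_cylinder M smooth_\<Phi> c d(1) d', of g x y]
    by (simp add: drep \<Phi>_initial(1)[OF p])
  also have "\<dots> = g p (?A x + snd x *\<^sub>R \<xi> p) (?A y + snd y *\<^sub>R \<xi> p)"
    by (rule metric_in_chart_to_chart[OF M d, symmetric])
  also have "\<dots> = g p (?A x) (?A y)"
    by (simp add: orth orth' null bilinear_ladd[OF bil] bilinear_radd[OF bil] bilinear_lmul[OF bil] bilinear_rmul[OF bil])
  finally show ?thesis by (simp add: pullback_metric_def)
qed

lemma mfderiv_fst_cyl:
  assumes z: "(p, t) \<in> W" and a: "a \<in> S" "p \<in> fst a"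
  shows "mfderiv \<O> S fst (p, t) (from_chart \<O> (cyl_chart W a) (p, t) x) = from_chart S a p (fst x)"
proof -
  have c: "cyl_chart W a \<in> \<O>" "(p, t) \<in> fst (cyl_chart W a)" using a z by (auto simp: cylinder_def)
  have "to_chart S a p (mfderiv \<O> S fst (p, t) (from_chart \<O> (cyl_chart W a) (p, t) x)) = fst x"
    using to_chart_mfderiv_from_chart[OF atlas_cylinder S smooth_map_cylinder_fst c a(1), of x] a(2)
    by (simp add: drep_cyl_fst[OF a a z] drep_ident[OF S a])
  then show ?thesis using from_to_chart(1)[OF S a] by metis
qed

lemma pullback_metric_conformal:
  assumes z: "(p, t) \<in> W"
  shows "pullback_metric \<O> M \<Phi> g (p, t) x y = exp (- 2 * (LBINT s=0..t. \<mu> (\<Phi> (p, s)))) *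
    pullback_metric S M (\<lambda>p. p) g p (mfderiv \<O> S fst (p, t) x) (mfderiv \<O> S fst (p, t) y)"
proof -
  have "p \<in> carrier S" using z by (simp add: W_iff)
  then obtain a where a: "a \<in> S" "p \<in> fst a" by (auto simp: carrier_def)
  have c: "cyl_chart W a \<in> \<O>" "(p, t) \<in> fst (cyl_chart W a)" using a z by (auto simp: cylinder_def)
  \<comment> \<open>Every vector at the point has components in the product chart, so the formula
    for constant components covers arbitrary \<open>x\<close> and \<open>y\<close>.\<close>
  have e: "from_chart \<O> (cyl_chart W a) (p, t) (to_chart \<O> (cyl_chart W a) (p, t) v) = v" for v
    by (rule from_to_chart(1)[OF atlas_cylinder c])
  show ?thesis
    using pullback_metric_solution[OF z a, of "to_chart \<O> (cyl_chart W a) (p, t) x" "to_chart \<O> (cyl_chart W a) (p, t) y"]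
      initial_metric[OF a] mfderiv_fst_cyl[OF z a, of "to_chart \<O> (cyl_chart W a) (p, t) x"]
      mfderiv_fst_cyl[OF z a, of "to_chart \<O> (cyl_chart W a) (p, t) y"]
    by (simp only: e)
qed

section \<open>The conformal formula on the hypersurface\<close>

abbreviation F :: "'m \<Rightarrow> 'm" where "F \<equiv> fst \<circ> inv_into (carrier \<O>) \<Phi>"

lemma F_\<Phi>: "(p, t) \<in> W \<Longrightarrow> F (\<Phi> (p, t)) = p"
  by (simp add: inv_\<Phi>)

lemma smooth_F: "smooth_map \<Sigma> S F"
  using smooth_map_compose[OF atlas_\<Sigma> atlas_cylinder S smooth_\<Phi>_inverse smooth_map_cylinder_fst] by (simp add: comp_def)

lemma mfderiv_F: "z \<in> W \<Longrightarrow> mfderiv \<Sigma> S F (\<Phi> z) (mfderiv \<O> \<Sigma> \<Phi> z v) = mfderiv \<O> S fst z v"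
proof -
  assume z: "z \<in> W"
  then have zO: "z \<in> carrier \<O>" by (simp add: carrier_cylinder)
  have "mfderiv \<O> S (\<lambda>z. F (\<Phi> z)) z = mfderiv \<O> S fst z"
    by (rule mfderiv_cong[OF atlas_cylinder zO], drule carrier_cylinder[THEN equalityD1, THEN subsetD])
       (simp add: inv_\<Phi>)
  then show ?thesis using mfderiv_compose[OF atlas_cylinder atlas_\<Sigma> smooth_\<Phi>_\<Sigma> smooth_F zO, of v] by simp
qed

definition \<Omega> :: "'m \<Rightarrow> real"
  where "\<Omega> q = (let z = inv_into (carrier \<O>) \<Phi> q in exp (- 2 * (LBINT s=0..snd z. \<mu> (\<Phi> (fst z, s)))))"

lemma \<Omega>_\<Phi>: "(p, t) \<in> W \<Longrightarrow> \<Omega> (\<Phi> (p, t)) = exp (- 2 * (LBINT s=0..t. \<mu> (\<Phi> (p, s))))"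
  by (simp add: \<Omega>_def inv_\<Phi>)

lemma \<Omega>_pos: "\<Omega> q > 0"
  by (simp add: \<Omega>_def Let_def)

text \<open>d\<Phi> is onto the tangent space of \<Sigma>, and it intertwines the differential of F
  with that of the projection, so the formula on the cylinder carries over.\<close>

lemma induced_metric_conformal:
  assumes q: "q \<in> carrier \<Sigma>"
  shows "induced_metric \<Sigma> M g q x y =
    \<Omega> q * induced_metric S M g (F q) (mfderiv \<Sigma> S F q x) (mfderiv \<Sigma> S F q y)"
proof -
  obtain p t where z: "(p, t) \<in> W" "q = \<Phi> (p, t)" using q by (auto simp: carrier_\<Sigma>)
  have zO: "(p, t) \<in> carrier \<O>" using z by (simp add: carrier_cylinder)
  obtain x' y' where xy: "x = mfderiv \<O> \<Sigma> \<Phi> (p, t) x'" "y = mfderiv \<O> \<Sigma> \<Phi> (p, t) y'"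
    using mfderiv_diffeomorphism_inverse(2)[OF atlas_cylinder atlas_\<Sigma> diffeomorphism_\<Phi> zO] by metis
  have "induced_metric \<Sigma> M g q x y = pullback_metric \<O> M \<Phi> g (p, t) x' y'"
    using mfderiv_\<Sigma>_M[OF z(1)] by (simp add: induced_metric_def pullback_metric_def id_def xy z(2))
  then show ?thesis
    using pullback_metric_conformal[OF z(1), of x' y']
    unfolding xy z(2) mfderiv_F[OF z(1)] \<Omega>_\<Phi>[OF z(1)] F_\<Phi>[OF z(1)] induced_metric_def id_def by (simp only:)
qed

end

section \<open>Leaves of the screen distribution\<close>

lemma diffeomorphism_cong:
  assumes "atlas N" "diffeomorphism N M h" and eq: "\<And>p. p \<in> carrier N \<Longrightarrow> f p = h p"
  shows "diffeomorphism N M f"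
proof -
  have "(\<lambda>y. y \<in> carrier N \<and> f y = x) = (\<lambda>y. y \<in> carrier N \<and> h y = x)" for x using eq by auto
  then have "inv_into (carrier N) f = inv_into (carrier N) h"
    unfolding inv_into_def by (simp only:)
  then show ?thesis
    using assms smooth_map_cong[OF assms(1) _ eq, of M] bij_betw_cong[of "carrier N" f h "carrier M"]
    by (simp add: diffeomorphism_def)
qed

text \<open>In a chart, \<rho> is the quotient of the coefficients of \<open>k\<close> and
  \<open>h\<close> on one basis vector, with positive denominator. No regularity of \<rho> has to be
  put in, in particular none of integrals depending on a parameter.\<close>

lemma conformal_factor_smooth:
  fixes L :: "('m, 'a::euclidean_space) mfld"
  assumes L: "atlas L" and h: "riemannian_metric L h" and k: "symmetric_tensor L k"
    and eq: "\<And>q u v. q \<in> carrier L \<Longrightarrow> k q u v = \<rho> q * h q u v"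
  shows "smooth_map L real_line \<rho>"
proof (rule smooth_mapI[OF L atlas_real_line])
  fix q assume q: "q \<in> carrier L"
  then obtain a where a: "a \<in> L" "q \<in> fst a" by (auto simp: carrier_def)
  let ?X = "snd a ` fst a"
  have X: "open ?X" using L a by (auto simp: atlas_def)
  obtain u :: 'a where u: "u \<in> Basis" using nonempty_Basis by blast
  let ?h = "\<lambda>x. metric_in_chart L h a x u u" and ?k = "\<lambda>x. metric_in_chart L k a x u u"
  have hs: "symmetric_tensor L h" using h by (simp add: riemannian_metric_def)
  have val: "?h (snd a p) > 0 \<and> ?k (snd a p) = \<rho> p * ?h (snd a p)" if p: "p \<in> fst a" for p
  proof -
    have pL: "p \<in> carrier L" by (rule chart_dom_carrier[OF a(1) p])
    have l: "linear (from_chart L a p)" by (rule linear_from_chart[OF L a(1) p])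
    have "from_chart L a p u \<noteq> 0"
      using from_to_chart(2)[OF L a(1) p, of u] linear_0[OF linear_to_chart[OF L a(1) p]] u by force
    then show ?thesis
      using h pL eq[OF pL] by (simp add: metric_in_chart_at[OF L a(1) p] riemannian_metric_def)
  qed
  have "smooth_on ?X ?h" "smooth_on ?X ?k"
    using hs k a(1) by (simp_all add: symmetric_tensor_def)
  then have "smooth_on ?X (\<lambda>x. ?k x / ?h x)"
    by (intro smooth_on_divide[OF X]) (use val in force)+
  then have "smooth_on ?X (snd (UNIV, id) \<circ> \<rho> \<circ> chart_inv a)"
  proof (rule smooth_on_cong[OF X, rotated])
    fix x assume "x \<in> ?X"
    then obtain p where p: "x = snd a p" "p \<in> fst a" by (rule imageE)
    then show "(snd (UNIV, id) \<circ> \<rho> \<circ> chart_inv a) x = ?k x / ?h x"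
      using val[OF p(2)] chart_inv_chart[OF L a(1) p(2)] by simp
  qed
  then show "\<exists>a\<in>L. \<exists>c\<in>real_line. \<exists>X. q \<in> fst a \<and> open X \<and> snd a q \<in> X \<and> X \<subseteq> snd a ` fst a \<and>
      \<rho> ` chart_inv a ` X \<subseteq> fst c \<and> smooth_on X (snd c \<circ> \<rho> \<circ> chart_inv a)"
    using a X by (intro bexI[of _ a] bexI[of _ "(UNIV, id)"] exI[of _ ?X]) (auto simp: real_line_def)
qed

lemma mfderiv_diffeomorphism_eq_0:
  assumes "atlas N" "atlas M" "diffeomorphism N M f" "p \<in> carrier N" "mfderiv N M f p v = 0"
  shows "v = 0"
proof -
  have s: "smooth_map N M f" "smooth_map M N (inv_into (carrier N) f)" using assms(3) by (auto simp: diffeomorphism_def)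
  have "linear (mfderiv M N (inv_into (carrier N) f) (f p))"
    by (rule linear_mfderiv[OF s(2) smooth_map_carrier[OF s(1) assms(4)]])
  then show ?thesis
    using mfderiv_diffeomorphism_inverse(1)[OF assms(1-4), of v] assms(5) linear_0 by metis
qed

section \<open>Sections of F and integral manifolds of the screen distribution\<close>

context umbilical_emanation
begin

abbreviation Scr :: "'m \<Rightarrow> ('a \<times> real) set" where "Scr \<equiv> screen_distribution S \<O> \<Sigma> \<Phi>"

lemma Scr_\<Phi>: "(p, t) \<in> W \<Longrightarrow> Scr (\<Phi> (p, t)) = mfderiv \<O> \<Sigma> \<Phi> (p, t) ` (UNIV \<times> {0})"
  by (simp add: screen_distribution_def Let_def inv_\<Phi> range_mfderiv_slice)

lemma section_metric:
  assumes L: "atlas L" and i: "smooth_map L \<Sigma> (\<lambda>q. q)" and q: "q \<in> carrier L"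
  shows "induced_metric L M g q u v = \<Omega> q * induced_metric S M g (F q) (mfderiv L S F q u) (mfderiv L S F q v)"
proof -
  have q\<Sigma>: "q \<in> carrier \<Sigma>" by (rule smooth_map_carrier[OF i q])
  have 1: "mfderiv L M (\<lambda>q. q) q w = mfderiv \<Sigma> M (\<lambda>q. q) q (mfderiv L \<Sigma> (\<lambda>q. q) q w)" for w
    by (rule mfderiv_compose[OF L atlas_\<Sigma> i smooth_\<Sigma>_M q])
  have 2: "mfderiv L S F q w = mfderiv \<Sigma> S F q (mfderiv L \<Sigma> (\<lambda>q. q) q w)" for w
    using mfderiv_compose[OF L atlas_\<Sigma> i smooth_F q, of w] .
  have "induced_metric L M g q u v = induced_metric \<Sigma> M g q (mfderiv L \<Sigma> (\<lambda>q. q) q u) (mfderiv L \<Sigma> (\<lambda>q. q) q v)"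
    by (simp only: induced_metric_def pullback_metric_def id_def 1)
  then show ?thesis
    by (simp only: induced_metric_conformal[OF q\<Sigma>] 2)
qed

text \<open>Positivity is that of the metric of \<open>S\<close>: \<Omega> is positive and the
  differential of a diffeomorphism kills no nonzero vector.\<close>

lemma section_riemannian:
  assumes riem: "riemannian_metric S (induced_metric S M g)"
    and L: "atlas L" and i: "smooth_map L \<Sigma> (\<lambda>q. q)" and F: "diffeomorphism L S F"
  shows "riemannian_metric L (induced_metric L M g)"
proof -
  have "smooth_map L M (\<lambda>q. q)" by (rule smooth_map_compose[OF L atlas_\<Sigma> M i smooth_\<Sigma>_M])
  then have "symmetric_tensor L (induced_metric L M g)"
    using symmetric_tensor_pullback[OF L M _ symmetric_g] by (simp add: induced_metric_def id_def)
  moreover have "induced_metric L M g q v v > 0" if q: "q \<in> carrier L" and v: "v \<noteq> 0" for q v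
  proof -
    have "F q \<in> carrier S"
      using smooth_map_carrier[of L S F q] F q by (simp add: diffeomorphism_def)
    moreover have "mfderiv L S F q v \<noteq> 0" using mfderiv_diffeomorphism_eq_0[OF L S F q] v by blast
    ultimately have "induced_metric S M g (F q) (mfderiv L S F q v) (mfderiv L S F q v) > 0"
      using riem by (simp add: riemannian_metric_def)
    then show ?thesis using section_metric[OF L i q] \<Omega>_pos by simp
  qed
  ultimately show ?thesis by (simp add: riemannian_metric_def)
qed

text \<open>The comparison map covers the identity of \<open>S\<close>, so both metrics are
  multiples of the same pullback from \<open>S\<close> and differ by the quotient of the two values
  of \<Omega>.\<close>

lemma sections_conformal:
  assumes riem: "riemannian_metric S (induced_metric S M g)"
    and L: "atlas L" and i: "smooth_map L \<Sigma> (\<lambda>q. q)" and F: "diffeomorphism L S F"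
    and L': "atlas L'" and i': "smooth_map L' \<Sigma> (\<lambda>q. q)" and F': "diffeomorphism L' S F"
  shows "conformal_map L (induced_metric L M g) L' (induced_metric L' M g) (inv_into (carrier L') F \<circ> F)"
    and "globally_conformally_related L (induced_metric L M g) L' (induced_metric L' M g)"
proof -
  let ?G = "inv_into (carrier L') F \<circ> F"
  have G: "diffeomorphism L L' ?G"
    by (rule diffeomorphism_compose[OF L S L' F diffeomorphism_inverse[OF L' F']])
  have sG: "smooth_map L L' ?G" and sF': "smooth_map L' S F" using G F' by (auto simp: diffeomorphism_def)
  have h: "riemannian_metric L (induced_metric L M g)" by (rule section_riemannian[OF riem L i F])
  have h': "riemannian_metric L' (induced_metric L' M g)" by (rule section_riemannian[OF riem L' i' F'])
  let ?\<rho> = "\<lambda>q. \<Omega> (?G q) / \<Omega> q"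
  have FG: "F (?G q) = F q" if q: "q \<in> carrier L" for q
  proof -
    have "F q \<in> F ` carrier L'"
      using F F' q by (auto simp: diffeomorphism_def bij_betw_def)
    from f_inv_into_f[OF this] show ?thesis by (simp only: o_apply)
  qed
  have pb: "pullback_metric L L' ?G (induced_metric L' M g) q u v = ?\<rho> q * induced_metric L M g q u v"
    if q: "q \<in> carrier L" for q u v
  proof -
    have "mfderiv L' S F (?G q) (mfderiv L L' ?G q w) = mfderiv L S F q w" for w
      using mfderiv_compose[OF L L' sG sF' q, of w] mfderiv_cong[OF L q FG, where M=S] by (simp only:)
    then have "pullback_metric L L' ?G (induced_metric L' M g) q u v =
        \<Omega> (?G q) * induced_metric S M g (F q) (mfderiv L S F q u) (mfderiv L S F q v)"
      unfolding pullback_metric_def section_metric[OF L' i' smooth_map_carrier[OF sG q]] FG[OF q] by (simp only:)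
    then show ?thesis
      using \<Omega>_pos[of q] unfolding section_metric[OF L i q] by (simp del: o_apply)
  qed
  have k: "symmetric_tensor L (pullback_metric L L' ?G (induced_metric L' M g))"
    using symmetric_tensor_pullback[OF L L' sG] h' by (simp add: riemannian_metric_def)
  have "smooth_map L real_line ?\<rho>" by (rule conformal_factor_smooth[OF L h k pb])
  moreover have "?\<rho> q > 0" for q using \<Omega>_pos by simp
  ultimately show conf: "conformal_map L (induced_metric L M g) L' (induced_metric L' M g) ?G"
    unfolding conformal_map_def using sG pb by (intro conjI exI[of _ ?\<rho>]) auto
  show "globally_conformally_related L (induced_metric L M g) L' (induced_metric L' M g)"
    unfolding globally_conformally_related_def using h h' G conf by blast
qed

lemma leaf_section:
  assumes "leaf \<Sigma> Scr L" shows "atlas L" "smooth_map L \<Sigma> (\<lambda>q. q)"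
  using assms smooth_manifold_atlas by (auto simp: leaf_def integral_manifold_def immersion_def id_def)

text \<open>The parameter \<open>t\<close> is locally constant on an integral manifold.\<close>

lemma integral_manifold_level_open:
  assumes L: "integral_manifold \<Sigma> Scr L"
  shows "openin (mtop L) {q \<in> carrier L. snd (inv_into (carrier \<O>) \<Phi> q) \<in> B}"
proof -
  have atl: "atlas L" and i: "smooth_map L \<Sigma> (\<lambda>q. q)"
    and range: "\<And>q. q \<in> carrier L \<Longrightarrow> range (mfderiv L \<Sigma> (\<lambda>q. q) q) = Scr q"
    using L smooth_manifold_atlas by (auto simp: integral_manifold_def immersion_def id_def)
  let ?w = "inv_into (carrier \<O>) \<Phi>"
  have w: "smooth_map L \<O> ?w" by (rule smooth_map_compose[OF atl atlas_\<Sigma> atlas_cylinder i smooth_\<Phi>_inverse])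
  \<comment> \<open>Vectors tangent to \<open>L\<close> lie in the screen distribution, hence are
    images of horizontal vectors of the cylinder. In coordinates the parameter thus has zero
    derivative on \<open>L\<close>.\<close>
  have vert: "snd (drep a (cyl_chart W b) ?w q u) = 0"
    if a: "a \<in> L" "q \<in> fst a" and b: "b \<in> S" "?w q \<in> fst (cyl_chart W b)" for a b q u
  proof -
    have q: "q \<in> carrier L" by (rule chart_dom_carrier[OF a])
    have q\<Sigma>: "q \<in> carrier \<Sigma>" by (rule smooth_map_carrier[OF i q])
    then obtain p t where pt: "(p, t) \<in> W" "q = \<Phi> (p, t)" by (auto simp: carrier_\<Sigma>)
    have zO: "(p, t) \<in> carrier \<O>" using pt by (simp add: carrier_cylinder)
    have wq: "?w q = (p, t)" using pt inv_\<Phi> by simp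
    let ?u = "from_chart L a q u"
    have "mfderiv L \<Sigma> (\<lambda>q. q) q ?u \<in> Scr q" using range[OF q] by blast
    then obtain v where v: "mfderiv L \<Sigma> (\<lambda>q. q) q ?u = mfderiv \<O> \<Sigma> \<Phi> (p, t) (v, 0)"
      using Scr_\<Phi>[OF pt(1)] pt(2) by auto
    have "mfderiv L \<O> ?w q ?u = mfderiv \<Sigma> \<O> ?w q (mfderiv L \<Sigma> (\<lambda>q. q) q ?u)"
      by (rule mfderiv_compose[OF atl atlas_\<Sigma> i smooth_\<Phi>_inverse q])
    also have "\<dots> = (v, 0)"
      unfolding v unfolding pt(2) by (rule mfderiv_diffeomorphism_inverse(1)[OF atlas_cylinder atlas_\<Sigma> diffeomorphism_\<Phi> zO])
    finally have d: "mfderiv L \<O> ?w q ?u = (v, 0)" .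
    have bO: "cyl_chart W b \<in> \<O>" using b by (simp add: cylinder_def)
    have "drep a (cyl_chart W b) ?w q u = to_chart \<O> (cyl_chart W b) (p, t) (v, 0)"
      using to_chart_mfderiv_from_chart[OF atl atlas_cylinder w a bO b(2), of u] unfolding d wq by (rule sym)
    moreover obtain c where c: "c \<in> S" "p \<in> fst c" "chart_at \<O> (p, t) = cyl_chart W c"
      using chart_at_cylinder[OF pt(1)] .
    have "p \<in> fst b" using b(2) wq by simp
    from drep_cyl_cyl[OF c(1,2) b(1) this pt(1), of "(v, 0)"]
    have "snd (to_chart \<O> (cyl_chart W b) (p, t) (v, 0)) = 0" unfolding to_chart_drep c(3) by simp
    ultimately show ?thesis by (simp only:)
  qed
  have "\<exists>T. openin (mtop L) T \<and> q \<in> T \<and> T \<subseteq> {q \<in> carrier L. snd (?w q) \<in> B}"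
    if q: "q \<in> carrier L" "snd (?w q) \<in> B" for q
  proof -
    obtain a where a: "a \<in> L" "q \<in> fst a" using q by (auto simp: carrier_def)
    have "?w q \<in> carrier \<O>" by (rule smooth_map_carrier[OF w q(1)])
    then obtain b where b: "b \<in> S" "?w q \<in> fst (cyl_chart W b)"
      unfolding carrier_def cylinder_def by blast
    have bO: "cyl_chart W b \<in> \<O>" using b by (simp add: cylinder_def)
    let ?X = "snd a ` {r \<in> fst a. ?w r \<in> fst (cyl_chart W b)}"
    let ?f = "\<lambda>x. snd ((snd (cyl_chart W b) \<circ> ?w \<circ> chart_inv a) x)"
    have X: "open ?X" by (rule smooth_map_open_rep[OF atl w a(1) openin_mtop_chart[OF bO]])
    have "snd a q \<in> ?X" using a b by (intro imageI) (simp only: mem_Collect_eq)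
    \<comment> \<open>A ball in the coordinates of \<open>L\<close> is convex, so a vanishing
      derivative forces the parameter to be constant on it.\<close>
    then obtain e where e: "e > 0" "ball (snd a q) e \<subseteq> ?X" using X openE by blast
    have D: "(?f has_derivative (\<lambda>h. 0)) (at x within ball (snd a q) e)" if x: "x \<in> ball (snd a q) e" for x
    proof -
      have "x \<in> ?X" using e x by blast
      then obtain r where r: "x = snd a r" "r \<in> {r \<in> fst a. ?w r \<in> fst (cyl_chart W b)}" by (rule imageE)
      then have r': "r \<in> fst a" "?w r \<in> fst (cyl_chart W b)" by (simp_all only: mem_Collect_eq)
      have "(?f has_derivative (\<lambda>h. snd (drep a (cyl_chart W b) ?w r h))) (at x)"
        unfolding r(1) by (rule has_derivative_snd[OF smooth_map_has_derivative[OF w a(1) bO r']])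
      then show ?thesis
        unfolding vert[OF a(1) r'(1) b(1) r'(2)] by (rule has_derivative_at_withinI)
    qed
    obtain k where k: "\<And>x. x \<in> ball (snd a q) e \<Longrightarrow> ?f x = k"
      using has_derivative_zero_constant[OF convex_ball D] by metis
    let ?T = "{r \<in> fst a. snd a r \<in> ball (snd a q) e}"
    have val: "?f (snd a r) = snd (?w r)" if r: "r \<in> fst a" for r
      using chart_inv_chart[OF atl a(1) r] by (simp add: case_prod_unfold)
    have "?T \<subseteq> {q \<in> carrier L. snd (?w q) \<in> B}"
    proof
      fix r assume r: "r \<in> ?T"
      have "snd (?w r) = k" using k[of "snd a r"] val[of r] r by simp
      moreover have "snd (?w q) = k" using k[of "snd a q"] val[OF a(2)] e(1) by simp
      ultimately show "r \<in> {q \<in> carrier L. snd (?w q) \<in> B}"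
        using q(2) chart_dom_carrier[OF a(1)] r by simp
    qed
    moreover have "openin (mtop L) ?T" by (rule openin_mtop_preimage[OF a(1) open_ball])
    moreover have "q \<in> ?T" using a(2) e(1) by simp
    ultimately show ?thesis by blast
  qed
  then show ?thesis by (subst openin_subopen) simp
qed

text \<open>A level set of the parameter and its complement are both open in the topology of
  \<open>L\<close> itself, which may be finer than that of \<Sigma>; connectedness is used in the
  same topology.\<close>

lemma connected_integral_manifold_level:
  assumes L: "integral_manifold \<Sigma> Scr L" and conn: "connected_space (mtop L)"
    and q: "q \<in> carrier L" "r \<in> carrier L"
  shows "snd (inv_into (carrier \<O>) \<Phi> q) = snd (inv_into (carrier \<O>) \<Phi> r)"
proof (rule ccontr)
  let ?\<tau> = "\<lambda>q. snd (inv_into (carrier \<O>) \<Phi> q)"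
  assume ne: "?\<tau> q \<noteq> ?\<tau> r"
  let ?A = "{s \<in> carrier L. ?\<tau> s \<in> {?\<tau> q}}" and ?B = "{s \<in> carrier L. ?\<tau> s \<in> - {?\<tau> q}}"
  have "openin (mtop L) ?A" "openin (mtop L) ?B"
    by (rule integral_manifold_level_open[OF L])+
  moreover have "topspace (mtop L) \<subseteq> ?A \<union> ?B" by auto
  moreover have "?A \<inter> ?B = {}" by auto
  moreover have "?A \<noteq> {}" using q by auto
  moreover have "?B \<noteq> {}" using q ne by auto
  ultimately have "openin (mtop L) ?A \<and> openin (mtop L) ?B \<and> topspace (mtop L) \<subseteq> ?A \<union> ?B \<and>
      ?A \<inter> ?B = {} \<and> ?A \<noteq> {} \<and> ?B \<noteq> {}" by (intro conjI)
  then have "\<exists>A B. openin (mtop L) A \<and> openin (mtop L) B \<and> topspace (mtop L) \<subseteq> A \<union> B \<and>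
      A \<inter> B = {} \<and> A \<noteq> {} \<and> B \<noteq> {}" by (rule exI[of _ ?B, THEN exI[of _ ?A]])
  then show False using conn unfolding connected_space_def by (rule notE[rotated])
qed

section \<open>The canonical leaf at a parameter of the common domain\<close>

context
  fixes t :: real
  assumes Dom: "\<And>p. p \<in> carrier S \<Longrightarrow> (p, t) \<in> W"
begin

abbreviation slice :: "'m \<Rightarrow> 'm" where "slice \<equiv> \<lambda>p. \<Phi> (p, t)"
abbreviation leaf_t :: "('m, 'a) mfld" where "leaf_t \<equiv> image_mfld slice S"

lemma inj_slice: "inj_on slice (carrier S)"
proof (rule inj_onI)
  fix p p' assume "p \<in> carrier S" "p' \<in> carrier S" "\<Phi> (p, t) = \<Phi> (p', t)"
  then have "(p, t) = (p', t)" using inj_onD[OF inj_\<Phi>, of "(p, t)" "(p', t)"] Dom by (simp add: carrier_cylinder)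
  then show "p = p'" by simp
qed

lemma atlas_leaf: "atlas leaf_t"
  by (rule atlas_image_mfld[OF S inj_slice])

lemma diffeomorphism_slice: "diffeomorphism S leaf_t slice"
  by (rule diffeomorphism_image_mfld[OF S inj_slice])

lemma F_slice: "p \<in> carrier S \<Longrightarrow> F (slice p) = p"
  using F_\<Phi>[OF Dom] .

lemma carrier_leaf: "carrier leaf_t = slice ` carrier S"
  by (rule carrier_image_mfld)

lemma diffeomorphism_F_leaf: "diffeomorphism leaf_t S F"
proof (rule diffeomorphism_cong[OF atlas_leaf diffeomorphism_inverse[OF S diffeomorphism_slice]])
  fix q assume "q \<in> carrier leaf_t"
  then obtain p where p: "p \<in> carrier S" "q = slice p" by (auto simp: carrier_leaf)
  show "F q = inv_into (carrier S) slice q"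
    unfolding p(2) F_slice[OF p(1)] using inv_into_f_f[OF inj_slice p(1)] by (rule sym)
qed

lemma smooth_slice_\<Sigma>: "smooth_map S \<Sigma> slice"
  by (rule smooth_map_compose[OF S atlas_cylinder atlas_\<Sigma> smooth_map_slice[OF Dom] smooth_\<Phi>_\<Sigma>])

text \<open>On the leaf, F is the inverse of \<open>slice\<close>, so the inclusion is
  \<open>slice\<close> after F.\<close>

lemma smooth_leaf_\<Sigma>: "smooth_map leaf_t \<Sigma> (\<lambda>q. q)"
proof -
  have "smooth_map leaf_t S F" using diffeomorphism_F_leaf by (simp add: diffeomorphism_def)
  from smooth_map_compose[OF atlas_leaf S atlas_\<Sigma> this smooth_slice_\<Sigma>]
  show ?thesis
    by (rule smooth_map_cong[OF atlas_leaf]) (auto simp: carrier_leaf F_slice simp del: o_apply)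
qed

lemma mfderiv_leaf_\<Sigma>:
  assumes p: "p \<in> carrier S"
  shows "mfderiv leaf_t \<Sigma> (\<lambda>q. q) (slice p) (mfderiv S leaf_t slice p v) =
     mfderiv \<O> \<Sigma> \<Phi> (p, t) (mfderiv S \<O> (\<lambda>p. (p, t)) p v)"
proof -
  have "smooth_map S leaf_t slice" using diffeomorphism_slice by (simp add: diffeomorphism_def)
  from mfderiv_compose[OF S atlas_leaf this smooth_leaf_\<Sigma> p, of v]
    mfderiv_compose[OF S atlas_cylinder smooth_map_slice[OF Dom] smooth_\<Phi>_\<Sigma> p, of v]
  show ?thesis by simp
qed

text \<open>Through the slice diffeomorphism the inclusion becomes the slice map of the cylinder
  followed by \<open>\<Phi>\<close>. The projection to \<open>S\<close> gives its differential a
  left inverse, and its range is the screen by construction.\<close>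

lemma integral_manifold_leaf:
  assumes "smooth_manifold S" shows "integral_manifold \<Sigma> Scr leaf_t"
proof -
  have surj: "\<exists>u. v = mfderiv S leaf_t slice p u" if "p \<in> carrier S" for p v
    using mfderiv_diffeomorphism_inverse(2)[OF S atlas_leaf diffeomorphism_slice that, of v] by metis
  have inj: "inj (mfderiv leaf_t \<Sigma> (\<lambda>q. q) q)" and range: "range (mfderiv leaf_t \<Sigma> (\<lambda>q. q) q) = Scr q"
    if q: "q \<in> carrier leaf_t" for q
  proof -
    obtain p where p: "p \<in> carrier S" "q = slice p" using q by (auto simp: carrier_leaf)
    have zO: "(p, t) \<in> carrier \<O>" using Dom[OF p(1)] by (simp add: carrier_cylinder)
    have fst: "mfderiv \<O> S fst (p, t) (mfderiv S \<O> (\<lambda>p. (p, t)) p v) = v" for v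
      using mfderiv_compose[OF S atlas_cylinder smooth_map_slice[OF Dom] smooth_map_cylinder_fst p(1), of v]
        mfderiv_ident[OF S p(1), of v] by simp
    show "inj (mfderiv leaf_t \<Sigma> (\<lambda>q. q) q)"
    proof (rule injI)
      fix x y assume eq: "mfderiv leaf_t \<Sigma> (\<lambda>q. q) q x = mfderiv leaf_t \<Sigma> (\<lambda>q. q) q y"
      obtain x' y' where xy: "x = mfderiv S leaf_t slice p x'" "y = mfderiv S leaf_t slice p y'"
        using surj[OF p(1)] by blast
      have "mfderiv S \<O> (\<lambda>p. (p, t)) p x' = mfderiv S \<O> (\<lambda>p. (p, t)) p y'"
        using eq mfderiv_diffeomorphism_inverse(1)[OF atlas_cylinder atlas_\<Sigma> diffeomorphism_\<Phi> zO]
        unfolding xy p(2) mfderiv_leaf_\<Sigma>[OF p(1)] by metis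
      then have "x' = y'" using fst by metis
      then show "x = y" using xy by simp
    qed
    have "range (mfderiv leaf_t \<Sigma> (\<lambda>q. q) q) = range (\<lambda>u. mfderiv leaf_t \<Sigma> (\<lambda>q. q) q (mfderiv S leaf_t slice p u))"
    proof (intro equalityI subsetI)
      fix w assume "w \<in> range (mfderiv leaf_t \<Sigma> (\<lambda>q. q) q)"
      then obtain v where v: "w = mfderiv leaf_t \<Sigma> (\<lambda>q. q) q v" by (rule rangeE)
      obtain u where "v = mfderiv S leaf_t slice p u" using surj[OF p(1), of v] by blast
      then show "w \<in> range (\<lambda>u. mfderiv leaf_t \<Sigma> (\<lambda>q. q) q (mfderiv S leaf_t slice p u))"
        using v by blast
    qed blast
    also have "\<dots> = mfderiv \<O> \<Sigma> \<Phi> (p, t) ` range (mfderiv S \<O> (\<lambda>p. (p, t)) p)"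
      unfolding p(2) mfderiv_leaf_\<Sigma>[OF p(1)] by (simp add: image_image)
    also have "\<dots> = Scr q"
      by (simp add: p(2) Scr_\<Phi>[OF Dom[OF p(1)]] range_mfderiv_slice[OF Dom[OF p(1)]])
    finally show "range (mfderiv leaf_t \<Sigma> (\<lambda>q. q) q) = Scr q" .
  qed
  then show ?thesis
    using smooth_manifold_image_mfld[OF assms inj_slice] smooth_leaf_\<Sigma>
    unfolding integral_manifold_def immersion_def id_def by blast
qed

text \<open>A larger connected integral manifold lies in a single parameter level, and since it
  contains the canonical leaf, that level is \<open>t\<close>.\<close>

lemma leaf_leaf:
  assumes S': "smooth_manifold S" and conn: "connected_space (mtop S)"
  shows "leaf \<Sigma> Scr leaf_t"
  unfolding leaf_def
proof (intro conjI allI impI)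
  show "integral_manifold \<Sigma> Scr leaf_t" by (rule integral_manifold_leaf[OF S'])
  show "connected_space (mtop leaf_t)"
    using homeomorphic_connected_space[OF diffeomorphism_homeomorphic[OF diffeomorphism_slice]] conn by simp
  fix L' :: "('m, 'a) mfld"
  assume L': "integral_manifold \<Sigma> Scr L' \<and> connected_space (mtop L') \<and> carrier leaf_t \<subseteq> carrier L'"
  have "q \<in> carrier leaf_t" if q: "q \<in> carrier L'" for q
  proof -
    have "smooth_map L' \<Sigma> (\<lambda>q. q)" using L' by (simp add: integral_manifold_def immersion_def id_def)
    then have "q \<in> carrier \<Sigma>" using q by (rule smooth_map_carrier)
    then obtain p s where ps: "(p, s) \<in> W" "q = \<Phi> (p, s)" by (auto simp: carrier_\<Sigma>)
    have p: "p \<in> carrier S" using ps by (simp add: W_iff)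
    \<comment> \<open>The point of the leaf on the same generator as \<open>q\<close>, used to
      compare parameters.\<close>
    have "slice p \<in> carrier L'" using L' p by (auto simp: carrier_leaf)
    then have "snd (inv_into (carrier \<O>) \<Phi> q) = snd (inv_into (carrier \<O>) \<Phi> (slice p))"
      using connected_integral_manifold_level[of L' q] L' q by blast
    then have "s = t" unfolding ps(2) inv_\<Phi>[OF ps(1)] inv_\<Phi>[OF Dom[OF p]] by simp
    then show ?thesis using ps p by (simp add: carrier_leaf)
  qed
  then show "carrier L' = carrier leaf_t" using L' by blast
qed

end

end

text \<open>That \<open>S\<close> is spacelike is expressed by the induced metric being Riemannian.
  The third conjunct shows that canonical leaves meet the hypotheses of the second, from which the
  fourth follows.\<close>

theorem theorem7p1:
  fixes M :: "('m, 'e::euclidean_space) mfld"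
    and S :: "('m, 'a::euclidean_space) mfld"
    and g :: "'m \<Rightarrow> 'e \<Rightarrow> 'e \<Rightarrow> real"
    and \<Gamma> :: "('m, 'e) christoffel"
    and T \<xi> :: "'m \<Rightarrow> 'e"
    and V :: "('m \<times> 'e) set"
    and \<O> :: "('m \<times> real, 'a \<times> real) mfld"
    and \<Phi> :: "'m \<times> real \<Rightarrow> 'm"
    and \<Sigma> :: "('m, 'a \<times> real) mfld"
    and F :: "'m \<Rightarrow> 'm"
    and U :: "'m \<Rightarrow> 'a \<times> real"
    and Scr :: "'m \<Rightarrow> ('a \<times> real) set"
    and \<mu> :: "'m \<Rightarrow> real"
    and Dom :: "real set"
    and canonical_leaf :: "real \<Rightarrow> ('m, 'a) mfld"
  assumes "DIM('e) \<ge> 4" and "DIM('e) = DIM('a) + 2"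
    and "spacetime M g T" and "levi_civita M g \<Gamma>"
    and "embedded_submanifold S M" and "connected_space (mtop S)"
    and "riemannian_metric S (induced_metric S M g)"
    and "lightlike_normal_field M g S \<xi>"
    and "normal_exp_neighborhood M g \<Gamma> S V"
    and "\<O> = flow_mfld S \<xi> V"
    and "\<Phi> = flow_map M \<Gamma> \<xi>"
    and "\<Sigma> = image_mfld \<Phi> \<O>"
    and "F = fst \<circ> inv_into (carrier \<O>) \<Phi>"
    and "U = push_dt \<O> \<Sigma> \<Phi>"
    and "Scr = screen_distribution S \<O> \<Sigma> \<Phi>"
    and "Dom = {t. \<forall>p\<in>carrier S. (p, t) \<in> carrier \<O>}"
    and "canonical_leaf = (\<lambda>t. image_mfld (\<lambda>p. \<Phi> (p, t)) S)"
    and "totally_umbilical_with M g \<Gamma> \<Sigma> U \<mu>"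
  shows
    "(\<forall>X Y. vector_field \<Sigma> X \<and> vector_field \<Sigma> Y \<longrightarrow>
        (\<forall>p t. (p, t) \<in> carrier \<O> \<longrightarrow>
           (let q = \<Phi> (p, t) in
              induced_metric \<Sigma> M g q (X q) (Y q) =
                exp (- 2 * (LBINT s=0..t. \<mu> (\<Phi> (p, s)))) *
                induced_metric S M g p (mfderiv \<Sigma> S F q (X q)) (mfderiv \<Sigma> S F q (Y q)))))
   \<and> (\<forall>(L :: ('m, 'a) mfld) (L' :: ('m, 'a) mfld).
        leaf \<Sigma> Scr L \<and> leaf \<Sigma> Scr L' \<and> diffeomorphism L S F \<and> diffeomorphism L' S F \<longrightarrow>
          conformal_map L (induced_metric L M g) L' (induced_metric L' M g)
            (inv_into (carrier L') F \<circ> F) \<and>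
          globally_conformally_related L (induced_metric L M g) L' (induced_metric L' M g))
   \<and> (\<forall>t\<in>Dom. leaf \<Sigma> Scr (canonical_leaf t) \<and> diffeomorphism (canonical_leaf t) S F)
   \<and> (\<forall>t\<in>Dom. \<forall>s\<in>Dom.
        conformal_map
          (canonical_leaf t) (induced_metric (canonical_leaf t) M g)
          (canonical_leaf s) (induced_metric (canonical_leaf s) M g)
          (inv_into (carrier (canonical_leaf s)) F \<circ> F) \<and>
        globally_conformally_related
          (canonical_leaf t) (induced_metric (canonical_leaf t) M g)
          (canonical_leaf s) (induced_metric (canonical_leaf s) M g))"
  proof -
  have manifold_S: "smooth_manifold S" using assms(5) by (simp add: embedded_submanifold_def)
  have \<O>: "\<O> = cylinder S (flow_domain S \<xi> V)" unfolding assms(10) by (rule flow_mfld_cylinder)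
  have E: "lightlike_emanation M S g \<Gamma> \<xi> V"
    using assms(2-5,8,9) unfolding lightlike_emanation_def spacetime_def by blast
  have "umbilical_emanation M S g \<Gamma> \<xi> V \<mu>"
    unfolding umbilical_emanation_def umbilical_emanation_axioms_def
    using E assms(18) unfolding assms(14) assms(12) assms(11) \<O> by blast
  then interpret E: umbilical_emanation M S g \<Gamma> \<xi> V \<mu> .
  have mem: "(p, t) \<in> carrier \<O> \<longleftrightarrow> (p, t) \<in> E.W" for p t unfolding \<O> E.carrier_cylinder ..
  have \<Sigma>: "\<Sigma> = E.\<Sigma>" unfolding assms(12) assms(11) \<O> ..
  have F: "F = E.F" unfolding assms(13) assms(11) \<O> ..
  have Scr: "Scr = E.Scr" unfolding assms(15) \<Sigma> \<O> assms(11) ..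
  have Dom: "(p, t) \<in> E.W" if "t \<in> Dom" "p \<in> carrier S" for p t
    using that unfolding assms(16) mem by blast
  have leaves: "leaf E.\<Sigma> E.Scr (canonical_leaf t)" "diffeomorphism (canonical_leaf t) S E.F" if "t \<in> Dom" for t
    unfolding assms(17) assms(11)
    using E.leaf_leaf[OF Dom[OF that] manifold_S assms(6)] E.diffeomorphism_F_leaf[OF Dom[OF that]] by blast+
  have conformal: "conformal_map L (induced_metric L M g) L' (induced_metric L' M g) (inv_into (carrier L') E.F \<circ> E.F) \<and>
      globally_conformally_related L (induced_metric L M g) L' (induced_metric L' M g)"
    if "leaf E.\<Sigma> E.Scr L" "leaf E.\<Sigma> E.Scr L'" "diffeomorphism L S E.F" "diffeomorphism L' S E.F"
    for L L' :: "('m, 'a) mfld"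
    using E.sections_conformal[OF assms(7) E.leaf_section[OF that(1)] that(3) E.leaf_section[OF that(2)] that(4)] by blast
  \<comment> \<open>Stated for single tangent vectors, the formula specialises to the values of any
    two fields at the point.\<close>
  have metric: "induced_metric E.\<Sigma> M g (\<Phi> (p, t)) x y = exp (- 2 * (LBINT s=0..t. \<mu> (\<Phi> (p, s)))) *
      induced_metric S M g p (mfderiv E.\<Sigma> S E.F (\<Phi> (p, t)) x) (mfderiv E.\<Sigma> S E.F (\<Phi> (p, t)) y)"
    if z: "(p, t) \<in> E.W" for p t x y
  proof -
    have "E.\<Phi> (p, t) \<in> carrier E.\<Sigma>" using z by (simp add: E.carrier_\<Sigma>)
    from E.induced_metric_conformal[OF this, of x y] show ?thesis
      unfolding E.\<Omega>_\<Phi>[OF z] E.F_\<Phi>[OF z] assms(11) .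
  qed
  show ?thesis
    unfolding \<Sigma> F Scr mem Let_def using metric conformal leaves by blast
qed

end
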